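(* There exist absolute constants $C_1,C_2,M>0$ and $\delta\in(0,1)$ such that the following holds for all positive integers $n,m$ with $m\geq Mn$ and every fixed $x_0\in\mathbb{C}^n$. Let $A\in\mathbb{C}^{m\times n}$ be a random matrix with rows $a_1^*,\dots,a_m^*$, whose entries are independent standard complex Gaussian variables, and let $b=|Ax_0|$. Let $z_0$ be a main eigenvector of $$\frac{1}{m}\sum_{i=1}^m|a_i^*x_0|^2\, a_ia_i^*\, 1_{|a_i^*x_0|^2\leq \frac{9}{m}\sum_{j=1}^m|a_j^*x_0|^2},$$ and define, for every integer $t\geq 1$, $$z_t=A^\dag\big(b\odot\mathrm{phase}(Az_{t-1})\big).$$ Then, with probability at least $1-C_1\exp(-C_2m)$, $$\forall t\in\mathbb{N},\ t\geq 1,\qquad \inf_{\phi\in\mathbb{R}}\|e^{i\phi}x_0-z_t\|\leq \delta^t\|x_0\|.$$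
   Context: Standard complex Gaussian: the real and imaginary parts are independent, each distributed as $\mathcal{N}(0,1/2)$. $a_i\in\mathbb{C}^n$ are column vectors and $a_i^*$ is the conjugate transpose, the $i$-th row of $A$. $|\cdot|$ of a complex vector is the entrywise modulus; $\odot$ is the entrywise product. For $z\in\mathbb{C}$, $\mathrm{phase}(z)=z/|z|$ if $z\neq 0$ and $\mathrm{phase}(0)=1$; it is applied entrywise to vectors. $A^\dag$ is the Moore-Penrose pseudo-inverse. $1_{\mathcal{P}}$ equals $1$ if condition $\mathcal{P}$ holds and $0$ otherwise. A main eigenvector of a Hermitian matrix is a (nonzero) eigenvector associated with its largest eigenvalue. $\|\cdot\|$ is the Euclidean norm. The constants do not depend on $n,m,x_0$. *)

theory Defs
  imports
    "HOL-Probability.Probability"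
    "Jordan_Normal_Form.Schur_Decomposition"
begin

no_notation Finite_Cartesian_Product.vec_nth (infixl \<open>$\<close> 90)
hide_const (open) Determinants.det Finite_Cartesian_Product.mat Finite_Cartesian_Product.row
  Finite_Cartesian_Product.vec

(* normal_density takes the standard deviation as its second argument: sqrt (1/2) is variance 1/2. *)
definition std_complex_gaussian :: "complex measure" where
  "std_complex_gaussian =
     distr (density lborel (normal_density 0 (sqrt (1/2))) \<Otimes>\<^sub>M
            density lborel (normal_density 0 (sqrt (1/2))))
           borel (\<lambda>(x, y). Complex x y)"

(* Joint law of the entries of an m x n matrix with independent standard complex Gaussian
   entries; the matrix belonging to an outcome w is "mat m n w".  Working with this law instead
   of an arbitrary sample space keeps the constants of a theorem independent of the type of the
   sample space; see gaussian_entries_transfer for the passage to an arbitrary sample space. *)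
definition gaussian_entries :: "nat \<Rightarrow> nat \<Rightarrow> (nat \<times> nat \<Rightarrow> complex) measure" where
  "gaussian_entries m n = (\<Pi>\<^sub>M ij \<in> {..<m} \<times> {..<n}. std_complex_gaussian)"

lemma sets_std_complex_gaussian [measurable_cong]: "sets std_complex_gaussian = sets borel"
  by (simp add: std_complex_gaussian_def)

lemma gaussian_entries_transfer:
  fixes A :: "'w \<Rightarrow> complex mat"
  assumes "prob_space P" and "m > 0" and "n > 0"
    and indep: "prob_space.indep_vars P (\<lambda>_. borel) (\<lambda>ij w. A w $$ ij) ({..<m} \<times> {..<n})"
    and law: "\<And>ij. ij \<in> {..<m} \<times> {..<n} \<Longrightarrow> distr P borel (\<lambda>w. A w $$ ij) = std_complex_gaussian"
    and E: "E \<in> sets (gaussian_entries m n)"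
  shows "measure P {w \<in> space P. (\<lambda>ij \<in> {..<m} \<times> {..<n}. A w $$ ij) \<in> E}
       = measure (gaussian_entries m n) E"
proof -
  interpret prob_space P by fact
  let ?I = "{..<m} \<times> {..<n}"
  let ?X = "\<lambda>w. \<lambda>ij\<in>?I. A w $$ ij"
  have rv: "random_variable borel (\<lambda>w. A w $$ ij)" if "ij \<in> ?I" for ij
    using indep[unfolded indep_vars_def] that by (elim conjE) (erule bspec)
  have ne: "?I \<noteq> {}" using assms by auto
  have "distr P (Pi\<^sub>M ?I (\<lambda>_. borel)) ?X = (\<Pi>\<^sub>M ij\<in>?I. distr P borel (\<lambda>w. A w $$ ij))"
    by (rule iffD1[OF indep_vars_iff_distr_eq_PiM'[OF ne rv] indep])
  also have "\<dots> = gaussian_entries m n"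
    unfolding gaussian_entries_def by (intro PiM_cong law) auto
  finally have D: "distr P (Pi\<^sub>M ?I (\<lambda>_. borel)) ?X = gaussian_entries m n" .
  have X: "?X \<in> measurable P (Pi\<^sub>M ?I (\<lambda>_. borel))"
    by (rule measurable_restrict) (rule rv)
  have E': "E \<in> sets (Pi\<^sub>M ?I (\<lambda>_. borel))"
    using E unfolding D[symmetric] by simp
  have "measure (gaussian_entries m n) E = measure P (?X -` E \<inter> space P)"
    unfolding D[symmetric] using X E' by (rule measure_distr)
  also have "?X -` E \<inter> space P = {w \<in> space P. ?X w \<in> E}" by auto
  finally show ?thesis by simp
qed

definition phase :: "complex \<Rightarrow> complex" where
  "phase z = (if z = 0 then 1 else z / complex_of_real (cmod z))"

definition had_prod :: "complex vec \<Rightarrow> complex vec \<Rightarrow> complex vec"  (infixl \<open>\<odot>\<^sub>v\<close> 70) where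
  "u \<odot>\<^sub>v v = vec (dim_vec u) (\<lambda>i. u $ i * v $ i)"

definition abs_cvec :: "complex vec \<Rightarrow> complex vec" where
  "abs_cvec v = map_vec (\<lambda>z. complex_of_real (cmod z)) v"

definition norm_cvec :: "complex vec \<Rightarrow> real" where
  "norm_cvec v = L2_set (\<lambda>i. cmod (v $ i)) {..<dim_vec v}"

definition moore_penrose :: "complex mat \<Rightarrow> complex mat \<Rightarrow> bool" where
  "moore_penrose A X \<longleftrightarrow>
     X \<in> carrier_mat (dim_col A) (dim_row A) \<and>
     A * X * A = A \<and> X * A * X = X \<and>
     mat_adjoint (A * X) = A * X \<and> mat_adjoint (X * A) = X * A"

lemma mat_adjoint_mult:
  fixes B C :: "complex mat"
  assumes B: "B \<in> carrier_mat r s" and C: "C \<in> carrier_mat s t"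
  shows "mat_adjoint (B * C) = mat_adjoint C * mat_adjoint B"
  using B C
  by (intro eq_matI)
     (auto simp: mat_adjoint_def mat_of_rows_def scalar_prod_def mult.commute intro!: sum.cong)

lemma moore_penrose_unique:
  assumes X: "moore_penrose A X" and Y: "moore_penrose A Y"
  shows "X = Y"
proof -
  define m n where "m = dim_row A" and "n = dim_col A"
  have A: "A \<in> carrier_mat m n" and cX: "X \<in> carrier_mat n m" and cY: "Y \<in> carrier_mat n m"
    using X Y by (auto simp: m_def n_def moore_penrose_def)
  have x: "A * X * A = A" "X * A * X = X" "mat_adjoint (A * X) = A * X" "mat_adjoint (X * A) = X * A"
    and y: "A * Y * A = A" "Y * A * Y = Y" "mat_adjoint (A * Y) = A * Y" "mat_adjoint (Y * A) = Y * A"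
    using X Y by (simp_all only: moore_penrose_def)
  have "A * X = mat_adjoint ((A * Y * A) * X)" by (simp only: x y)
  also have "(A * Y * A) * X = (A * Y) * (A * X)"
    using A cX cY by (intro assoc_mult_mat) auto
  also have "mat_adjoint \<dots> = mat_adjoint (A * X) * mat_adjoint (A * Y)"
    using A cX cY by (intro mat_adjoint_mult) auto
  also have "\<dots> = (A * X * A) * Y"
    unfolding x(3) y(3) using A cX cY by (intro assoc_mult_mat[symmetric]) auto
  finally have AXY: "A * X = A * Y" by (simp only: x)
  have "X * A = mat_adjoint (X * (A * Y * A))" by (simp only: x y)
  also have "X * (A * Y * A) = (X * A) * (Y * A)"
    using A cX cY by (smt (verit) assoc_mult_mat mult_carrier_mat)
  also have "mat_adjoint \<dots> = mat_adjoint (Y * A) * mat_adjoint (X * A)"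
    using A cX cY by (intro mat_adjoint_mult) auto
  also have "\<dots> = Y * (A * X * A)"
    unfolding x(4) y(4) using A cX cY by (smt (verit) assoc_mult_mat mult_carrier_mat)
  finally have XAY: "X * A = Y * A" by (simp only: x)
  have "X = X * (A * X)" using x(2) A cX by (metis assoc_mult_mat)
  also have "\<dots> = (X * A) * Y" using A cX cY by (simp add: AXY assoc_mult_mat[of _ n m _ n _ m])
  also have "\<dots> = Y" by (simp only: XAY y)
  finally show ?thesis .
qed

definition pinv :: "complex mat \<Rightarrow> complex mat" where
  "pinv A = (THE X. moore_penrose A X)"

(* Meant for Hermitian H, all of whose eigenvalues are real. *)
definition main_eigenvector :: "complex mat \<Rightarrow> complex vec \<Rightarrow> bool" where
  "main_eigenvector H v \<longleftrightarrow>
     (\<exists>\<mu>::real. eigenvector H v (complex_of_real \<mu>) \<and>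
        (\<forall>\<nu>::real. eigenvalue H (complex_of_real \<nu>) \<longrightarrow> \<nu> \<le> \<mu>))"

(* The column vector a_i, whose conjugate transpose is the i-th row of A. *)
definition meas_vec :: "complex mat \<Rightarrow> nat \<Rightarrow> complex vec" where
  "meas_vec A i = conjugate (row A i)"

(* |a_i^* x|^2; note that (u \<bullet>c v) conjugates its second argument, so (x \<bullet>c a) = a^* x. *)
definition intensity :: "complex mat \<Rightarrow> complex vec \<Rightarrow> nat \<Rightarrow> real" where
  "intensity A x i = (cmod (x \<bullet>c meas_vec A i))\<^sup>2"

(* The (k, l) entry of a a^* is a_k * cnj a_l. *)
definition spectral_mat :: "complex mat \<Rightarrow> complex vec \<Rightarrow> complex mat" where
  "spectral_mat A x = (let m = dim_row A; n = dim_col A in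
     mat n n (\<lambda>(k, l).
       1 / of_nat m *
       (\<Sum>i<m. complex_of_real (intensity A x i) * (meas_vec A i $ k * cnj (meas_vec A i $ l)) *
              of_bool (intensity A x i \<le> 9 / real m * (\<Sum>j<m. intensity A x j)))))"

primrec altproj :: "complex mat \<Rightarrow> complex vec \<Rightarrow> complex vec \<Rightarrow> nat \<Rightarrow> complex vec" where
  "altproj A b z0 0 = z0"
| "altproj A b z0 (Suc t) = pinv A *\<^sub>v (b \<odot>\<^sub>v map_vec phase (A *\<^sub>v altproj A b z0 t))"

end

theory Submission
  imports Defs
begin

text \<open>
  Scale so that \<open>x\<^sub>0\<close> becomes a unit vector \<open>u\<close>. For a row \<open>a\<close> of \<open>A\<close>, the pair \<open>(a u, a v)\<close> is distributed like
  \<open>(g, \<langle>v, u\<rangle> g + r g')\<close> with independent standard complex Gaussians \<open>g, g'\<close>; this comes from the invariance of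
  the law of \<open>(g, g')\<close> under \<open>SU(2)\<close>. Bernstein inequalities, a net of the unit ball and Lipschitz dependence
  on \<open>v\<close> then give, with overwhelming probability and uniformly in \<open>v\<close>, the bounds on which the rest is based.

  A step of the iteration starts from \<open>\<alpha> (u + v)\<close> with \<open>v\<close> orthogonal to \<open>u\<close>. To first order, replacing
  the phase of \<open>A (u + v)\<close> by that of \<open>A u\<close> costs only the component of \<open>A v\<close> orthogonal to the phase of \<open>A u\<close>
  in each entry, which carries half of the energy of \<open>A v\<close>. The entries
  where \<open>\<bar>A v\<bar>\<close> is not small compared with \<open>\<bar>A u\<bar>\<close> contribute little when \<open>v\<close> is small. Since the pseudo-inverse
  solves the least squares problem, a step therefore contracts the distance to the orbit of \<open>u\<close>. The truncated
  spectral matrix concentrates around a matrix with top eigenvector \<open>u\<close> and a spectral gap, so its main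
  eigenvector lies in the region where the contraction applies.
\<close>

section \<open>Unitary invariance of the complex Gaussian law\<close>

text \<open>Every iterate depends on all of \<open>A\<close>, so no step may treat \<open>A\<close>
  as independent of the current vector: each probabilistic bound holds for all \<open>v\<close> at
  once, and the rest is deterministic. A net argument wants statistics that are Lipschitz in
  \<open>A v\<close>; dependence on \<open>A u\<close> may jump, since \<open>u\<close> is fixed
  before the net. Two statistics need repair. The set of entries where \<open>A v\<close> is not
  small against \<open>A u\<close> jumps in \<open>v\<close>; it is covered by an event about
  \<open>A u\<close> alone and a Lipschitz tail of \<open>A v\<close>. The truncation level of the
  spectral matrix is random; it is enclosed between 9 - h and 9 + h. The gap comes from truncated
  moments: the expected form is at least 4/3 at \<open>u\<close> and at most 1 orthogonally to it.

  One step multiplies the squared error by at most (0.04 + 0.51 / 0.81) / (0.99 * 0.81), which is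
  below the square of 19/20: 0.51 is the half energy with a margin, 0.04 the price of the bad
  entries, 0.99 the lower singular value bound, and each 0.81 comes from a modulus or real part kept
  above 9/10. The length of the starting eigenvector is irrelevant because \<open>phase\<close>
  ignores positive factors.\<close>

abbreviation "scg \<equiv> std_complex_gaussian"

lemma measurable_Complex[measurable]:
  "(\<lambda>(x, y). Complex x y) \<in> borel \<Otimes>\<^sub>M borel \<rightarrow>\<^sub>M borel"
  by (simp add: Complex_eq split_beta)

lemma prob_space_scg: "prob_space scg"
proof -
  interpret N: prob_space "density lborel (normal_density 0 (sqrt (1/2)))"
    by (rule prob_space_normal_density) simp
  interpret P: pair_prob_space "density lborel (normal_density 0 (sqrt (1/2)))" "density lborel (normal_density 0 (sqrt (1/2)))" ..
  show ?thesis unfolding std_complex_gaussian_def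
    by (rule P.prob_space_distr) simp
qed

lemma distr_Complex_lborel:
  "distr (lborel \<Otimes>\<^sub>M lborel) borel (\<lambda>(x, y). Complex x y) = lborel"
proof (rule lborel_eqI[symmetric])
  fix l u :: complex
  assume le: "\<And>b. b \<in> Basis \<Longrightarrow> l \<bullet> b \<le> u \<bullet> b"
  have lu: "Re l \<le> Re u" "Im l \<le> Im u"
    using le[of 1] le[of \<i>] by (auto simp: Basis_complex_def)
  have "(\<lambda>(x, y). Complex x y) -` box l u \<inter> space (lborel \<Otimes>\<^sub>M lborel) =
      {Re l<..<Re u} \<times> {Im l<..<Im u}"
    by (auto simp: in_box_complex_iff space_pair_measure)
  then show "emeasure (distr (lborel \<Otimes>\<^sub>M lborel) borel (\<lambda>(x, y). Complex x y)) (box l u)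
      = (\<Prod>b\<in>Basis. (u - l) \<bullet> b)"
    using lu by (subst emeasure_distr)
      (auto simp: lborel.emeasure_pair_measure_Times Basis_complex_def ennreal_mult')
qed simp

definition gauss_density :: "complex \<Rightarrow> ennreal" where
  "gauss_density z = ennreal (exp (- (cmod z)\<^sup>2) / pi)"

lemma gauss_density_measurable[measurable]: "gauss_density \<in> borel_measurable borel"
  unfolding gauss_density_def by measurable

lemma scg_density: "scg = density lborel gauss_density"
proof -
  let ?d = "normal_density 0 (sqrt (1/2))"
  have [simp]: "sigma_finite_measure (density lborel ?d)"
    using prob_space_normal_density[of "sqrt (1/2)" 0] 
    by (intro prob_space_imp_sigma_finite) simp
  have eq: "gauss_density (Complex x y) = ennreal (?d x) * ennreal (?d y)" for x y
  proof -
    have "?d x * ?d y = exp (- (cmod (Complex x y))\<^sup>2) / pi"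
      by (simp add: normal_density_def cmod_power2 exp_add[symmetric] real_sqrt_mult[symmetric] field_simps)
    then show ?thesis unfolding gauss_density_def by (simp add: ennreal_mult'[symmetric])
  qed
  have "scg = distr (density (lborel \<Otimes>\<^sub>M lborel) (\<lambda>(x, y). ennreal (?d x) * ennreal (?d y))) borel (\<lambda>(x, y). Complex x y)"
    unfolding std_complex_gaussian_def by (subst pair_measure_density) (auto simp: lborel.sigma_finite_measure_axioms)
  also have "\<dots> = distr (density (lborel \<Otimes>\<^sub>M lborel) (gauss_density \<circ> (\<lambda>(x, y). Complex x y))) borel (\<lambda>(x, y). Complex x y)"
    by (simp add: comp_def split_beta' eq)
  also have "\<dots> = density (distr (lborel \<Otimes>\<^sub>M lborel) borel (\<lambda>(x, y). Complex x y)) gauss_density"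
    by (subst density_distr) (auto simp: comp_def)
  finally show ?thesis by (simp add: distr_Complex_lborel)
qed

lemma nn_integral_lborel_translate:
  fixes f :: "complex \<Rightarrow> ennreal"
  assumes [measurable]: "f \<in> borel_measurable borel"
  shows "(\<integral>\<^sup>+x. f (c + x) \<partial>lborel) = (\<integral>\<^sup>+x. f x \<partial>lborel)"
proof -
  have "(\<integral>\<^sup>+x. f x \<partial>lborel) = (\<integral>\<^sup>+x. f x \<partial>distr lborel borel ((+) c))"
    by (simp add: lborel_distr_plus)
  also have "\<dots> = (\<integral>\<^sup>+x. f (c + x) \<partial>lborel)" by (simp add: nn_integral_distr)
  finally show ?thesis by simp
qed

lemma lborel_pair_sigma: "pair_sigma_finite (lborel::complex measure) (lborel::complex measure)" ..

text \<open>For a fixed second coordinate a shear is a translation, so Tonelli and translation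
  invariance replace a change of variables with a Jacobian.\<close>

lemma nn_integral_shear1:
  fixes F :: "complex \<times> complex \<Rightarrow> ennreal"
  assumes [measurable]: "F \<in> borel_measurable (borel \<Otimes>\<^sub>M borel)"
  shows "(\<integral>\<^sup>+x. F (fst x + c * snd x, snd x) \<partial>(lborel \<Otimes>\<^sub>M lborel)) = (\<integral>\<^sup>+x. F x \<partial>(lborel \<Otimes>\<^sub>M lborel))"
proof -
  have "(\<integral>\<^sup>+x. F (fst x + c * snd x, snd x) \<partial>(lborel \<Otimes>\<^sub>M lborel)) =
      (\<integral>\<^sup>+y. \<integral>\<^sup>+x. F (c * y + x, y) \<partial>lborel \<partial>lborel)"
    by (subst pair_sigma_finite.nn_integral_snd[OF lborel_pair_sigma, symmetric]) (auto simp: add.commute)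
  also have "\<dots> = (\<integral>\<^sup>+y. \<integral>\<^sup>+x. F (x, y) \<partial>lborel \<partial>lborel)"
    by (intro nn_integral_cong nn_integral_lborel_translate) measurable
  also have "\<dots> = (\<integral>\<^sup>+x. F x \<partial>(lborel \<Otimes>\<^sub>M lborel))"
    by (subst pair_sigma_finite.nn_integral_snd[OF lborel_pair_sigma, symmetric]) auto
  finally show ?thesis .
qed

lemma nn_integral_shear2:
  fixes F :: "complex \<times> complex \<Rightarrow> ennreal"
  assumes [measurable]: "F \<in> borel_measurable (borel \<Otimes>\<^sub>M borel)"
  shows "(\<integral>\<^sup>+x. F (fst x, snd x + c * fst x) \<partial>(lborel \<Otimes>\<^sub>M lborel)) = (\<integral>\<^sup>+x. F x \<partial>(lborel \<Otimes>\<^sub>M lborel))"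
proof -
  have "(\<integral>\<^sup>+x. F (fst x, snd x + c * fst x) \<partial>(lborel \<Otimes>\<^sub>M lborel)) =
      (\<integral>\<^sup>+x. \<integral>\<^sup>+y. F (x, c * x + y) \<partial>lborel \<partial>lborel)"
    by (subst lborel.nn_integral_fst[symmetric]) (auto simp: add.commute)
  also have "\<dots> = (\<integral>\<^sup>+x. \<integral>\<^sup>+y. F (x, y) \<partial>lborel \<partial>lborel)"
    by (intro nn_integral_cong nn_integral_lborel_translate[where f="\<lambda>y. F (_, y)"]) measurable
  also have "\<dots> = (\<integral>\<^sup>+x. F x \<partial>(lborel \<Otimes>\<^sub>M lborel))"
    by (subst lborel.nn_integral_fst[symmetric]) auto
  finally show ?thesis .
qed

text \<open>A 2 by 2 matrix of determinant 1 with nonzero lower left entry \<open>q\<close> is a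
  product of three shears with parameters \<open>p\<close>, \<open>q\<close>, \<open>r\<close>.
  Matching the diagonal entries forces \<open>p * q = \<alpha> - 1\<close> and
  \<open>r * q = cnj \<alpha> - 1\<close>; the determinant condition then yields the upper right
  entry \<open>\<beta>\<close>. Dividing by \<open>q\<close> is why \<open>\<beta>\<close> must not
  vanish here.\<close>

lemma nn_integral_SU2_lborel:
  fixes F :: "complex \<times> complex \<Rightarrow> ennreal"
  assumes F[measurable]: "F \<in> borel_measurable (borel \<Otimes>\<^sub>M borel)"
    and ab: "(cmod \<alpha>)\<^sup>2 + (cmod \<beta>)\<^sup>2 = 1" and b: "\<beta> \<noteq> 0"
  shows "(\<integral>\<^sup>+x. F (\<alpha> * fst x + \<beta> * snd x, - cnj \<beta> * fst x + cnj \<alpha> * snd x) \<partial>(lborel \<Otimes>\<^sub>M lborel))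
     = (\<integral>\<^sup>+x. F x \<partial>(lborel \<Otimes>\<^sub>M lborel))"
proof -
  define q where "q = - cnj \<beta>"
  define p where "p = (\<alpha> - 1) / q"
  define r where "r = (cnj \<alpha> - 1) / q"
  have q0: "q \<noteq> 0" using b by (simp add: q_def)
  have pq: "p * q = \<alpha> - 1" "r * q = cnj \<alpha> - 1" using q0 by (auto simp: p_def r_def)
  have "\<alpha> * cnj \<alpha> + \<beta> * cnj \<beta> = 1"
    using ab by (metis complex_norm_square of_real_1 of_real_add)
  then have aa: "\<alpha> * cnj \<alpha> - 1 = \<beta> * q" by (simp add: q_def algebra_simps)
  have "(r * (1 + p * q) + p) * q = \<beta> * q"
  proof -
    have "(r * (1 + p * q) + p) * q = (r * q) * (1 + p * q) + p * q" by (simp add: algebra_simps)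
    also have "\<dots> = \<beta> * q" unfolding pq using aa by (simp add: algebra_simps)
    finally show ?thesis .
  qed
  then have B: "r * (1 + p * q) + p = \<beta>" using q0 by simp
  define G1 where "G1 = (\<lambda>x. F (fst x + p * snd x, snd x))"
  define G2 where "G2 = (\<lambda>x. G1 (fst x, snd x + q * fst x))"
  have [measurable]: "G1 \<in> borel_measurable (borel \<Otimes>\<^sub>M borel)" "G2 \<in> borel_measurable (borel \<Otimes>\<^sub>M borel)"
    unfolding G2_def G1_def by measurable
  have "F (\<alpha> * fst x + \<beta> * snd x, - cnj \<beta> * fst x + cnj \<alpha> * snd x) = G2 (fst x + r * snd x, snd x)" for x
  proof -
    have 1: "\<alpha> = 1 + p * q" "cnj \<alpha> = 1 + r * q" "- cnj \<beta> = q" using pq by (auto simp: q_def)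
    show ?thesis unfolding G2_def G1_def 1(3) unfolding 1(2) unfolding 1(1) B[symmetric]
      by (simp add: algebra_simps)
  qed
  then have "(\<integral>\<^sup>+x. F (\<alpha> * fst x + \<beta> * snd x, - cnj \<beta> * fst x + cnj \<alpha> * snd x) \<partial>(lborel \<Otimes>\<^sub>M lborel))
     = (\<integral>\<^sup>+x. G2 (fst x + r * snd x, snd x) \<partial>(lborel \<Otimes>\<^sub>M lborel))" by simp
  also have "\<dots> = (\<integral>\<^sup>+x. G2 x \<partial>(lborel \<Otimes>\<^sub>M lborel))" by (rule nn_integral_shear1) measurable
  also have "\<dots> = (\<integral>\<^sup>+x. G1 x \<partial>(lborel \<Otimes>\<^sub>M lborel))" unfolding G2_def by (rule nn_integral_shear2) measurable
  also have "\<dots> = (\<integral>\<^sup>+x. F x \<partial>(lborel \<Otimes>\<^sub>M lborel))" unfolding G1_def by (rule nn_integral_shear1) measurable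
  finally show ?thesis .
qed

lemma unitary2_norm:
  assumes "(cmod \<alpha>)\<^sup>2 + (cmod \<beta>)\<^sup>2 = 1"
  shows "(cmod (\<alpha> * x + \<beta> * y))\<^sup>2 + (cmod (- cnj \<beta> * x + cnj \<alpha> * y))\<^sup>2 = (cmod x)\<^sup>2 + (cmod y)\<^sup>2"
proof -
  have "(cmod (\<alpha> * x + \<beta> * y))\<^sup>2 + (cmod (- cnj \<beta> * x + cnj \<alpha> * y))\<^sup>2
     = ((cmod \<alpha>)\<^sup>2 + (cmod \<beta>)\<^sup>2) * ((cmod x)\<^sup>2 + (cmod y)\<^sup>2)"
    by (simp only: cmod_power2 complex_cnj plus_complex.sel times_complex.sel uminus_complex.sel cnj.sel)
      (simp add: algebra_simps power2_eq_square)
  with assms show ?thesis by simp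
qed

lemma nn_integral_SU2_scg:
  fixes F :: "complex \<times> complex \<Rightarrow> ennreal"
  assumes F[measurable]: "F \<in> borel_measurable (borel \<Otimes>\<^sub>M borel)"
    and ab: "(cmod \<alpha>)\<^sup>2 + (cmod \<beta>)\<^sup>2 = 1" and b: "\<beta> \<noteq> 0"
  shows "(\<integral>\<^sup>+x. F (\<alpha> * fst x + \<beta> * snd x, - cnj \<beta> * fst x + cnj \<alpha> * snd x) \<partial>(scg \<Otimes>\<^sub>M scg))
     = (\<integral>\<^sup>+x. F x \<partial>(scg \<Otimes>\<^sub>M scg))"
proof -
  let ?g = "\<lambda>(x, y). gauss_density x * gauss_density y"
  have sf: "sigma_finite_measure (density lborel gauss_density)"
    using prob_space_scg unfolding scg_density by (rule prob_space_imp_sigma_finite)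
  have d: "scg \<Otimes>\<^sub>M scg = density (lborel \<Otimes>\<^sub>M lborel) ?g"
    unfolding scg_density by (rule pair_measure_density) (auto simp: sf lborel.sigma_finite_measure_axioms)
  have g: "?g x = ennreal (exp (- ((cmod (fst x))\<^sup>2 + (cmod (snd x))\<^sup>2)) / pi\<^sup>2)" for x
    by (auto simp: gauss_density_def split_beta ennreal_mult'[symmetric] exp_add[symmetric] power2_eq_square)
  have inv: "?g x = ?g (\<alpha> * fst x + \<beta> * snd x, - cnj \<beta> * fst x + cnj \<alpha> * snd x)" for x
    unfolding g fst_conv snd_conv unitary2_norm[OF ab] ..
  have "(\<integral>\<^sup>+x. F (\<alpha> * fst x + \<beta> * snd x, - cnj \<beta> * fst x + cnj \<alpha> * snd x) \<partial>(scg \<Otimes>\<^sub>M scg))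
     = (\<integral>\<^sup>+x. ?g x * F (\<alpha> * fst x + \<beta> * snd x, - cnj \<beta> * fst x + cnj \<alpha> * snd x) \<partial>(lborel \<Otimes>\<^sub>M lborel))"
    unfolding d by (rule nn_integral_density) measurable
  also have "\<dots> = (\<integral>\<^sup>+x. (\<lambda>x. ?g x * F x) (\<alpha> * fst x + \<beta> * snd x, - cnj \<beta> * fst x + cnj \<alpha> * snd x) \<partial>(lborel \<Otimes>\<^sub>M lborel))"
    by (intro nn_integral_cong) (subst inv, rule refl)
  also have "\<dots> = (\<integral>\<^sup>+x. ?g x * F x \<partial>(lborel \<Otimes>\<^sub>M lborel))"
    by (rule nn_integral_SU2_lborel[OF _ ab b]) measurable
  also have "\<dots> = (\<integral>\<^sup>+x. F x \<partial>(scg \<Otimes>\<^sub>M scg))"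
    unfolding d by (rule nn_integral_density[symmetric]) measurable
  finally show ?thesis .
qed

lemma nn_integral_SU2:
  fixes F :: "complex \<times> complex \<Rightarrow> ennreal"
  assumes F[measurable]: "F \<in> borel_measurable (borel \<Otimes>\<^sub>M borel)"
    and ab: "(cmod \<alpha>)\<^sup>2 + (cmod \<beta>)\<^sup>2 = 1"
  shows "(\<integral>\<^sup>+x. F (\<alpha> * fst x + \<beta> * snd x, - cnj \<beta> * fst x + cnj \<alpha> * snd x) \<partial>(scg \<Otimes>\<^sub>M scg))
     = (\<integral>\<^sup>+x. F x \<partial>(scg \<Otimes>\<^sub>M scg))"
proof (cases "\<beta> = 0")
  case True
  \<comment> \<open>The diagonal matrix with entries \<open>\<alpha>\<close> and
    \<open>cnj \<alpha>\<close> is the product of two matrices with zero diagonal, and each of them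
    has a nonzero upper right entry.\<close>
  define G where "G = (\<lambda>x. F (0 * fst x + (- \<alpha>) * snd x, - cnj (- \<alpha>) * fst x + cnj 0 * snd x))"
  have [measurable]: "G \<in> borel_measurable (borel \<Otimes>\<^sub>M borel)" unfolding G_def by measurable
  have "(\<integral>\<^sup>+x. F (\<alpha> * fst x + \<beta> * snd x, - cnj \<beta> * fst x + cnj \<alpha> * snd x) \<partial>(scg \<Otimes>\<^sub>M scg))
    = (\<integral>\<^sup>+x. G (0 * fst x + 1 * snd x, - cnj 1 * fst x + cnj 0 * snd x) \<partial>(scg \<Otimes>\<^sub>M scg))"
    using True by (simp add: G_def)
  also have "\<dots> = (\<integral>\<^sup>+x. G x \<partial>(scg \<Otimes>\<^sub>M scg))" by (rule nn_integral_SU2_scg) auto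
  also have "\<dots> = (\<integral>\<^sup>+x. F x \<partial>(scg \<Otimes>\<^sub>M scg))"
    unfolding G_def by (rule nn_integral_SU2_scg) (use True ab in auto)
  finally show ?thesis .
qed (use assms nn_integral_SU2_scg in blast)

lemma pair_sigma_scg: "pair_sigma_finite scg scg"
  using prob_space_scg by (simp add: pair_sigma_finite_def prob_space_imp_sigma_finite)

lemma sigma_scg: "sigma_finite_measure scg"
  using prob_space_scg by (simp add: prob_space_imp_sigma_finite)

text \<open>Rotate the two Gaussians so that the first form becomes \<open>\<rho>\<close> times the
  first new coordinate; \<open>c'\<close>, \<open>d'\<close> are the coefficients of the second form
  in the new coordinates. A rotation preserves norms and inner products of the coefficient vectors,
  which gives the two equations. If \<open>\<rho> = 0\<close> the first form is zero and nothing has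
  to be rotated.\<close>

lemma combine_gaussians:
  fixes a b c d :: complex
  defines "\<rho> \<equiv> complex_of_real (sqrt ((cmod a)\<^sup>2 + (cmod b)\<^sup>2))"
  obtains c' d' where "(cmod c')\<^sup>2 + (cmod d')\<^sup>2 = (cmod c)\<^sup>2 + (cmod d)\<^sup>2"
    "\<rho> * cnj c' = a * cnj c + b * cnj d"
    "\<And>F. F \<in> borel_measurable (borel \<Otimes>\<^sub>M borel) \<Longrightarrow>
      (\<integral>\<^sup>+x. \<integral>\<^sup>+y. F (a * x + b * y, c * x + d * y) \<partial>scg \<partial>scg)
      = (\<integral>\<^sup>+x. \<integral>\<^sup>+y. (F (\<rho> * x, c' * x + d' * y) :: ennreal) \<partial>scg \<partial>scg)"
proof (cases "\<rho> = 0")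
  case True
  then have "(cmod a)\<^sup>2 + (cmod b)\<^sup>2 = 0" by (simp add: \<rho>_def)
  then have "a = 0" "b = 0" by (auto simp: sum_power2_eq_zero_iff)
  with True show ?thesis by (intro that[of c d]) auto
next
  case False
  define \<alpha> \<beta> where "\<alpha> = a / \<rho>" and "\<beta> = b / \<rho>"
  have \<rho>2: "(cmod \<rho>)\<^sup>2 = (cmod a)\<^sup>2 + (cmod b)\<^sup>2" by (simp add: \<rho>_def)
  have ab: "(cmod \<alpha>)\<^sup>2 + (cmod \<beta>)\<^sup>2 = 1"
    using False by (simp add: \<alpha>_def \<beta>_def norm_divide power_divide add_divide_distrib[symmetric] \<rho>2[symmetric])
  then have ab': "\<alpha> * cnj \<alpha> + \<beta> * cnj \<beta> = 1"
    by (metis complex_norm_square of_real_1 of_real_add)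
  have r: "a = \<rho> * \<alpha>" "b = \<rho> * \<beta>" using False by (auto simp: \<alpha>_def \<beta>_def)
  define c' d' where "c' = c * cnj \<alpha> + d * cnj \<beta>" and "d' = d * \<alpha> - c * \<beta>"
  have cn: "cnj \<rho> = \<rho>" by (simp add: \<rho>_def)
  show ?thesis
  proof (rule that[of c' d'])
    show "(cmod c')\<^sup>2 + (cmod d')\<^sup>2 = (cmod c)\<^sup>2 + (cmod d)\<^sup>2"
      using unitary2_norm[of "cnj \<alpha>" "cnj \<beta>" c d] ab by (simp add: c'_def d'_def algebra_simps)
    show "\<rho> * cnj c' = a * cnj c + b * cnj d"
      by (simp add: c'_def r cn algebra_simps)
    fix F :: "complex \<times> complex \<Rightarrow> ennreal"
    assume F[measurable]: "F \<in> borel_measurable (borel \<Otimes>\<^sub>M borel)"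
    define G where "G = (\<lambda>x. F (\<rho> * fst x, c' * fst x + d' * snd x))"
    have [measurable]: "G \<in> borel_measurable (borel \<Otimes>\<^sub>M borel)" unfolding G_def by measurable
    have e: "c * x + d * y = c' * (\<alpha> * x + \<beta> * y) + d' * (- cnj \<beta> * x + cnj \<alpha> * y)" for x y
    proof -
      have "c' * (\<alpha> * x + \<beta> * y) + d' * (- cnj \<beta> * x + cnj \<alpha> * y) = (c * x + d * y) * (\<alpha> * cnj \<alpha> + \<beta> * cnj \<beta>)"
        unfolding c'_def d'_def by (simp add: algebra_simps)
      then show ?thesis by (simp add: ab')
    qed
    have "(\<integral>\<^sup>+x. \<integral>\<^sup>+y. F (a * x + b * y, c * x + d * y) \<partial>scg \<partial>scg)
      = (\<integral>\<^sup>+x. F (a * fst x + b * snd x, c * fst x + d * snd x) \<partial>(scg \<Otimes>\<^sub>M scg))"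
      by (subst sigma_finite_measure.nn_integral_fst[OF sigma_scg, symmetric]) auto
    also have "\<dots> = (\<integral>\<^sup>+x. G (\<alpha> * fst x + \<beta> * snd x, - cnj \<beta> * fst x + cnj \<alpha> * snd x) \<partial>(scg \<Otimes>\<^sub>M scg))"
      unfolding G_def fst_conv snd_conv e[symmetric] r by (simp add: algebra_simps)
    also have "\<dots> = (\<integral>\<^sup>+x. G x \<partial>(scg \<Otimes>\<^sub>M scg))" by (rule nn_integral_SU2[OF _ ab]) measurable
    also have "\<dots> = (\<integral>\<^sup>+x. \<integral>\<^sup>+y. F (\<rho> * x, c' * x + d' * y) \<partial>scg \<partial>scg)"
      unfolding G_def by (subst sigma_finite_measure.nn_integral_fst[OF sigma_scg, symmetric]) auto
    finally show "(\<integral>\<^sup>+x. \<integral>\<^sup>+y. F (a * x + b * y, c * x + d * y) \<partial>scg \<partial>scg)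
      = (\<integral>\<^sup>+x. \<integral>\<^sup>+y. F (\<rho> * x, c' * x + d' * y) \<partial>scg \<partial>scg)" .
  qed
qed

text \<open>Vectors are functions on all naturals of which only the first \<open>n\<close> values
  are read. There is no conjugation, because a row of \<open>A\<close> already consists of the
  conjugated entries of the measurement vector.\<close>

definition lin :: "nat \<Rightarrow> (nat \<Rightarrow> complex) \<Rightarrow> (nat \<Rightarrow> complex) \<Rightarrow> complex" where
  "lin n a v = (\<Sum>j<n. a j * v j)"

definition nsq :: "nat \<Rightarrow> (nat \<Rightarrow> complex) \<Rightarrow> real" where
  "nsq n v = (\<Sum>j<n. (cmod (v j))\<^sup>2)"

definition inn :: "nat \<Rightarrow> (nat \<Rightarrow> complex) \<Rightarrow> (nat \<Rightarrow> complex) \<Rightarrow> complex" where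
  "inn n u v = (\<Sum>j<n. u j * cnj (v j))"

definition gauss_row :: "nat \<Rightarrow> (nat \<Rightarrow> complex) measure" where
  "gauss_row n = (\<Pi>\<^sub>M j \<in> {..<n}. scg)"

lemma nsq_nonneg[simp]: "nsq n v \<ge> 0"
  by (simp add: nsq_def sum_nonneg)

lemma product_sigma_scg: "product_sigma_finite (\<lambda>_. scg)"
  by (simp add: product_sigma_finite_def sigma_scg)

lemma lin_measurable[measurable]: "(\<lambda>a. lin n a v) \<in> gauss_row n \<rightarrow>\<^sub>M borel"
  unfolding lin_def gauss_row_def by measurable

text \<open>Joint law of two linear forms of a Gaussian row. In the induction a new coordinate
  \<open>h\<close> joins the two Gaussians \<open>x\<close>, \<open>y\<close> that represent the
  shorter forms, and two rotations bring the three back to two. The coefficients \<open>q\<close>,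
  \<open>r\<close> come before the quantifier over \<open>F\<close>, so that one representation
  serves all integrands.\<close>

lemma nn_integral_lin_pair:
  "\<exists>q r. complex_of_real (sqrt (nsq n u)) * cnj q = inn n u v \<and> (cmod q)\<^sup>2 + (cmod r)\<^sup>2 = nsq n v \<and>
    (\<forall>F. F \<in> borel_measurable (borel \<Otimes>\<^sub>M borel) \<longrightarrow>
      (\<integral>\<^sup>+a. F (lin n a u, lin n a v) \<partial>gauss_row n)
      = (\<integral>\<^sup>+x. \<integral>\<^sup>+y. (F (complex_of_real (sqrt (nsq n u)) * x, q * x + r * y) :: ennreal) \<partial>scg \<partial>scg))"
proof (induction n)
  case 0
  interpret prob_space scg by (rule prob_space_scg)
  interpret product_sigma_finite "\<lambda>_. scg" by (rule product_sigma_scg)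
  have "(\<integral>\<^sup>+a. F (lin 0 a u, lin 0 a v) \<partial>gauss_row 0) = F (0, 0)" for F :: "complex \<times> complex \<Rightarrow> ennreal"
    unfolding gauss_row_def lessThan_0 by (subst nn_integral_empty) (simp_all add: lin_def)
  then show ?case
    by (intro exI[of _ 0]) (simp add: nsq_def inn_def emeasure_space_1)
next
  case (Suc n)
  interpret S: prob_space scg by (rule prob_space_scg)
  interpret product_sigma_finite "\<lambda>_. scg" by (rule product_sigma_scg)
  define p where "p = complex_of_real (sqrt (nsq n u))"
  obtain q r where p: "p * cnj q = inn n u v" and qr: "(cmod q)\<^sup>2 + (cmod r)\<^sup>2 = nsq n v" and
    IH: "\<And>F. F \<in> borel_measurable (borel \<Otimes>\<^sub>M borel) \<Longrightarrow>
      (\<integral>\<^sup>+a. F (lin n a u, lin n a v) \<partial>gauss_row n)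
      = (\<integral>\<^sup>+x. \<integral>\<^sup>+y. (F (p * x, q * x + r * y) :: ennreal) \<partial>scg \<partial>scg)"
    using Suc unfolding p_def by blast
  define p' where "p' = complex_of_real (sqrt (nsq (Suc n) u))"
  have p': "complex_of_real (sqrt ((cmod p)\<^sup>2 + (cmod (u n))\<^sup>2)) = p'"
    by (simp add: p_def p'_def nsq_def sum_nonneg)
  \<comment> \<open>Rotation of \<open>x\<close> and \<open>h\<close>: afterwards the first form
    depends on one Gaussian only.\<close>
  obtain q' s where q's: "(cmod q')\<^sup>2 + (cmod s)\<^sup>2 = (cmod q)\<^sup>2 + (cmod (v n))\<^sup>2"
    "p' * cnj q' = p * cnj q + u n * cnj (v n)" and
    st1: "\<And>F. F \<in> borel_measurable (borel \<Otimes>\<^sub>M borel) \<Longrightarrow>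
      (\<integral>\<^sup>+x. \<integral>\<^sup>+y. F (p * x + u n * y, q * x + v n * y) \<partial>scg \<partial>scg)
      = (\<integral>\<^sup>+x. \<integral>\<^sup>+y. (F (p' * x, q' * x + s * y) :: ennreal) \<partial>scg \<partial>scg)"
    by (rule combine_gaussians[of q "v n" p "u n", unfolded p']) (rule that)
  define r' where "r' = complex_of_real (sqrt ((cmod s)\<^sup>2 + (cmod r)\<^sup>2))"
  \<comment> \<open>The second form still contains two independent Gaussians with coefficients
    \<open>s\<close> and \<open>r\<close>; taking the other form to be zero merges them into one
    with coefficient \<open>r'\<close>.\<close>
  have st2: "(\<integral>\<^sup>+x. \<integral>\<^sup>+y. F (s * x + r * y, 0 * x + 0 * y) \<partial>scg \<partial>scg)
      = (\<integral>\<^sup>+x. \<integral>\<^sup>+y. (F (r' * x, 0) :: ennreal) \<partial>scg \<partial>scg)"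
    if F: "F \<in> borel_measurable (borel \<Otimes>\<^sub>M borel)" for F
  proof -
    obtain c' d' :: complex where a: "(cmod c')\<^sup>2 + (cmod d')\<^sup>2 = (cmod 0)\<^sup>2 + (cmod 0)\<^sup>2"
      and "r' * cnj c' = s * cnj 0 + r * cnj 0" and
      b: "\<And>F. F \<in> borel_measurable (borel \<Otimes>\<^sub>M borel) \<Longrightarrow>
      (\<integral>\<^sup>+x. \<integral>\<^sup>+y. (F (s * x + r * y, 0 * x + 0 * y)::ennreal) \<partial>scg \<partial>scg)
      = (\<integral>\<^sup>+x. \<integral>\<^sup>+y. F (r' * x, c' * x + d' * y) \<partial>scg \<partial>scg)"
      by (rule combine_gaussians[of 0 0 s r, folded r'_def]) (rule that)
    have "c' = 0" "d' = 0" using a by (auto simp: sum_power2_eq_zero_iff)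
    then show ?thesis using b[OF F] by simp
  qed
  show ?case
  proof (rule exI[of _ q'], rule exI[of _ r'], intro conjI allI impI)
    show "complex_of_real (sqrt (nsq (Suc n) u)) * cnj q' = inn (Suc n) u v"
      using q's p by (simp add: p'_def[symmetric] inn_def)
    show "(cmod q')\<^sup>2 + (cmod r')\<^sup>2 = nsq (Suc n) v"
      using q's qr by (simp add: r'_def nsq_def)
    fix F :: "complex \<times> complex \<Rightarrow> ennreal"
    assume F[measurable]: "F \<in> borel_measurable (borel \<Otimes>\<^sub>M borel)"
    have m: "(\<lambda>a. F (lin (Suc n) a u, lin (Suc n) a v)) \<in> borel_measurable (\<Pi>\<^sub>M j \<in> insert n {..<n}. scg)"
      using lin_measurable[of "Suc n"] by (simp add: gauss_row_def lessThan_Suc) measurable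
    have m2: "(\<lambda>z. \<integral>\<^sup>+h. F (fst z + u n * h, snd z + v n * h) \<partial>scg) \<in> borel_measurable (borel \<Otimes>\<^sub>M borel)"
      by (rule S.borel_measurable_nn_integral) measurable
    have up: "lin (Suc n) (a(n := h)) w = lin n a w + w n * h" for a h w
      by (simp add: lin_def mult.commute)
    have "(\<integral>\<^sup>+a. F (lin (Suc n) a u, lin (Suc n) a v) \<partial>gauss_row (Suc n)) =
       (\<integral>\<^sup>+a. \<integral>\<^sup>+h. F (lin (Suc n) (a(n := h)) u, lin (Suc n) (a(n := h)) v) \<partial>scg \<partial>gauss_row n)"
      unfolding gauss_row_def lessThan_Suc by (subst product_nn_integral_insert[OF _ _ m]) simp_all
    also have "\<dots> = (\<integral>\<^sup>+a. (\<lambda>z. \<integral>\<^sup>+h. F (fst z + u n * h, snd z + v n * h) \<partial>scg) (lin n a u, lin n a v) \<partial>gauss_row n)"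
      by (simp add: up)
    also have "\<dots> = (\<integral>\<^sup>+x. \<integral>\<^sup>+y. \<integral>\<^sup>+h. F (p * x + u n * h, q * x + r * y + v n * h) \<partial>scg \<partial>scg \<partial>scg)"
      by (subst IH) (simp_all add: m2)
    also have "\<dots> = (\<integral>\<^sup>+y. \<integral>\<^sup>+x. \<integral>\<^sup>+h. F (p * x + u n * h, q * x + r * y + v n * h) \<partial>scg \<partial>scg \<partial>scg)"
      by (rule pair_sigma_finite.Fubini'[OF pair_sigma_scg]) measurable
    also have "\<dots> = (\<integral>\<^sup>+y. \<integral>\<^sup>+x. \<integral>\<^sup>+h. (\<lambda>z. F (fst z, snd z + r * y)) (p * x + u n * h, q * x + v n * h) \<partial>scg \<partial>scg \<partial>scg)"
      by (simp add: add_ac)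
    also have "\<dots> = (\<integral>\<^sup>+y. \<integral>\<^sup>+x. \<integral>\<^sup>+h. (\<lambda>z. F (fst z, snd z + r * y)) (p' * x, q' * x + s * h) \<partial>scg \<partial>scg \<partial>scg)"
      by (intro nn_integral_cong st1) measurable
    also have "\<dots> = (\<integral>\<^sup>+x. \<integral>\<^sup>+y. \<integral>\<^sup>+h. (\<lambda>z. F (fst z, snd z + r * y)) (p' * x, q' * x + s * h) \<partial>scg \<partial>scg \<partial>scg)"
      by (rule pair_sigma_finite.Fubini'[OF pair_sigma_scg]) measurable
    also have "\<dots> = (\<integral>\<^sup>+x. \<integral>\<^sup>+h. \<integral>\<^sup>+y. (\<lambda>z. F (fst z, snd z + r * y)) (p' * x, q' * x + s * h) \<partial>scg \<partial>scg \<partial>scg)"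
      by (intro nn_integral_cong pair_sigma_finite.Fubini'[OF pair_sigma_scg]) measurable
    also have "\<dots> = (\<integral>\<^sup>+x. \<integral>\<^sup>+h. \<integral>\<^sup>+y. (\<lambda>z. F (p' * x, q' * x + fst z)) (s * h + r * y, 0 * h + 0 * y) \<partial>scg \<partial>scg \<partial>scg)"
      by (simp add: add_ac)
    also have "\<dots> = (\<integral>\<^sup>+x. \<integral>\<^sup>+h. \<integral>\<^sup>+y. (\<lambda>z. F (p' * x, q' * x + fst z)) (r' * h, 0::complex) \<partial>scg \<partial>scg \<partial>scg)"
      by (intro nn_integral_cong st2) measurable

    also have "\<dots> = (\<integral>\<^sup>+x. \<integral>\<^sup>+y. F (p' * x, q' * x + r' * y) \<partial>scg \<partial>scg)"
      by (simp add: S.emeasure_space_1)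
    finally show "(\<integral>\<^sup>+a. F (lin (Suc n) a u, lin (Suc n) a v) \<partial>gauss_row (Suc n))
      = (\<integral>\<^sup>+x. \<integral>\<^sup>+y. F (complex_of_real (sqrt (nsq (Suc n) u)) * x, q' * x + r' * y) \<partial>scg \<partial>scg)"
      unfolding p'_def .
  qed
qed

section \<open>Moments of a complex Gaussian\<close>

abbreviation "real_gauss \<equiv> density lborel (normal_density 0 (sqrt (1/2)))"

lemma prob_space_real_gauss: "prob_space real_gauss"
  by (rule prob_space_normal_density) simp

lemma nn_integral_scg:
  assumes [measurable]: "f \<in> borel_measurable borel"
  shows "(\<integral>\<^sup>+z. f z \<partial>scg) = (\<integral>\<^sup>+x. \<integral>\<^sup>+y. f (Complex x y) \<partial>real_gauss \<partial>real_gauss)"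
proof -
  have "(\<integral>\<^sup>+z. f z \<partial>scg) = (\<integral>\<^sup>+p. f ((\<lambda>(x, y). Complex x y) p) \<partial>(real_gauss \<Otimes>\<^sub>M real_gauss))"
    unfolding std_complex_gaussian_def by (rule nn_integral_distr) measurable
  also have "\<dots> = (\<integral>\<^sup>+x. \<integral>\<^sup>+y. f (Complex x y) \<partial>real_gauss \<partial>real_gauss)"
    by (subst sigma_finite_measure.nn_integral_fst[symmetric])
      (auto intro: prob_space_imp_sigma_finite prob_space_real_gauss)
  finally show ?thesis .
qed

lemma real_gauss_moment:
  "(\<integral>\<^sup>+x. ennreal (x ^ (2 * k)) \<partial>real_gauss) = ennreal (fact (2 * k) / (4 ^ k * fact k))"
proof -
  have b: "has_bochner_integral lborel (\<lambda>x. normal_density 0 (sqrt (1/2)) x * x ^ (2 * k)) (fact (2 * k) / (4 ^ k * fact k))"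
    using normal_moment_even[of "sqrt (1/2)" 0 k] by simp
  have "(\<integral>\<^sup>+x. ennreal (x ^ (2 * k)) \<partial>real_gauss) =
     (\<integral>\<^sup>+x. ennreal (normal_density 0 (sqrt (1/2)) x * x ^ (2 * k)) \<partial>lborel)"
    by (subst nn_integral_density) (auto simp: ennreal_mult zero_le_even_power)
  also have "\<dots> = ennreal (\<integral>x. normal_density 0 (sqrt (1/2)) x * x ^ (2 * k) \<partial>lborel)"
    by (rule nn_integral_eq_integral) (auto simp: zero_le_even_power intro: integrable.intros[OF b])
  also have "\<dots> = ennreal (fact (2 * k) / (4 ^ k * fact k))"
    using b by (simp add: has_bochner_integral_integral_eq)
  finally show ?thesis .
qed

lemma scg_moment_mixed:
  "(\<integral>\<^sup>+z. ennreal (Re z ^ (2 * i) * Im z ^ (2 * j)) \<partial>scg) =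
     ennreal (fact (2 * i) / (4 ^ i * fact i) * (fact (2 * j) / (4 ^ j * fact j)))"
proof -
  have "(\<integral>\<^sup>+z. ennreal (Re z ^ (2 * i) * Im z ^ (2 * j)) \<partial>scg) =
     (\<integral>\<^sup>+x. \<integral>\<^sup>+y. ennreal (x ^ (2 * i)) * ennreal (y ^ (2 * j)) \<partial>real_gauss \<partial>real_gauss)"
    by (subst nn_integral_scg) (auto simp: ennreal_mult zero_le_even_power)
  also have "\<dots> = ennreal (fact (2 * i) / (4 ^ i * fact i)) * ennreal (fact (2 * j) / (4 ^ j * fact j))"
    by (simp add: nn_integral_cmult nn_integral_multc real_gauss_moment)
  also have "\<dots> = ennreal (fact (2 * i) / (4 ^ i * fact i) * (fact (2 * j) / (4 ^ j * fact j)))"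
    by (rule ennreal_mult[symmetric]) auto
  finally show ?thesis .
qed

lemma scg_Im_sq: "(\<integral>\<^sup>+z. ennreal ((Im z)\<^sup>2) \<partial>scg) = ennreal (1/2)"
  using scg_moment_mixed[of 0 1] by (simp add: power2_eq_square)

lemma scg_norm2: "(\<integral>\<^sup>+z. ennreal ((cmod z)\<^sup>2) \<partial>scg) = 1"
proof -
  have "(\<integral>\<^sup>+z. ennreal ((cmod z)\<^sup>2) \<partial>scg) =
     (\<integral>\<^sup>+z. ennreal (Re z ^ (2*1) * Im z ^ (2*0)) + ennreal (Re z ^ (2*0) * Im z ^ (2*1)) \<partial>scg)"
    by (simp add: cmod_power2)
  also have "\<dots> = ennreal (1/2) + ennreal (1/2)"
    by (subst nn_integral_add) (simp_all only: scg_moment_mixed, auto simp: power2_eq_square)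
  finally show ?thesis using ennreal_plus[of "1/2" "1/2"] by simp
qed

text \<open>The squared modulus is exponential with mean 1, so its second and third moments are 2!
  and 3!. They are obtained here by expanding into moments of the real and imaginary parts.\<close>

lemma scg_norm4: "(\<integral>\<^sup>+z. ennreal ((cmod z)^4) \<partial>scg) = 2"
proof -
  have e: "cmod z ^ 4 = Re z ^ (2*2) * Im z ^ (2*0) + 2 * (Re z ^ (2*1) * Im z ^ (2*1)) + Re z ^ (2*0) * Im z ^ (2*2)" for z
  proof -
    have "cmod z ^ 4 = ((cmod z)\<^sup>2)\<^sup>2" by (simp flip: power_mult)
    then show ?thesis unfolding cmod_power2 by (simp add: algebra_simps power2_eq_square power_numeral_reduce)
  qed
  have "(\<integral>\<^sup>+z. ennreal (cmod z ^ 4) \<partial>scg) =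
     (\<integral>\<^sup>+z. ennreal (Re z ^ (2*2) * Im z ^ (2*0)) + 2 * ennreal (Re z ^ (2*1) * Im z ^ (2*1)) + ennreal (Re z ^ (2*0) * Im z ^ (2*2)) \<partial>scg)"
    unfolding e by (simp add: ennreal_mult' zero_le_even_power)
  also have "\<dots> = ennreal (3/4) + 2 * ennreal (1/4) + ennreal (3/4)"
    by (subst nn_integral_add, measurable, subst nn_integral_add, measurable, subst nn_integral_cmult, measurable)
      (simp only: scg_moment_mixed, simp add: fact_numeral)
  also have "\<dots> = ennreal 2"
    using ennreal_plus[of "3/4" "1/2"] ennreal_plus[of "5/4" "3/4"] ennreal_mult[of 2 "1/4"] by simp
  finally show ?thesis by simp
qed

lemma scg_norm6: "(\<integral>\<^sup>+z. ennreal ((cmod z)^6) \<partial>scg) = 6"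
proof -
  have e: "cmod z ^ 6 = Re z ^ (2*3) * Im z ^ (2*0) + 3 * (Re z ^ (2*2) * Im z ^ (2*1)) + 3 * (Re z ^ (2*1) * Im z ^ (2*2)) + Re z ^ (2*0) * Im z ^ (2*3)" for z
  proof -
    have "cmod z ^ 6 = ((cmod z)\<^sup>2)^3" by (simp flip: power_mult)
    then show ?thesis unfolding cmod_power2 by (simp add: algebra_simps power2_eq_square power_numeral_reduce)
  qed
  have "(\<integral>\<^sup>+z. ennreal (cmod z ^ 6) \<partial>scg) =
     (\<integral>\<^sup>+z. ennreal (Re z ^ (2*3) * Im z ^ (2*0)) + 3 * ennreal (Re z ^ (2*2) * Im z ^ (2*1)) + 3 * ennreal (Re z ^ (2*1) * Im z ^ (2*2)) + ennreal (Re z ^ (2*0) * Im z ^ (2*3)) \<partial>scg)"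
    unfolding e by (simp add: ennreal_mult' zero_le_even_power)
  also have "\<dots> = ennreal (15/8) + 3 * ennreal (3/8) + 3 * ennreal (3/8) + ennreal (15/8)"
    by (subst nn_integral_add, measurable, subst nn_integral_add, measurable, subst nn_integral_add, measurable,
       subst nn_integral_cmult, measurable, subst nn_integral_cmult, measurable)
      (simp only: scg_moment_mixed, simp add: fact_numeral)
  also have "\<dots> = ennreal 6"
    using ennreal_plus[of "15/8" "9/8"] ennreal_plus[of 3 "9/8"] ennreal_plus[of "33/8" "15/8"] ennreal_mult[of 3 "3/8"] by simp
  finally show ?thesis by simp
qed

text \<open>For an exponential variable of mean 1 the exponential moment at 1/2 is 1 / (1 - 1/2).
  This value 2 is the bound in the Bernstein inequalities for squared moduli.\<close>

lemma scg_exp_half: "(\<integral>\<^sup>+z. ennreal (exp ((cmod z)\<^sup>2 / 2)) \<partial>scg) = 2"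
proof -
  have r: "(\<integral>\<^sup>+x. ennreal (exp (x\<^sup>2 / 2)) \<partial>real_gauss) = ennreal (sqrt 2)"
  proof -
    have "(\<integral>\<^sup>+x. ennreal (exp (x\<^sup>2 / 2)) \<partial>real_gauss) =
      (\<integral>\<^sup>+x. ennreal (normal_density 0 (sqrt (1/2)) x) * ennreal (exp (x\<^sup>2 / 2)) \<partial>lborel)"
      by (rule nn_integral_density) auto
    \<comment> \<open>The factor exp(x^2 / 2) turns the density of variance 1/2 into sqrt 2 times
      the standard normal density.\<close>
    also have "\<dots> = (\<integral>\<^sup>+x. ennreal (sqrt 2) * ennreal (std_normal_density x) \<partial>lborel)"
      by (intro nn_integral_cong)
        (auto simp: ennreal_mult[symmetric] normal_density_def real_sqrt_mult real_sqrt_divide mult_exp_exp field_simps)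
    also have "\<dots> = ennreal (sqrt 2)"
      using prob_space.emeasure_space_1[OF prob_space_normal_density[of 1 0]]
      by (simp add: nn_integral_cmult emeasure_density)
    finally show ?thesis .
  qed
  have "(\<integral>\<^sup>+z. ennreal (exp ((cmod z)\<^sup>2 / 2)) \<partial>scg) =
      (\<integral>\<^sup>+x. \<integral>\<^sup>+y. ennreal (exp (x\<^sup>2 / 2)) * ennreal (exp (y\<^sup>2 / 2)) \<partial>real_gauss \<partial>real_gauss)"
    by (subst nn_integral_scg) (auto simp: cmod_power2 ennreal_mult[symmetric] mult_exp_exp add_divide_distrib)
  also have "\<dots> = 2"
    by (simp add: nn_integral_cmult nn_integral_multc r) (simp flip: ennreal_mult)
  finally show ?thesis .
qed

text \<open>The diagonal rotation with entries \<open>\<omega>\<close> and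
  \<open>cnj \<omega>\<close>, applied to a function of the first coordinate alone.\<close>

lemma scg_rotate:
  assumes [measurable]: "F \<in> borel_measurable borel" and w: "cmod \<omega> = 1"
  shows "(\<integral>\<^sup>+z. F (\<omega> * z) \<partial>scg) = (\<integral>\<^sup>+z. F z \<partial>scg)"
proof -
  interpret prob_space scg by (rule prob_space_scg)
  have 1: "(\<integral>\<^sup>+z. (G (fst z) :: ennreal) \<partial>(scg \<Otimes>\<^sub>M scg)) = (\<integral>\<^sup>+z. G z \<partial>scg)" if [measurable]: "G \<in> borel_measurable borel" for G
    by (subst nn_integral_fst[symmetric]) (auto simp: emeasure_space_1)
  have "(\<integral>\<^sup>+z. F (\<omega> * z) \<partial>scg) = (\<integral>\<^sup>+z. F (\<omega> * fst z) \<partial>(scg \<Otimes>\<^sub>M scg))"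
    by (rule 1[of "\<lambda>z. F (\<omega> * z)", symmetric]) measurable
  also have "\<dots> = (\<integral>\<^sup>+z. (\<lambda>z. F (fst z)) (\<omega> * fst z + 0 * snd z, - cnj 0 * fst z + cnj \<omega> * snd z) \<partial>(scg \<Otimes>\<^sub>M scg))"
    by simp
  also have "\<dots> = (\<integral>\<^sup>+z. F (fst z) \<partial>(scg \<Otimes>\<^sub>M scg))"
    by (rule nn_integral_SU2) (use w in auto)
  also have "\<dots> = (\<integral>\<^sup>+z. F z \<partial>scg)" by (rule 1) measurable
  finally show ?thesis .
qed

lemma scg_Im_rotate_sq:
  assumes "cmod \<omega> = 1"
  shows "(\<integral>\<^sup>+z. ennreal ((Im (\<omega> * z))\<^sup>2) \<partial>scg) = ennreal (1/2)"
  using scg_rotate[of "\<lambda>z. ennreal ((Im z)\<^sup>2)" \<omega>] assms by (simp add: scg_Im_sq)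

text \<open>Parallelogram identity and the symmetry \<open>g \<mapsto> - g\<close>: this avoids Bochner integrals.\<close>

lemma scg_affine_norm2:
  "(\<integral>\<^sup>+z. ennreal ((cmod (a + r * z))\<^sup>2) \<partial>scg) = ennreal ((cmod a)\<^sup>2 + (cmod r)\<^sup>2)"
proof -
  interpret prob_space scg by (rule prob_space_scg)
  let ?I = "\<integral>\<^sup>+z. ennreal ((cmod (a + r * z))\<^sup>2) \<partial>scg"
  have "2 * ?I = ?I + (\<integral>\<^sup>+z. ennreal ((cmod (a + r * (-1 * z)))\<^sup>2) \<partial>scg)"
    by (subst scg_rotate[of "\<lambda>z. ennreal ((cmod (a + r * z))\<^sup>2)" "-1"]) (auto simp: mult_2)
  also have "\<dots> = (\<integral>\<^sup>+z. ennreal ((cmod (a + r * z))\<^sup>2) + ennreal ((cmod (a + r * (-1 * z)))\<^sup>2) \<partial>scg)"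
    by (rule nn_integral_add[symmetric]) measurable
  also have "\<dots> = (\<integral>\<^sup>+z. ennreal (2 * (cmod a)\<^sup>2) + ennreal (2 * (cmod r)\<^sup>2) * ennreal ((cmod z)\<^sup>2) \<partial>scg)"
  proof (rule nn_integral_cong)
    fix z
    have "(cmod (a + r * z))\<^sup>2 + (cmod (a + r * (-1 * z)))\<^sup>2 = 2 * (cmod a)\<^sup>2 + 2 * (cmod r)\<^sup>2 * (cmod z)\<^sup>2"
      unfolding cmod_power2 by (simp add: algebra_simps power2_eq_square)
    then show "ennreal ((cmod (a + r * z))\<^sup>2) + ennreal ((cmod (a + r * (-1 * z)))\<^sup>2) =
       ennreal (2 * (cmod a)\<^sup>2) + ennreal (2 * (cmod r)\<^sup>2) * ennreal ((cmod z)\<^sup>2)"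
      by (simp add: ennreal_mult[symmetric] ennreal_plus[symmetric] del: ennreal_plus)
  qed
  also have "\<dots> = 2 * ennreal ((cmod a)\<^sup>2 + (cmod r)\<^sup>2)"
    by (subst nn_integral_add) (auto simp: nn_integral_cmult scg_norm2 emeasure_space_1 ennreal_mult' distrib_left)
  finally show ?thesis
    by (simp only: ennreal_mult_cancel_left) simp
qed

lemma scg_null_norm: "emeasure scg {z. cmod z = \<rho>} = 0"
proof -
  have s: "{z. cmod z = \<rho>} = sphere (0::complex) \<rho>" by auto
  have m: "sphere (0::complex) \<rho> \<in> sets lborel" by simp
  have "emeasure lebesgue (sphere (0::complex) \<rho>) = 0"
    using negligible_sphere[of "0::complex" \<rho>] unfolding negligible_iff_null_sets by (rule null_setsD1)
  then have "sphere (0::complex) \<rho> \<in> null_sets lborel"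
    using m null_sets_completion_iff[OF m] by (auto intro: null_setsI)
  then have "(\<integral>\<^sup>+z. gauss_density z * indicator (sphere 0 \<rho>) z \<partial>lborel) = 0"
    by (rule nn_integral_null_set)
  then show ?thesis unfolding scg_density s
    using m by (subst emeasure_density) auto
qed

section \<open>Independent rows and Bernstein inequalities\<close>

definition mrow :: "(nat \<times> nat \<Rightarrow> complex) \<Rightarrow> nat \<Rightarrow> nat \<Rightarrow> complex" where
  "mrow w i j = w (i, j)"

lemma prob_space_gaussian_entries: "prob_space (gaussian_entries m n)"
  unfolding gaussian_entries_def by (intro prob_space_PiM prob_space_scg)

lemma prob_space_gauss_row: "prob_space (gauss_row n)"
  unfolding gauss_row_def by (intro prob_space_PiM prob_space_scg)

lemma restrict_mrow_measurable:
  assumes "i < m"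
  shows "(\<lambda>w. restrict (mrow w i) {..<n}) \<in> gaussian_entries m n \<rightarrow>\<^sub>M gauss_row n"
  unfolding gaussian_entries_def gauss_row_def mrow_def
  by (intro measurable_restrict measurable_component_singleton) (use assms in auto)

lemma lin_restrict[simp]: "lin n (restrict a {..<n}) v = lin n a v"
  by (simp add: lin_def)

lemma lin_mrow_measurable[measurable]:
  assumes "i < m"
  shows "(\<lambda>w. lin n (mrow w i) v) \<in> borel_measurable (gaussian_entries m n)"
  using measurable_compose[OF restrict_mrow_measurable[OF assms] lin_measurable] by simp

text \<open>Independence of the rows, in the form needed for exponential moments of row sums. The
  restriction makes a row a point of the product space of \<open>gauss_row\<close>, whose functions
  are undefined beyond \<open>n\<close>.\<close>

lemma nn_integral_prod_rows:
  fixes F :: "(nat \<Rightarrow> complex) \<Rightarrow> ennreal"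
  assumes F: "F \<in> borel_measurable (gauss_row n)"
  shows "(\<integral>\<^sup>+w. (\<Prod>i<m. F (restrict (mrow w i) {..<n})) \<partial>gaussian_entries m n) = (\<integral>\<^sup>+a. F a \<partial>gauss_row n) ^ m"
proof (induction m)
  case 0
  interpret prob_space "gaussian_entries 0 n" by (rule prob_space_gaussian_entries)
  show ?case by (simp add: emeasure_space_1)
next
  case (Suc m)
  interpret product_sigma_finite "\<lambda>_. scg" by (rule product_sigma_scg)
  let ?I = "{..<m} \<times> {..<n}" and ?J = "{m} \<times> {..<n}"
  let ?f = "\<lambda>w. (\<Prod>i<Suc m. F (restrict (mrow w i) {..<n}))"
  have IJ: "{..<Suc m} \<times> {..<n} = ?I \<union> ?J" by auto
  have rm: "(\<lambda>w. F (restrict (mrow w i) {..<n})) \<in> borel_measurable (gaussian_entries k n)" if "i < k" for i k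
    using measurable_compose[OF restrict_mrow_measurable[OF that] F] .
  have m: "?f \<in> borel_measurable (\<Pi>\<^sub>M ij\<in>?I \<union> ?J. scg)"
    using rm[of _ "Suc m"] unfolding gaussian_entries_def IJ by (intro borel_measurable_prod_ennreal) auto
  have mJm: "(\<lambda>w. restrict (\<lambda>j. w (m, j)) {..<n}) \<in> (\<Pi>\<^sub>M ij\<in>?J. scg) \<rightarrow>\<^sub>M gauss_row n"
    unfolding gauss_row_def by measurable
  then have mJ: "(\<lambda>w. F (restrict (mrow w m) {..<n})) \<in> borel_measurable (\<Pi>\<^sub>M ij\<in>?J. scg)"
    using F unfolding mrow_def by (rule measurable_compose)
  have r1: "restrict (mrow (merge ?I ?J (x, y)) i) {..<n} = restrict (mrow x i) {..<n}" if "i < m" for x y i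
    using that by (auto simp: mrow_def merge_def restrict_def)
  have r2: "restrict (mrow (merge ?I ?J (x, y)) m) {..<n} = restrict (mrow y m) {..<n}" for x y
    by (auto simp: mrow_def merge_def restrict_def)
  have d: "distr (\<Pi>\<^sub>M ij\<in>?J. scg) (gauss_row n) (\<lambda>w. \<lambda>j\<in>{..<n}. w (m, j)) = gauss_row n"
    unfolding gauss_row_def
    using distr_PiM_reindex[of ?J "\<lambda>_. scg" "\<lambda>j. (m, j)" "{..<n}"] prob_space_scg
    by (auto simp: inj_on_def)
  have J: "(\<integral>\<^sup>+y. F (restrict (mrow y m) {..<n}) \<partial>(\<Pi>\<^sub>M ij\<in>?J. scg)) = (\<integral>\<^sup>+a. F a \<partial>gauss_row n)"
  proof -
    have "(\<integral>\<^sup>+a. F a \<partial>gauss_row n) = (\<integral>\<^sup>+a. F a \<partial>distr (\<Pi>\<^sub>M ij\<in>?J. scg) (gauss_row n) (\<lambda>w. \<lambda>j\<in>{..<n}. w (m, j)))"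
      by (simp only: d)
    also have "\<dots> = (\<integral>\<^sup>+y. F (restrict (mrow y m) {..<n}) \<partial>(\<Pi>\<^sub>M ij\<in>?J. scg))"
      unfolding mrow_def by (rule nn_integral_distr) (use mJm F in auto)
    finally show ?thesis ..
  qed
  have "(\<integral>\<^sup>+w. ?f w \<partial>gaussian_entries (Suc m) n) =
     (\<integral>\<^sup>+x. \<integral>\<^sup>+y. ?f (merge ?I ?J (x, y)) \<partial>(\<Pi>\<^sub>M ij\<in>?J. scg) \<partial>(\<Pi>\<^sub>M ij\<in>?I. scg))"
    unfolding gaussian_entries_def IJ by (rule product_nn_integral_fold) (auto simp: m simp del: prod.lessThan_Suc)
  also have "\<dots> = (\<integral>\<^sup>+x. \<integral>\<^sup>+y. (\<Prod>i<m. F (restrict (mrow x i) {..<n})) * F (restrict (mrow y m) {..<n})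
       \<partial>(\<Pi>\<^sub>M ij\<in>?J. scg) \<partial>(\<Pi>\<^sub>M ij\<in>?I. scg))"
    by (simp add: r1 r2)
  also have "\<dots> = (\<integral>\<^sup>+x. (\<Prod>i<m. F (restrict (mrow x i) {..<n})) * (\<integral>\<^sup>+a. F a \<partial>gauss_row n) \<partial>gaussian_entries m n)"
    unfolding gaussian_entries_def by (subst nn_integral_cmult[OF mJ]) (simp add: J)
  also have "\<dots> = (\<integral>\<^sup>+a. F a \<partial>gauss_row n) ^ Suc m"
    by (subst nn_integral_multc) (auto intro!: borel_measurable_prod_ennreal rm simp: Suc mult.commute)
  finally show ?case .
qed

lemma row_sum_measurable:
  fixes Y :: "(nat \<Rightarrow> complex) \<Rightarrow> real"
  assumes "Y \<in> borel_measurable (gauss_row n)" "\<forall>a. Y (restrict a {..<n}) = Y a"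
  shows "(\<lambda>w. \<Sum>i<m. Y (mrow w i)) \<in> borel_measurable (gaussian_entries m n)"
proof (rule borel_measurable_sum)
  fix i assume "i \<in> {..<m}"
  then show "(\<lambda>w. Y (mrow w i)) \<in> borel_measurable (gaussian_entries m n)"
    using measurable_compose[OF restrict_mrow_measurable[of i m n] assms(1)] assms(2) by simp
qed

text \<open>Markov's inequality for the exponential of the row sum. The free parameter of the method
  is absorbed into \<open>Y\<close>, which may take negative values; both Bernstein inequalities use
  it with \<open>Y\<close> scaled by \<open>s\<close> or by \<open>- s\<close>.\<close>

lemma chernoff:
  fixes Y :: "(nat \<Rightarrow> complex) \<Rightarrow> real"
  assumes Y: "Y \<in> borel_measurable (gauss_row n)" and L: "\<And>a. Y (restrict a {..<n}) = Y a"
    and mgf: "(\<integral>\<^sup>+a. ennreal (exp (Y a)) \<partial>gauss_row n) \<le> ennreal (exp t)"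
  shows "emeasure (gaussian_entries m n) {w \<in> space (gaussian_entries m n). real m * (t + c) \<le> (\<Sum>i<m. Y (mrow w i))}
     \<le> ennreal (exp (- c * real m))"
proof -
  let ?S = "\<lambda>w. \<Sum>i<m. Y (mrow w i)"
  have [measurable]: "?S \<in> borel_measurable (gaussian_entries m n)"
    by (rule row_sum_measurable[OF Y]) (rule allI, rule L)
  let ?A = "{w \<in> space (gaussian_entries m n). real m * (t + c) \<le> ?S w}"
  have e1: "1 \<le> ennreal (exp (- (real m * (t + c)))) * ennreal (exp s) \<longleftrightarrow> real m * (t + c) \<le> s" for s
    by (simp add: ennreal_mult[symmetric] mult_exp_exp)
  have "emeasure (gaussian_entries m n) ?A =
     emeasure (gaussian_entries m n) {w \<in> space (gaussian_entries m n). 1 \<le> ennreal (exp (- (real m * (t + c)))) * ennreal (exp (?S w))}"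
    by (simp only: e1)
  also have "\<dots> \<le> ennreal (exp (- (real m * (t + c)))) * (\<integral>\<^sup>+w. ennreal (exp (?S w)) * indicator (space (gaussian_entries m n)) w \<partial>gaussian_entries m n)"
    by (rule nn_integral_Markov_inequality) measurable
  also have "(\<integral>\<^sup>+w. ennreal (exp (?S w)) * indicator (space (gaussian_entries m n)) w \<partial>gaussian_entries m n) =
     (\<integral>\<^sup>+w. (\<Prod>i<m. ennreal (exp (Y (restrict (mrow w i) {..<n})))) \<partial>gaussian_entries m n)"
    by (intro nn_integral_cong) (simp add: exp_sum L prod_ennreal)
  also have "\<dots> = (\<integral>\<^sup>+a. ennreal (exp (Y a)) \<partial>gauss_row n) ^ m"
    by (rule nn_integral_prod_rows) (use Y in measurable)
  also have "\<dots> \<le> ennreal (exp t) ^ m" by (rule power_mono[OF mgf]) simp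
  also have "\<dots> = ennreal (exp (real m * t))" by (simp add: ennreal_power exp_of_nat_mult)
  also have "ennreal (exp (- (real m * (t + c)))) * ennreal (exp (real m * t)) = ennreal (exp (- c * real m))"
    by (simp add: ennreal_mult[symmetric] mult_exp_exp algebra_simps)
  finally show ?thesis by (simp add: mult_left_mono)
qed

text \<open>The Taylor remainder is (s y)^2 / 2 times exp(s y). As \<open>s\<close> is at most half
  of \<open>s0\<close>, one factor exp(s0 y / 2) dominates the exponential and a second one
  dominates (s0 y / 2)^2 / 2; converting the square produces the constant 4 / s0^2.\<close>

lemma exp_le_quadratic:
  fixes y :: real
  assumes "0 \<le> y" "0 < s0" "0 \<le> s" "s \<le> s0 / 2"
  shows "exp (s * y) \<le> 1 + s * y + 4 / s0\<^sup>2 * s\<^sup>2 * exp (s0 * y)"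
proof -
  have 1: "exp x \<le> 1 + x + x\<^sup>2 / 2 * exp x" if "0 \<le> x" for x :: real
  proof -
    obtain t where t: "\<bar>t\<bar> \<le> \<bar>x\<bar>" "exp x = (\<Sum>m<2. x ^ m / fact m) + exp t / fact 2 * x ^ 2"
      using Maclaurin_exp_le by blast
    have "exp t \<le> exp x" using t(1) that by auto
    then have "exp t / 2 * x^2 \<le> exp x / 2 * x^2" by (intro mult_right_mono) auto
    with t(2) show ?thesis by (simp add: numeral_2_eq_2 field_simps)
  qed
  have 2: "x\<^sup>2 / 2 \<le> exp x" if "0 \<le> x" for x :: real
    using exp_lower_Taylor_quadratic[OF that] that by linarith
  have 3: "(s0 * y / 2)\<^sup>2 / 2 \<le> exp (s0 * y / 2)" using 2[of "s0 * y / 2"] assms by simp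
  have "(s * y)\<^sup>2 / 2 * exp (s * y) \<le> (s * y)\<^sup>2 / 2 * exp (s0 * y / 2)"
    using assms mult_right_mono[of s "s0/2" y] by (intro mult_left_mono) auto
  also have "\<dots> = (4 / s0\<^sup>2 * s\<^sup>2) * ((s0 * y / 2)\<^sup>2 / 2) * exp (s0 * y / 2)"
    using assms by (simp add: field_simps power2_eq_square)
  also have "\<dots> \<le> (4 / s0\<^sup>2 * s\<^sup>2) * exp (s0 * y / 2) * exp (s0 * y / 2)"
    using 3 by (intro mult_right_mono mult_left_mono) auto
  also have "\<dots> = 4 / s0\<^sup>2 * s\<^sup>2 * exp (s0 * y)" by (simp add: mult_exp_exp mult.assoc)
  finally show ?thesis using 1[of "s * y"] assms by simp
qed

definition exp_moment_row :: "nat \<Rightarrow> real \<Rightarrow> real \<Rightarrow> ((nat \<Rightarrow> complex) \<Rightarrow> real) \<Rightarrow> bool" where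
  "exp_moment_row n s0 B Y \<longleftrightarrow> Y \<in> borel_measurable (gauss_row n) \<and> (\<forall>a. Y (restrict a {..<n}) = Y a) \<and>
    (\<forall>a. 0 \<le> Y a) \<and> (\<integral>\<^sup>+a. ennreal (exp (s0 * Y a)) \<partial>gauss_row n) \<le> ennreal B"

text \<open>The rate depends only on \<open>s0\<close>, \<open>B\<close> and \<open>\<eta>\<close>,
  uniformly in the dimensions, the statistic and its mean; this is what later allows a union bound
  over a net of dimension-dependent size.\<close>

lemma bernstein_upper:
  assumes "s0 > 0" "B \<ge> 0" "\<eta> > 0"
  shows "\<exists>c>0. \<forall>n m Y \<mu>. exp_moment_row n s0 B Y \<longrightarrow> \<mu> \<ge> 0 \<longrightarrow>
    (\<integral>\<^sup>+a. ennreal (Y a) \<partial>gauss_row n) \<le> ennreal \<mu> \<longrightarrow>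
    emeasure (gaussian_entries m n) {w \<in> space (gaussian_entries m n). real m * (\<mu> + \<eta>) \<le> (\<Sum>i<m. Y (mrow w i))}
      \<le> ennreal (exp (- c * real m))"
proof -
  define D where "D = 4 / s0\<^sup>2 * B + 1"
  have D: "D > 0" using assms by (auto simp: D_def intro!: add_nonneg_pos)
  \<comment> \<open>With \<open>s * D \<le> \<eta> / 2\<close> the quadratic term of the exponential
    moment is at most \<open>s * \<eta> / 2\<close>, so half of the gain \<open>s * \<eta>\<close>
    remains as the rate.\<close>
  define s where "s = min (s0 / 2) (\<eta> / (2 * D))"
  have s: "s > 0" "s \<le> s0 / 2" "s * D \<le> \<eta> / 2"
    using assms D by (auto simp: s_def min_def field_simps)
  show ?thesis
  proof (intro exI[of _ "s * \<eta> / 2"] conjI allI impI)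
    show "s * \<eta> / 2 > 0" using s assms by simp
    fix n m :: nat and Y :: "(nat \<Rightarrow> complex) \<Rightarrow> real" and \<mu> :: real
    assume "exp_moment_row n s0 B Y" and mu: "\<mu> \<ge> 0" "(\<integral>\<^sup>+a. ennreal (Y a) \<partial>gauss_row n) \<le> ennreal \<mu>"
    then have Y[measurable]: "Y \<in> borel_measurable (gauss_row n)" and L: "\<forall>a. Y (restrict a {..<n}) = Y a"
      and pos: "\<forall>a. 0 \<le> Y a" and ex: "(\<integral>\<^sup>+a. ennreal (exp (s0 * Y a)) \<partial>gauss_row n) \<le> ennreal B"
      by (auto simp: exp_moment_row_def)
    interpret prob_space "gauss_row n" by (rule prob_space_gauss_row)
    define k where "k = 4 / s0\<^sup>2 * s\<^sup>2"
    have k0: "k \<ge> 0" by (simp add: k_def)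
    have "(\<integral>\<^sup>+a. ennreal (exp (s * Y a)) \<partial>gauss_row n) \<le>
       (\<integral>\<^sup>+a. 1 + ennreal s * ennreal (Y a) + ennreal k * ennreal (exp (s0 * Y a)) \<partial>gauss_row n)"
    proof (rule nn_integral_mono)
      fix a
      have "ennreal (exp (s * Y a)) \<le> ennreal (1 + s * Y a + k * exp (s0 * Y a))"
        using exp_le_quadratic[of "Y a" s0 s, folded k_def] s pos assms by (intro ennreal_leI) auto
      also have "\<dots> = 1 + ennreal s * ennreal (Y a) + ennreal k * ennreal (exp (s0 * Y a))"
        using s pos k0 by (simp add: ennreal_mult ennreal_plus)
      finally show "ennreal (exp (s * Y a)) \<le> \<dots>" .
    qed
    also have "\<dots> = 1 + ennreal s * (\<integral>\<^sup>+a. ennreal (Y a) \<partial>gauss_row n) + ennreal k * (\<integral>\<^sup>+a. ennreal (exp (s0 * Y a)) \<partial>gauss_row n)"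
      by (simp add: nn_integral_add nn_integral_cmult emeasure_space_1)
    also have "\<dots> \<le> 1 + ennreal s * ennreal \<mu> + ennreal k * ennreal B"
      by (intro add_mono mult_left_mono ex mu order_refl) auto
    also have "\<dots> = ennreal (1 + s * \<mu> + k * B)"
      using s mu assms k0 by (simp add: ennreal_mult ennreal_plus)
    also have "\<dots> \<le> ennreal (exp (s * \<mu> + k * B))"
      using exp_ge_add_one_self[of "s * \<mu> + k * B"] by (intro ennreal_leI) linarith
    finally have mgf: "(\<integral>\<^sup>+a. ennreal (exp (s * Y a)) \<partial>gauss_row n) \<le> ennreal (exp (s * \<mu> + k * B))" .
    have "k * B \<le> s * (s * D)" using s by (simp add: k_def D_def algebra_simps power2_eq_square)
    also have "\<dots> \<le> s * (\<eta> / 2)" using s by (intro mult_left_mono) auto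
    finally have kB: "k * B + s * \<eta> / 2 \<le> s * \<eta>" by simp
    have "emeasure (gaussian_entries m n) {w \<in> space (gaussian_entries m n). real m * (\<mu> + \<eta>) \<le> (\<Sum>i<m. Y (mrow w i))}
      \<le> emeasure (gaussian_entries m n) {w \<in> space (gaussian_entries m n).
         real m * (s * \<mu> + k * B + s * \<eta> / 2) \<le> (\<Sum>i<m. s * Y (mrow w i))}"
    proof (rule emeasure_mono)
      have [measurable]: "(\<lambda>w. \<Sum>i<m. s * Y (mrow w i)) \<in> borel_measurable (gaussian_entries m n)"
        by (rule row_sum_measurable[where Y="\<lambda>a. s * Y a"]) (measurable, use L in metis)
      show "{w \<in> space (gaussian_entries m n).
         real m * (s * \<mu> + k * B + s * \<eta> / 2) \<le> (\<Sum>i<m. s * Y (mrow w i))} \<in> sets (gaussian_entries m n)"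
        by measurable
      have "real m * (s * \<mu> + k * B + s * \<eta> / 2) \<le> (\<Sum>i<m. s * Y (mrow w i))"
        if "real m * (\<mu> + \<eta>) \<le> (\<Sum>i<m. Y (mrow w i))" for w
      proof -
        have "real m * (s * \<mu> + k * B + s * \<eta> / 2) \<le> real m * (s * \<mu> + s * \<eta>)"
          using kB by (intro mult_left_mono) auto
        also have "\<dots> = s * (real m * (\<mu> + \<eta>))" by (simp add: algebra_simps)
        also have "\<dots> \<le> s * (\<Sum>i<m. Y (mrow w i))" using that s by (intro mult_left_mono) auto
        finally show ?thesis by (simp add: sum_distrib_left)
      qed
      then show "{w \<in> space (gaussian_entries m n). real m * (\<mu> + \<eta>) \<le> (\<Sum>i<m. Y (mrow w i))} \<subseteq>
        {w \<in> space (gaussian_entries m n). real m * (s * \<mu> + k * B + s * \<eta> / 2) \<le> (\<Sum>i<m. s * Y (mrow w i))}"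
        by auto
    qed
    also have "\<dots> \<le> ennreal (exp (- (s * \<eta> / 2) * real m))"
    proof (intro chernoff mgf)
      show "(\<lambda>a. s * Y a) \<in> borel_measurable (gauss_row n)" by measurable
      show "s * Y (restrict a {..<n}) = s * Y a" for a using L by metis
    qed
    finally show "emeasure (gaussian_entries m n) {w \<in> space (gaussian_entries m n). real m * (\<mu> + \<eta>) \<le> (\<Sum>i<m. Y (mrow w i))}
      \<le> ennreal (exp (- (s * \<eta> / 2) * real m))" .
  qed
qed

text \<open>From (1 - x + x^2)(1 + x) = 1 + x^3, which is at least 1, and 1 + x at most exp x. The
  linear term stands on the left so that integration over the extended non-negative reals needs no
  subtraction.\<close>

lemma exp_neg_le_quadratic:
  fixes y :: real
  assumes "0 \<le> y" "0 < s0" "0 \<le> s"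
  shows "exp (- (s * y)) + s * y \<le> 1 + 2 / s0\<^sup>2 * s\<^sup>2 * exp (s0 * y)"
proof -
  define x where "x = s * y"
  have x: "x \<ge> 0" using assms by (simp add: x_def)
  have "exp (- x) * exp x = 1" by (simp add: mult_exp_exp)
  have "exp (- x) * (1 + x) \<le> exp (- x) * exp x" by (intro mult_left_mono) auto
  also have "\<dots> \<le> (1 - x + x\<^sup>2) * (1 + x)"
    using x by (simp add: mult_exp_exp algebra_simps power2_eq_square)
  finally have 1: "exp (- x) \<le> 1 - x + x\<^sup>2" using x by simp
  have "(s0 * y)\<^sup>2 / 2 \<le> exp (s0 * y)"
    using exp_lower_Taylor_quadratic[of "s0 * y"] assms by (smt (verit) mult_nonneg_nonneg)
  then have "2 / s0\<^sup>2 * s\<^sup>2 * ((s0 * y)\<^sup>2 / 2) \<le> 2 / s0\<^sup>2 * s\<^sup>2 * exp (s0 * y)"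
    by (intro mult_left_mono) auto
  moreover have "2 / s0\<^sup>2 * s\<^sup>2 * ((s0 * y)\<^sup>2 / 2) = x\<^sup>2"
    using assms by (simp add: x_def field_simps power2_eq_square)
  ultimately show ?thesis using 1 by (simp add: x_def)
qed

lemma bernstein_lower:
  assumes "s0 > 0" "B \<ge> 0" "\<eta> > 0"
  shows "\<exists>c>0. \<forall>n m Y \<mu>. exp_moment_row n s0 B Y \<longrightarrow> \<mu> \<ge> 0 \<longrightarrow>
    ennreal \<mu> \<le> (\<integral>\<^sup>+a. ennreal (Y a) \<partial>gauss_row n) \<longrightarrow>
    emeasure (gaussian_entries m n) {w \<in> space (gaussian_entries m n). (\<Sum>i<m. Y (mrow w i)) \<le> real m * (\<mu> - \<eta>)}
      \<le> ennreal (exp (- c * real m))"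
proof -
  define D where "D = 2 / s0\<^sup>2 * B + 1"
  have D: "D > 0" using assms by (auto simp: D_def intro!: add_nonneg_pos)
  define s where "s = \<eta> / (2 * D)"
  have s: "s > 0" "s * D \<le> \<eta> / 2"
    using assms D by (auto simp: s_def field_simps)
  show ?thesis
  proof (intro exI[of _ "s * \<eta> / 2"] conjI allI impI)
    show "s * \<eta> / 2 > 0" using s assms by simp
    fix n m :: nat and Y :: "(nat \<Rightarrow> complex) \<Rightarrow> real" and \<mu> :: real
    assume "exp_moment_row n s0 B Y" and mu: "\<mu> \<ge> 0" "ennreal \<mu> \<le> (\<integral>\<^sup>+a. ennreal (Y a) \<partial>gauss_row n)"
    then have Y[measurable]: "Y \<in> borel_measurable (gauss_row n)" and L: "\<forall>a. Y (restrict a {..<n}) = Y a"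
      and pos: "\<forall>a. 0 \<le> Y a" and ex: "(\<integral>\<^sup>+a. ennreal (exp (s0 * Y a)) \<partial>gauss_row n) \<le> ennreal B"
      by (auto simp: exp_moment_row_def)
    interpret prob_space "gauss_row n" by (rule prob_space_gauss_row)
    define k where "k = 2 / s0\<^sup>2 * s\<^sup>2"
    have k0: "k \<ge> 0" by (simp add: k_def)
    let ?I = "\<integral>\<^sup>+a. ennreal (exp (- s * Y a)) \<partial>gauss_row n"
    \<comment> \<open>The mean enters as a summand beside the exponential moment; once
      \<open>?I\<close> is known to be finite, it is moved to the other side in the reals.\<close>
    have "?I + ennreal (s * \<mu>) \<le> ?I + ennreal s * (\<integral>\<^sup>+a. ennreal (Y a) \<partial>gauss_row n)"
      using mu s by (simp add: ennreal_mult mult_left_mono)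
    also have "\<dots> = (\<integral>\<^sup>+a. ennreal (exp (- s * Y a)) + ennreal s * ennreal (Y a) \<partial>gauss_row n)"
      by (simp add: nn_integral_add nn_integral_cmult)
    also have "\<dots> \<le> (\<integral>\<^sup>+a. 1 + ennreal k * ennreal (exp (s0 * Y a)) \<partial>gauss_row n)"
    proof (rule nn_integral_mono)
      fix a
      have "ennreal (exp (- s * Y a)) + ennreal s * ennreal (Y a) = ennreal (exp (- (s * Y a)) + s * Y a)"
        using s pos k0 by (simp add: ennreal_mult ennreal_plus)
      also have "\<dots> \<le> ennreal (1 + k * exp (s0 * Y a))"
        using exp_neg_le_quadratic[of "Y a" s0 s, folded k_def] s pos assms by (intro ennreal_leI) auto
      also have "\<dots> = 1 + ennreal k * ennreal (exp (s0 * Y a))"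
        using s pos k0 by (simp add: ennreal_mult ennreal_plus)
      finally show "ennreal (exp (- s * Y a)) + ennreal s * ennreal (Y a) \<le> 1 + ennreal k * ennreal (exp (s0 * Y a))" .
    qed
    also have "\<dots> = 1 + ennreal k * (\<integral>\<^sup>+a. ennreal (exp (s0 * Y a)) \<partial>gauss_row n)"
      by (simp add: nn_integral_add nn_integral_cmult emeasure_space_1)
    also have "\<dots> \<le> 1 + ennreal k * ennreal B"
      by (intro add_mono mult_left_mono ex order_refl) auto
    also have "\<dots> = ennreal (1 + k * B)"
      using s assms k0 by (simp add: ennreal_mult ennreal_plus)
    finally have le: "?I + ennreal (s * \<mu>) \<le> ennreal (1 + k * B)" .
    have kB0: "0 \<le> k * B" using assms k0 by simp
    have fin: "?I < \<top>" using le by (metis ennreal_add_less_top ennreal_less_top le_less_trans)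
    then obtain I' where I': "?I = ennreal I'" "I' \<ge> 0" by (metis ennreal_cases less_irrefl)
    have "I' + s * \<mu> \<le> 1 + k * B"
      using le I' s mu kB0 unfolding I'(1) by (subst (asm) ennreal_plus[symmetric]) (auto simp del: ennreal_plus simp: ennreal_le_iff)
    then have "I' \<le> exp (- s * \<mu> + k * B)"
      using exp_ge_add_one_self[of "- s * \<mu> + k * B"] by linarith
    then have mgf: "?I \<le> ennreal (exp (- s * \<mu> + k * B))"
      unfolding I'(1) by (rule ennreal_leI)
    have "k * B \<le> s * (s * D)" using s by (simp add: k_def D_def algebra_simps power2_eq_square)
    also have "\<dots> \<le> s * (\<eta> / 2)" using s by (intro mult_left_mono) auto
    finally have kB: "k * B + s * \<eta> / 2 \<le> s * \<eta>" by simp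
    have "emeasure (gaussian_entries m n) {w \<in> space (gaussian_entries m n). (\<Sum>i<m. Y (mrow w i)) \<le> real m * (\<mu> - \<eta>)}
      \<le> emeasure (gaussian_entries m n) {w \<in> space (gaussian_entries m n).
         real m * (- s * \<mu> + k * B + s * \<eta> / 2) \<le> (\<Sum>i<m. - s * Y (mrow w i))}"
    proof (rule emeasure_mono)
      have [measurable]: "(\<lambda>w. \<Sum>i<m. - s * Y (mrow w i)) \<in> borel_measurable (gaussian_entries m n)"
        by (rule row_sum_measurable[where Y="\<lambda>a. - s * Y a"]) (measurable, use L in metis)
      show "{w \<in> space (gaussian_entries m n).
         real m * (- s * \<mu> + k * B + s * \<eta> / 2) \<le> (\<Sum>i<m. - s * Y (mrow w i))} \<in> sets (gaussian_entries m n)"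
        by measurable
      have "real m * (- s * \<mu> + k * B + s * \<eta> / 2) \<le> (\<Sum>i<m. - s * Y (mrow w i))"
        if "(\<Sum>i<m. Y (mrow w i)) \<le> real m * (\<mu> - \<eta>)" for w
      proof -
        have "real m * (- s * \<mu> + k * B + s * \<eta> / 2) \<le> real m * (- s * \<mu> + s * \<eta>)"
          using kB by (intro mult_left_mono) auto
        also have "\<dots> = - (s * (real m * (\<mu> - \<eta>)))" by (simp add: algebra_simps)
        also have "\<dots> \<le> - (s * (\<Sum>i<m. Y (mrow w i)))" using that s by (simp add: mult_left_mono)
        finally show ?thesis by (simp add: sum_distrib_left sum_negf)
      qed
      then show "{w \<in> space (gaussian_entries m n). (\<Sum>i<m. Y (mrow w i)) \<le> real m * (\<mu> - \<eta>)} \<subseteq>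
        {w \<in> space (gaussian_entries m n). real m * (- s * \<mu> + k * B + s * \<eta> / 2) \<le> (\<Sum>i<m. - s * Y (mrow w i))}"
        by auto
    qed
    also have "\<dots> \<le> ennreal (exp (- (s * \<eta> / 2) * real m))"
    proof (intro chernoff mgf)
      show "(\<lambda>a. - s * Y a) \<in> borel_measurable (gauss_row n)" by measurable
      show "- s * Y (restrict a {..<n}) = - s * Y a" for a using L by metis
    qed
    finally show "emeasure (gaussian_entries m n) {w \<in> space (gaussian_entries m n). (\<Sum>i<m. Y (mrow w i)) \<le> real m * (\<mu> - \<eta>)}
      \<le> ennreal (exp (- (s * \<eta> / 2) * real m))" .
  qed
qed

section \<open>A lattice net of the unit ball\<close>

lemma sum_half_powers:
  "(\<Sum>k\<in>{- int K..int K}. (1/2::real) ^ nat \<bar>k\<bar>) = 3 - 2 * (1/2) ^ K"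
proof (induction K)
  case (Suc K)
  have "{- int (Suc K)..int (Suc K)} = insert (int (Suc K)) (insert (- int (Suc K)) {- int K..int K})" by auto
  then show ?case using Suc by (simp add: nat_add_distrib)
qed simp

lemma abs_le_power2_int: "\<bar>k\<bar> \<le> k\<^sup>2" for k :: int
proof (cases "k = 0")
  case False
  then have "\<bar>k\<bar> * 1 \<le> \<bar>k\<bar> * \<bar>k\<bar>" by (intro mult_left_mono) auto
  then show ?thesis by (simp add: power2_eq_square)
qed simp

text \<open>Counting by a generating function: give a point the weight 2 to the minus sum of its
  absolute coordinates. Since |k| is at most k^2 for integers, each counted point has weight at
  least 2^(-R), while the weights of the whole box factor over 2 n real coordinates, each factor
  being at most 3.\<close>

lemma card_lattice_points:
  fixes R K n :: nat
  defines "bx \<equiv> {- int K..int K} \<times> {- int K..int K}"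
  defines "G \<equiv> {\<kappa> \<in> {..<n} \<rightarrow>\<^sub>E bx. (\<Sum>j<n. (fst (\<kappa> j))\<^sup>2 + (snd (\<kappa> j))\<^sup>2) \<le> int R}"
  shows "finite G" "real (card G) \<le> 2 ^ R * 9 ^ n"
proof -
  let ?h = "\<lambda>p::int \<times> int. (1/2::real) ^ (nat \<bar>fst p\<bar> + nat \<bar>snd p\<bar>)"
  have fb: "finite ({..<n} \<rightarrow>\<^sub>E bx)" by (intro finite_PiE) (auto simp: bx_def)
  then show fin: "finite G" unfolding G_def by (rule rev_finite_subset) auto
  have one: "1 \<le> 2 ^ R * (\<Prod>j<n. ?h (\<kappa> j))" if "\<kappa> \<in> G" for \<kappa>
  proof -
    have "int (\<Sum>j<n. nat \<bar>fst (\<kappa> j)\<bar> + nat \<bar>snd (\<kappa> j)\<bar>) = (\<Sum>j<n. \<bar>fst (\<kappa> j)\<bar> + \<bar>snd (\<kappa> j)\<bar>)"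
      by simp
    also have "\<dots> \<le> (\<Sum>j<n. (fst (\<kappa> j))\<^sup>2 + (snd (\<kappa> j))\<^sup>2)"
      by (intro sum_mono add_mono abs_le_power2_int)
    also have "\<dots> \<le> int R" using that by (simp add: G_def)
    finally have "(\<Sum>j<n. nat \<bar>fst (\<kappa> j)\<bar> + nat \<bar>snd (\<kappa> j)\<bar>) \<le> R" by linarith
    then have "(1/2::real) ^ R \<le> (1/2) ^ (\<Sum>j<n. nat \<bar>fst (\<kappa> j)\<bar> + nat \<bar>snd (\<kappa> j)\<bar>)"
      by (intro power_decreasing) auto
    also have "\<dots> = (\<Prod>j<n. ?h (\<kappa> j))" by (rule power_sum)
    finally have "2 ^ R * (1/2::real) ^ R \<le> 2 ^ R * (\<Prod>j<n. ?h (\<kappa> j))" by (intro mult_left_mono) auto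
    then show ?thesis by (simp add: power_mult_distrib[symmetric])
  qed
  have "real (card G) = (\<Sum>\<kappa>\<in>G. 1)" by simp
  also have "\<dots> \<le> (\<Sum>\<kappa>\<in>G. 2 ^ R * (\<Prod>j<n. ?h (\<kappa> j)))" by (intro sum_mono one)
  also have "\<dots> \<le> (\<Sum>\<kappa>\<in>{..<n} \<rightarrow>\<^sub>E bx. 2 ^ R * (\<Prod>j<n. ?h (\<kappa> j)))"
  proof (rule sum_mono2[OF fb])
    show "G \<subseteq> {..<n} \<rightarrow>\<^sub>E bx" unfolding G_def by (rule Collect_restrict)
  qed (intro mult_nonneg_nonneg prod_nonneg ballI zero_le_power; simp)
  also have "\<dots> = 2 ^ R * (\<Prod>j<n. \<Sum>p\<in>bx. ?h p)"
  proof -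
    have "(\<Prod>j<n. \<Sum>p\<in>bx. ?h p) = (\<Sum>\<kappa>\<in>{..<n} \<rightarrow>\<^sub>E bx. \<Prod>j<n. ?h (\<kappa> j))"
      by (rule prod_sum_PiE) (simp_all add: bx_def)
    then show ?thesis unfolding sum_distrib_left[symmetric] by (rule arg_cong[OF sym])
  qed
  also have "(\<Sum>p\<in>bx. ?h p) = (\<Sum>k\<in>{- int K..int K}. (1/2::real) ^ nat \<bar>k\<bar>)\<^sup>2"
  proof -
    have "(\<Sum>p\<in>bx. ?h p) = (\<Sum>(k, l)\<in>bx. (1/2) ^ nat \<bar>k\<bar> * (1/2) ^ nat \<bar>l\<bar>)"
      unfolding split_beta power_add ..
    also have "\<dots> = (\<Sum>k\<in>{- int K..int K}. \<Sum>l\<in>{- int K..int K}. (1/2::real) ^ nat \<bar>k\<bar> * (1/2) ^ nat \<bar>l\<bar>)"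
      unfolding bx_def by (rule sum.cartesian_product[symmetric])
    finally show ?thesis unfolding power2_eq_square sum_product .
  qed
  also have "2 ^ R * (\<Prod>j<n. (\<Sum>k\<in>{- int K..int K}. (1/2::real) ^ nat \<bar>k\<bar>)\<^sup>2) \<le> 2 ^ R * (\<Prod>j<n. 3\<^sup>2)"
  proof -
    let ?S = "\<Sum>k\<in>{- int K..int K}. (1/2::real) ^ nat \<bar>k\<bar>"
    have "0 \<le> ?S" by (intro sum_nonneg) auto
    moreover have "?S \<le> 3" by (simp add: sum_half_powers)
    ultimately show ?thesis by (intro mult_left_mono prod_mono conjI power_mono zero_le_power2) auto
  qed
  finally show "real (card G) \<le> 2 ^ R * 9 ^ n" by simp
qed

lemma nsq_add_le: "nsq n (\<lambda>j. a j + b j) \<le> 2 * nsq n a + 2 * nsq n b"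
proof -
  have "(cmod (x + y))\<^sup>2 \<le> 2 * (cmod x)\<^sup>2 + 2 * (cmod y)\<^sup>2" for x y
    unfolding cmod_power2 using zero_le_power2[of "Re x - Re y"] zero_le_power2[of "Im x - Im y"]
    by (simp add: power2_eq_square algebra_simps)
  then show ?thesis unfolding nsq_def sum_distrib_left sum.distrib[symmetric] by (intro sum_mono)
qed

text \<open>The net consists of scaled Gaussian integers, and a vector is rounded coordinatewise.
  Rounding may leave the unit ball, which explains the weaker bound 4 on net points.\<close>

lemma unit_ball_net:
  assumes N: "(N::nat) > 0" and n: "n > 0"
  shows "\<exists>T. finite T \<and> real (card T) \<le> (9 * 2 ^ (8 * N\<^sup>2)) ^ n \<and> (\<forall>v'\<in>T. nsq n v' \<le> 4) \<and>
    (\<forall>v. nsq n v \<le> 1 \<longrightarrow> (\<exists>v'\<in>T. nsq n (\<lambda>j. v j - v' j) \<le> (1 / real N)\<^sup>2))"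
proof -
  \<comment> \<open>The mesh \<open>h\<close> is such that an error of at most \<open>h\<close> in
    each of 2 n real coordinates has squared norm 2 n h^2 = 1 / N^2. In lattice units the ball of
    radius 2 has squared radius R = 4 / h^2.\<close>
  define R where "R = 8 * N\<^sup>2 * n"
  define h where "h = 1 / (real N * sqrt (2 * real n))"
  have h: "h > 0" using N n by (simp add: h_def)
  have h2: "h\<^sup>2 = 1 / (2 * (real N)\<^sup>2 * real n)" using n by (simp add: h_def power_divide power_mult_distrib)
  \<comment> \<open>The box serves to make the index set finite: k^2 at most \<open>R\<close>
    already forces |k| at most \<open>R\<close>.\<close>
  define bx where "bx = {- int R..int R} \<times> {- int R..int R}"
  define G where "G = {\<kappa> \<in> {..<n} \<rightarrow>\<^sub>E bx. (\<Sum>j<n. (fst (\<kappa> j))\<^sup>2 + (snd (\<kappa> j))\<^sup>2) \<le> int R}"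
  have fG: "finite G" and cG: "real (card G) \<le> 2 ^ R * 9 ^ n"
    using card_lattice_points[where n=n and R=R and K=R] unfolding G_def bx_def by auto
  define P where "P \<kappa> j = complex_of_real h * Complex (real_of_int (fst (\<kappa> j))) (real_of_int (snd (\<kappa> j)))"
    for \<kappa> :: "nat \<Rightarrow> int \<times> int" and j
  have nP: "nsq n (P \<kappa>) = h\<^sup>2 * real_of_int (\<Sum>j<n. (fst (\<kappa> j))\<^sup>2 + (snd (\<kappa> j))\<^sup>2)" for \<kappa>
    by (simp add: nsq_def P_def norm_mult power_mult_distrib cmod_power2 sum_distrib_left distrib_left sum.distrib)
  have hR: "h\<^sup>2 * real R = 4" using N n by (simp add: h2 R_def field_simps)
  show ?thesis
  proof (intro exI[of _ "P ` G"] conjI ballI allI impI)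
    show "finite (P ` G)" using fG by simp
    have "real (card (P ` G)) \<le> real (card G)" using card_image_le[OF fG] by simp
    also have "\<dots> \<le> 2 ^ R * 9 ^ n" by (rule cG)
    also have "\<dots> = (9 * 2 ^ (8 * N\<^sup>2)) ^ n" by (simp add: R_def power_mult_distrib power_mult)
    finally show "real (card (P ` G)) \<le> (9 * 2 ^ (8 * N\<^sup>2)) ^ n" .
  next
    fix v' assume "v' \<in> P ` G"
    then obtain \<kappa> where k: "v' = P \<kappa>" "(\<Sum>j<n. (fst (\<kappa> j))\<^sup>2 + (snd (\<kappa> j))\<^sup>2) \<le> int R"
      by (auto simp: G_def)
    then have "real_of_int (\<Sum>j<n. (fst (\<kappa> j))\<^sup>2 + (snd (\<kappa> j))\<^sup>2) \<le> real R" by linarith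
    then have "nsq n v' \<le> h\<^sup>2 * real R" unfolding k nP by (intro mult_left_mono) auto
    then show "nsq n v' \<le> 4" using hR by simp
  next
    fix v assume v: "nsq n v \<le> 1"
    define \<kappa> where "\<kappa> = (\<lambda>j\<in>{..<n}. (\<lfloor>Re (v j) / h\<rfloor>, \<lfloor>Im (v j) / h\<rfloor>))"
    have fl: "(x - h * real_of_int \<lfloor>x / h\<rfloor>)\<^sup>2 \<le> h\<^sup>2" for x
    proof -
      have "x = h * (x / h)" using h by simp
      then have "x - h * real_of_int \<lfloor>x / h\<rfloor> = h * frac (x / h)"
        by (simp add: frac_def algebra_simps)
      moreover have "(frac (x / h))\<^sup>2 \<le> 1" using frac_lt_1[of "x/h"] by (simp add: power_le_one less_imp_le)
      ultimately show ?thesis using h by (simp add: power_mult_distrib)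
    qed
    have d: "(cmod (v j - P \<kappa> j))\<^sup>2 \<le> 2 * h\<^sup>2" if "j < n" for j
      using that fl[of "Re (v j)"] fl[of "Im (v j)"] by (simp add: P_def \<kappa>_def cmod_power2)
    have "nsq n (\<lambda>j. v j - P \<kappa> j) \<le> (\<Sum>j<n. 2 * h\<^sup>2)"
      unfolding nsq_def by (intro sum_mono d) auto
    also have "\<dots> = (1 / real N)\<^sup>2" using N n by (simp add: h2 power_divide)
    finally have close: "nsq n (\<lambda>j. v j - P \<kappa> j) \<le> (1 / real N)\<^sup>2" .
    have "nsq n (P \<kappa>) = nsq n (\<lambda>j. v j + (P \<kappa> j - v j))" by simp
    also have "\<dots> \<le> 2 * nsq n v + 2 * nsq n (\<lambda>j. P \<kappa> j - v j)" by (rule nsq_add_le)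
    also have "nsq n (\<lambda>j. P \<kappa> j - v j) = nsq n (\<lambda>j. v j - P \<kappa> j)" by (simp add: nsq_def norm_minus_commute)
    also have "2 * nsq n v + 2 * nsq n (\<lambda>j. v j - P \<kappa> j) \<le> 2 + 2 * (1 / real N)\<^sup>2" using v close by simp
    also have "(1 / real N)\<^sup>2 \<le> 1" using N by (simp add: power_le_one)
    finally have "h\<^sup>2 * real_of_int (\<Sum>j<n. (fst (\<kappa> j))\<^sup>2 + (snd (\<kappa> j))\<^sup>2) \<le> h\<^sup>2 * real R"
      unfolding nP hR by simp
    then have "real_of_int (\<Sum>j<n. (fst (\<kappa> j))\<^sup>2 + (snd (\<kappa> j))\<^sup>2) \<le> real R" using h by simp
    then have le: "(\<Sum>j<n. (fst (\<kappa> j))\<^sup>2 + (snd (\<kappa> j))\<^sup>2) \<le> int R" by linarith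
    have "\<kappa> j \<in> bx" if "j < n" for j
    proof -
      have "(fst (\<kappa> j))\<^sup>2 + (snd (\<kappa> j))\<^sup>2 \<le> (\<Sum>j<n. (fst (\<kappa> j))\<^sup>2 + (snd (\<kappa> j))\<^sup>2)"
        using that by (intro member_le_sum) auto
      then have "\<bar>fst (\<kappa> j)\<bar> \<le> int R" "\<bar>snd (\<kappa> j)\<bar> \<le> int R"
        using le abs_le_power2_int[of "fst (\<kappa> j)"] abs_le_power2_int[of "snd (\<kappa> j)"] zero_le_power2[of "fst (\<kappa> j)"] zero_le_power2[of "snd (\<kappa> j)"] by linarith+
      then show ?thesis by (cases "\<kappa> j") (auto simp: bx_def abs_le_iff)
    qed
    then have "\<kappa> \<in> G" using le by (auto simp: G_def \<kappa>_def)
    then show "\<exists>v'\<in>P ` G. nsq n (\<lambda>j. v j - v' j) \<le> (1 / real N)\<^sup>2" using close by blast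
  qed
qed

section \<open>One step of alternating projections\<close>

lemma cmod_phase[simp]: "cmod (phase z) = 1"
  by (simp add: phase_def norm_divide)

lemma phase_mult: "a \<noteq> 0 \<Longrightarrow> b \<noteq> 0 \<Longrightarrow> phase (a * b) = phase a * phase b"
  by (simp add: phase_def norm_mult)

lemma norm_times_phase: "complex_of_real (cmod z) * phase z = z"
  by (simp add: phase_def)

text \<open>If \<theta> is the argument of \<open>w\<close>, the left side is 2 (1 - cos \<theta>)
  and the right side is the square of tan \<theta>.\<close>

lemma phase_minus_one_le:
  assumes "Re w > 0"
  shows "(cmod (phase w - 1))\<^sup>2 \<le> (Im w)\<^sup>2 / (Re w)\<^sup>2"
proof -
  define r where "r = cmod w"
  have w0: "w \<noteq> 0" using assms by auto
  have r: "r > 0" "r\<^sup>2 = (Re w)\<^sup>2 + (Im w)\<^sup>2" using w0 by (auto simp: r_def cmod_power2)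
  have xr: "Re w \<le> r" by (simp add: r_def complex_Re_le_cmod)
  have "(cmod (phase w - 1))\<^sup>2 = (Re w / r - 1)\<^sup>2 + (Im w / r)\<^sup>2"
    using w0 by (simp add: phase_def cmod_power2 r_def)
  also have "\<dots> = ((Re w)\<^sup>2 + (Im w)\<^sup>2) / r\<^sup>2 - 2 * Re w / r + 1"
    by (simp add: power2_diff power_divide add_divide_distrib)
  also have "\<dots> = 2 * (r - Re w) / r" unfolding r(2)[symmetric] using r(1) by (simp add: field_simps)
  also have "\<dots> \<le> (Im w)\<^sup>2 / (Re w)\<^sup>2"
  proof -
    have "2 * (r - Re w) * (Re w)\<^sup>2 \<le> (r - Re w) * (r + Re w) * r"
    proof -
      have "2 * (Re w)\<^sup>2 \<le> (r + Re w) * r"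
      proof -
        have "Re w * Re w \<le> r * r" "Re w * Re w \<le> Re w * r"
          using xr assms r(1) by (auto intro!: mult_mono)
        then show ?thesis by (simp add: power2_eq_square algebra_simps)
      qed
      then have "(r - Re w) * (2 * (Re w)\<^sup>2) \<le> (r - Re w) * ((r + Re w) * r)"
        using xr by (intro mult_left_mono) auto
      then show ?thesis by (simp add: algebra_simps)
    qed
    also have "(r - Re w) * (r + Re w) * r = (Im w)\<^sup>2 * r"
      using r(2) by (simp add: algebra_simps power2_eq_square)
    finally show ?thesis using assms r(1) by (simp add: field_simps)
  qed
  finally show ?thesis .
qed

text \<open>Turn by the phase of \<open>c\<close>: then \<open>c + d\<close> becomes |c| + e with
  |e| = |d|. If |d| is below |c| / 10, the real part is at least 9/10 of |c|, and to the phase error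
  only the imaginary part of e contributes; 81/100 is the square of 9/10. Otherwise, in particular
  for \<open>c = 0\<close>, the triangle inequality gives 2 |c|, hence the factor 4.\<close>

lemma phase_perturbation:
  assumes "\<alpha> \<noteq> 0"
  shows "(cmod (complex_of_real (cmod c) * phase (\<alpha> * (c + d)) - phase \<alpha> * c))\<^sup>2
    \<le> 4 * (if cmod c \<le> 10 * cmod d then (cmod c)\<^sup>2 else 0) + (Im (d * cnj (phase c)))\<^sup>2 / (81/100)"
proof (cases "cmod c \<le> 10 * cmod d")
  case True
  have "cmod (complex_of_real (cmod c) * phase (\<alpha> * (c + d)) - phase \<alpha> * c) \<le> cmod c + cmod c"
    by (rule order_trans[OF norm_triangle_ineq4]) (simp add: norm_mult)
  then have "(cmod (complex_of_real (cmod c) * phase (\<alpha> * (c + d)) - phase \<alpha> * c))\<^sup>2 \<le> (2 * cmod c)\<^sup>2"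
    by (intro power_mono) auto
  with True show ?thesis by (simp add: power_mult_distrib add_increasing2)
next
  case False
  define \<omega> e w where "\<omega> = phase c" and "e = d * cnj \<omega>" and "w = complex_of_real (cmod c) + e"
  have w1: "\<omega> * cnj \<omega> = 1" by (simp add: \<omega>_def flip: complex_norm_square)
  have c: "c = \<omega> * complex_of_real (cmod c)" using norm_times_phase[of c] by (simp add: \<omega>_def mult.commute)
  have c0: "cmod c > 0" using False by (meson mult_nonneg_nonneg norm_ge_zero not_le order_trans zero_le_numeral)
  have ne: "cmod e = cmod d" by (simp add: e_def \<omega>_def norm_mult)
  have "Re w \<ge> cmod c - cmod d" using abs_Re_le_cmod[of e] by (simp add: w_def ne)
  then have Rw: "Re w \<ge> (9/10) * cmod c" using False by simp
  then have Rw0: "Re w > 0" using c0 by linarith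
  have cd: "c + d = \<omega> * w"
    using w1 by (subst c) (simp add: w_def e_def algebra_simps)
  have w0: "w \<noteq> 0" "\<omega> \<noteq> 0" using Rw0 by (auto simp: \<omega>_def phase_def)
  have "cmod \<omega> = 1" by (simp add: \<omega>_def)
  then have ph: "phase \<omega> = \<omega>" using w0 by (simp add: phase_def[of \<omega>])
  have "phase (\<alpha> * (c + d)) = phase \<alpha> * (\<omega> * phase w)"
    unfolding cd using assms w0 by (simp add: phase_mult ph)
  then have "cmod (complex_of_real (cmod c) * phase (\<alpha> * (c + d)) - phase \<alpha> * c)
     = cmod ((phase \<alpha> * \<omega> * complex_of_real (cmod c)) * (phase w - 1))"
    unfolding arg_cong[OF c, of "(*) (phase \<alpha>)"] by (simp add: algebra_simps)
  also have "\<dots> = cmod c * cmod (phase w - 1)" by (simp add: norm_mult \<omega>_def)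
  finally have "(cmod (complex_of_real (cmod c) * phase (\<alpha> * (c + d)) - phase \<alpha> * c))\<^sup>2 = (cmod c)\<^sup>2 * (cmod (phase w - 1))\<^sup>2"
    by (simp add: power_mult_distrib)
  also have "\<dots> \<le> (cmod c)\<^sup>2 * ((Im w)\<^sup>2 / (Re w)\<^sup>2)"
    by (intro mult_left_mono phase_minus_one_le Rw0) auto
  also have "\<dots> = (Im w)\<^sup>2 * ((cmod c)\<^sup>2 / (Re w)\<^sup>2)" by simp
  also have "\<dots> \<le> (Im w)\<^sup>2 * (1 / (81/100))"
  proof (intro mult_left_mono)
    have "((9/10) * cmod c)\<^sup>2 \<le> (Re w)\<^sup>2" using Rw by (intro power_mono) auto
    then show "(cmod c)\<^sup>2 / (Re w)\<^sup>2 \<le> 1 / (81/100)" using Rw0 by (simp add: field_simps power2_eq_square)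
  qed simp
  also have "Im w = Im (d * cnj (phase c))" by (simp add: w_def e_def \<omega>_def)
  finally show ?thesis using False by simp
qed

section \<open>Algebra of linear forms and the least squares bound\<close>

lemma lin_add: "lin n a (\<lambda>j. u j + v j) = lin n a u + lin n a v"
  by (simp add: lin_def sum.distrib distrib_left)
lemma lin_diff: "lin n a (\<lambda>j. u j - v j) = lin n a u - lin n a v"
  by (simp add: lin_def sum_subtractf right_diff_distrib)
lemma lin_scale: "lin n a (\<lambda>j. s * v j) = s * lin n a v"
  by (simp add: lin_def sum_distrib_left mult.left_commute)
lemma nsq_scale: "nsq n (\<lambda>j. s * v j) = (cmod s)\<^sup>2 * nsq n v"
  by (simp add: nsq_def norm_mult power_mult_distrib sum_distrib_left)
lemma inn_self: "inn n u u = complex_of_real (nsq n u)"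
  by (simp add: inn_def nsq_def complex_norm_square[symmetric])
lemma inn_commute: "inn n v u = cnj (inn n u v)"
  by (simp add: inn_def mult.commute)

lemma nsq_pythagoras:
  assumes "inn n u y = 0"
  shows "nsq n (\<lambda>j. s * u j + t * y j) = (cmod s)\<^sup>2 * nsq n u + (cmod t)\<^sup>2 * nsq n y"
proof -
  have y: "inn n y u = 0" using assms inn_commute[of n y u] by simp
  have "complex_of_real (nsq n (\<lambda>j. s * u j + t * y j)) = inn n (\<lambda>j. s * u j + t * y j) (\<lambda>j. s * u j + t * y j)"
    by (simp add: inn_self)
  also have "\<dots> = s * cnj s * inn n u u + s * cnj t * inn n u y + t * cnj s * inn n y u + t * cnj t * inn n y y"
    by (simp add: inn_def sum_distrib_left algebra_simps sum.distrib)
  also have "\<dots> = complex_of_real ((cmod s)\<^sup>2 * nsq n u + (cmod t)\<^sup>2 * nsq n y)"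
    using assms y by (simp add: inn_self complex_norm_square[symmetric])
  finally show ?thesis by (simp only: of_real_eq_iff)
qed

text \<open>The normal equations say that the residual is orthogonal to the range of the matrix, so
  the fitted vector is an orthogonal projection of \<open>\<rho>\<close> and cannot be
  longer.\<close>

lemma least_squares_le:
  assumes ne: "\<And>j. j < n \<Longrightarrow> (\<Sum>i<m. cnj (w (i, j)) * (\<rho> i - lin n (mrow w i) e)) = 0"
  shows "(\<Sum>i<m. (cmod (lin n (mrow w i) e))\<^sup>2) \<le> (\<Sum>i<m. (cmod (\<rho> i))\<^sup>2)"
proof -
  let ?g = "\<lambda>i. lin n (mrow w i) e"
  have "(\<Sum>i<m. cnj (?g i) * (\<rho> i - ?g i)) = (\<Sum>i<m. \<Sum>j<n. cnj (e j) * (cnj (w (i, j)) * (\<rho> i - ?g i)))"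
    by (simp add: lin_def mrow_def sum_distrib_right sum_distrib_left mult_ac)
  also have "\<dots> = (\<Sum>j<n. cnj (e j) * (\<Sum>i<m. cnj (w (i, j)) * (\<rho> i - ?g i)))"
    unfolding sum_distrib_left by (rule sum.swap)
  also have "\<dots> = 0" using ne by simp
  finally have "(\<Sum>i<m. Re (cnj (?g i) * (\<rho> i - ?g i))) = 0"
    unfolding Re_sum[symmetric] by (simp only: zero_complex.sel)
  moreover have "2 * Re (cnj g * (r - g)) \<le> (cmod r)\<^sup>2 - (cmod g)\<^sup>2" for g r
    unfolding cmod_power2 using zero_le_power2[of "Re g - Re r"] zero_le_power2[of "Im g - Im r"]
    by (simp add: power2_eq_square algebra_simps)
  then have "(\<Sum>i<m. 2 * Re (cnj (?g i) * (\<rho> i - ?g i))) \<le> (\<Sum>i<m. (cmod (\<rho> i))\<^sup>2 - (cmod (?g i))\<^sup>2)"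
    by (intro sum_mono)
  ultimately show ?thesis by (simp add: sum_subtractf flip: sum_distrib_left)
qed

text \<open>The deterministic core of one iteration: all randomness is in the three estimates
  \<open>lower\<close>, \<open>imag\<close> and \<open>small\<close>. The point \<open>x\<close> may
  be any positive multiple of the current iterate, since only phases of its linear forms
  enter.\<close>

lemma altproj_contraction:
  fixes u :: "nat \<Rightarrow> complex" and w :: "nat \<times> nat \<Rightarrow> complex"
  assumes u: "nsq n u = 1" and m: "m > 0"
    and lower: "\<And>v. (99/100) * real m * nsq n v \<le> (\<Sum>i<m. (cmod (lin n (mrow w i) v))\<^sup>2)"
    and imag: "\<And>v. inn n u v = 0 \<Longrightarrow>
      (\<Sum>i<m. (Im (lin n (mrow w i) v * cnj (phase (lin n (mrow w i) u))))\<^sup>2) \<le> (51/100) * real m * nsq n v"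
    and small: "\<And>v. nsq n v \<le> \<gamma>\<^sup>2 \<Longrightarrow>
      (\<Sum>i<m. if cmod (lin n (mrow w i) u) \<le> 10 * cmod (lin n (mrow w i) v) then (cmod (lin n (mrow w i) u))\<^sup>2 else 0)
        \<le> (1/100) * real m * nsq n v"
    and e: "0 \<le> \<epsilon>" "\<epsilon> \<le> 1/10" "2 * \<epsilon> \<le> \<gamma>"
    and close: "nsq n (\<lambda>j. exp (\<i> * complex_of_real \<phi>) * u j - x j) \<le> \<epsilon>\<^sup>2"
    and ne: "\<And>j. j < n \<Longrightarrow> (\<Sum>i<m. cnj (w (i, j)) *
       (complex_of_real (cmod (lin n (mrow w i) u)) * phase (lin n (mrow w i) x) - lin n (mrow w i) z)) = 0"
  shows "\<exists>\<phi>'. nsq n (\<lambda>j. exp (\<i> * complex_of_real \<phi>') * u j - z j) \<le> ((19/20) * \<epsilon>)\<^sup>2"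
proof -
  define \<alpha> where "\<alpha> = inn n x u"
  define y where "y j = x j - \<alpha> * u j" for j
  have "inn n y u = inn n x u - \<alpha> * inn n u u"
    by (simp add: inn_def y_def sum_subtractf left_diff_distrib sum_distrib_left mult.assoc)
  then have "inn n y u = 0" using u by (simp add: inn_self \<alpha>_def)
  then have uy: "inn n u y = 0" using inn_commute[of n u y] by simp
  have "(\<lambda>j. exp (\<i> * complex_of_real \<phi>) * u j - x j) = (\<lambda>j. (exp (\<i> * complex_of_real \<phi>) - \<alpha>) * u j + (-1) * y j)"
    by (auto simp: y_def algebra_simps)
  then have "(cmod (exp (\<i> * complex_of_real \<phi>) - \<alpha>))\<^sup>2 + nsq n y \<le> \<epsilon>\<^sup>2"
    using close nsq_pythagoras[OF uy, of "exp (\<i> * complex_of_real \<phi>) - \<alpha>" "-1"] u by simp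
  then have A: "(cmod (exp (\<i> * complex_of_real \<phi>) - \<alpha>))\<^sup>2 \<le> \<epsilon>\<^sup>2" and Y: "nsq n y \<le> \<epsilon>\<^sup>2"
    using nsq_nonneg[of n y] zero_le_power2[of "cmod (exp (\<i> * complex_of_real \<phi>) - \<alpha>)"] by linarith+
  have "cmod (exp (\<i> * complex_of_real \<phi>) - \<alpha>) \<le> \<epsilon>" using A e(1) power2_le_imp_le by blast
  then have a9: "cmod \<alpha> \<ge> (9/10)"
    using norm_triangle_ineq2[of "exp (\<i> * complex_of_real \<phi>)" \<alpha>] e by simp
  then have a0: "\<alpha> \<noteq> 0" by auto
  define \<beta> where "\<beta> = 1 / \<alpha>"
  define v where "v j = \<beta> * y j" for j
  have a81: "(cmod \<alpha>)\<^sup>2 \<ge> (81/100)" using power_mono[OF a9, of 2] by (simp add: power2_eq_square)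
  \<comment> \<open>The coefficient \<open>\<alpha>\<close> is within \<open>\<epsilon>\<close> of a
    unit number, so |\<alpha>| is at least 9/10; dividing the orthogonal part by
    \<open>\<alpha>\<close> costs 100/81, and 100/81 being at most 4 explains the requirement
    \<open>2 * \<epsilon> \<le> \<gamma>\<close>.\<close>
  have nv: "81 * nsq n v \<le> 100 * \<epsilon>\<^sup>2"
  proof -
    have "nsq n v = nsq n y / (cmod \<alpha>)\<^sup>2" unfolding v_def nsq_scale by (simp add: \<beta>_def norm_divide power_divide)
    also have "\<dots> \<le> \<epsilon>\<^sup>2 / (81/100)" using Y a81 by (intro frac_le) auto
    finally show ?thesis by simp
  qed
  have vg: "nsq n v \<le> \<gamma>\<^sup>2"
  proof -
    have "nsq n v \<le> 4 * \<epsilon>\<^sup>2" using nv zero_le_power2[of \<epsilon>] by linarith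
    also have "\<dots> = (2 * \<epsilon>)\<^sup>2" by (simp add: power_mult_distrib)
    also have "\<dots> \<le> \<gamma>\<^sup>2" using e by (intro power_mono) auto
    finally show ?thesis .
  qed
  have "inn n u v = cnj \<beta> * inn n u y"
    unfolding inn_def v_def sum_distrib_left by (intro sum.cong) (auto simp: mult.left_commute)
  then have uv: "inn n u v = 0" using uy by simp
  let ?c = "\<lambda>i. lin n (mrow w i) u" and ?d = "\<lambda>i. lin n (mrow w i) v"
  have ab: "\<alpha> * \<beta> = 1" using a0 by (simp add: \<beta>_def)
  have x: "x = (\<lambda>j. \<alpha> * (u j + v j))"
    by (rule ext) (simp add: v_def y_def distrib_left mult.assoc[symmetric] ab)
  have lx: "lin n (mrow w i) x = \<alpha> * (?c i + ?d i)" for i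
    unfolding x by (simp add: lin_scale lin_add)
  \<comment> \<open>The comparison point on the orbit of \<open>u\<close>. Its image lies in the
    range of the matrix, so the fit of \<open>z - T\<close> has the data \<open>\<rho>\<close>, the
    entrywise phase error.\<close>
  define T where "T j = phase \<alpha> * u j" for j
  define \<rho> where "\<rho> i = complex_of_real (cmod (?c i)) * phase (\<alpha> * (?c i + ?d i)) - phase \<alpha> * ?c i" for i
  have "(\<Sum>i<m. (cmod (lin n (mrow w i) (\<lambda>j. z j - T j)))\<^sup>2) \<le> (\<Sum>i<m. (cmod (\<rho> i))\<^sup>2)"
  proof (rule least_squares_le)
    fix j assume "j < n"
    then show "(\<Sum>i<m. cnj (w (i, j)) * (\<rho> i - lin n (mrow w i) (\<lambda>j. z j - T j))) = 0"
      using ne[of j] unfolding lx \<rho>_def T_def lin_diff lin_scale by simp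
  qed
  also have "\<dots> \<le> (\<Sum>i<m. 4 * (if cmod (?c i) \<le> 10 * cmod (?d i) then (cmod (?c i))\<^sup>2 else 0)
      + (Im (?d i * cnj (phase (?c i))))\<^sup>2 / (81/100))"
    unfolding \<rho>_def by (intro sum_mono phase_perturbation a0)
  also have "\<dots> = 4 * (\<Sum>i<m. if cmod (?c i) \<le> 10 * cmod (?d i) then (cmod (?c i))\<^sup>2 else 0)
      + (\<Sum>i<m. (Im (?d i * cnj (phase (?c i))))\<^sup>2) / (81/100)"
    unfolding sum.distrib sum_distrib_left sum_divide_distrib ..
  also have "\<dots> \<le> 4 * ((1/100) * real m * nsq n v) + ((51/100) * real m * nsq n v) / (81/100)"
    by (intro add_mono mult_left_mono divide_right_mono small imag vg uv) auto
  finally have "(99/100) * real m * nsq n (\<lambda>j. z j - T j) \<le> 4 * ((1/100) * real m * nsq n v) + ((51/100) * real m * nsq n v) / (81/100)"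
    using lower[of "\<lambda>j. z j - T j"] by linarith
  then have "real m * ((99/100) * nsq n (\<lambda>j. z j - T j)) \<le> real m * (((4/100) + (51/100) / (81/100)) * nsq n v)"
    by (simp add: algebra_simps)
  then have "(99/100) * nsq n (\<lambda>j. z j - T j) \<le> ((4/100) + (51/100) / (81/100)) * nsq n v"
    using m by (simp only: mult_le_cancel_left_pos of_nat_0_less_iff)
  \<comment> \<open>The bracket is about 0.6697. Together with the 0.99 on the left and the factor
    100/81 from \<open>nv\<close> this gives about 0.836, below 361/400.\<close>
  also have "\<dots> \<le> (67/100) * nsq n v" by (intro mult_right_mono) auto
  finally have "(99/100) * nsq n (\<lambda>j. z j - T j) \<le> (67/100) * nsq n v" .
  then have "nsq n (\<lambda>j. z j - T j) \<le> (361/400) * \<epsilon>\<^sup>2"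
    using nv zero_le_power2[of \<epsilon>] by linarith
  then have "nsq n (\<lambda>j. z j - T j) \<le> ((19/20) * \<epsilon>)\<^sup>2"
    by (simp add: power2_eq_square)
  moreover have "nsq n (\<lambda>j. z j - T j) = nsq n (\<lambda>j. T j - z j)" by (simp add: nsq_def norm_minus_commute)
  moreover have "phase \<alpha> = exp (\<i> * complex_of_real (Arg \<alpha>))"
  proof -
    have "complex_of_real (cmod \<alpha>) * exp (\<i> * complex_of_real (Arg \<alpha>)) / complex_of_real (cmod \<alpha>)
        = exp (\<i> * complex_of_real (Arg \<alpha>))"
      using a0 by simp
    then show ?thesis unfolding Arg_eq[OF a0, symmetric] using a0 by (simp add: phase_def)
  qed
  ultimately have "nsq n (\<lambda>j. exp (\<i> * complex_of_real (Arg \<alpha>)) * u j - z j) \<le> ((19/20) * \<epsilon>)\<^sup>2"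
    by (simp only: T_def)
  then show ?thesis by (rule exI)
qed

section \<open>Uniform bounds over the unit ball\<close>

text \<open>\<open>p\<close> bounds the probability of failure. A measurable event inside
  \<open>P\<close> is asked for, instead of measurability of \<open>P\<close>, because
  \<open>P\<close> will quantify over uncountably many vectors.\<close>

definition likely :: "nat \<Rightarrow> nat \<Rightarrow> real \<Rightarrow> ((nat \<times> nat \<Rightarrow> complex) \<Rightarrow> bool) \<Rightarrow> bool" where
  "likely n m p P \<longleftrightarrow> (\<exists>E\<in>sets (gaussian_entries m n). measure (gaussian_entries m n) E \<ge> 1 - p \<and> (\<forall>w\<in>E. P w))"

lemma likely_mono: "likely n m p P \<Longrightarrow> (\<And>w. P w \<Longrightarrow> Q w) \<Longrightarrow> p \<le> q \<Longrightarrow> likely n m q Q"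
  unfolding likely_def by (elim bexE conjE, intro bexI conjI ballI) (auto elim: order_trans[rotated])

lemma likely_conj:
  assumes "likely n m p P" "likely n m q Q"
  shows "likely n m (p + q) (\<lambda>w. P w \<and> Q w)"
proof -
  interpret prob_space "gaussian_entries m n" by (rule prob_space_gaussian_entries)
  obtain E F where E: "E \<in> events" "prob E \<ge> 1 - p" "\<forall>w\<in>E. P w"
    and F: "F \<in> events" "prob F \<ge> 1 - q" "\<forall>w\<in>F. Q w"
    using assms unfolding likely_def by blast
  have "prob (E \<union> F) + prob (E \<inter> F) = prob E + prob F"
    using E(1) F(1) finite_measure_Union'[of E F] finite_measure_Diff'[of F E]
    by (simp add: Int_commute)
  then have "prob (E \<inter> F) \<ge> 1 - (p + q)" using prob_le_1[of "E \<union> F"] E(2) F(2) by linarith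
  then show ?thesis using E F unfolding likely_def by (intro bexI[of _ "E \<inter> F"]) auto
qed

lemma likely_avoid:
  assumes "A \<in> sets (gaussian_entries m n)" "measure (gaussian_entries m n) A \<le> p"
  shows "likely n m p (\<lambda>w. w \<in> space (gaussian_entries m n) \<and> w \<notin> A)"
proof -
  interpret prob_space "gaussian_entries m n" by (rule prob_space_gaussian_entries)
  show ?thesis unfolding likely_def using assms prob_compl[OF assms(1)]
    by (intro bexI[of _ "space (gaussian_entries m n) - A"]) auto
qed

text \<open>The constants precede \<open>n\<close>, \<open>m\<close> and \<open>u\<close>, so they
  are absolute; the ratio \<open>M\<close> leaves room for the size of a net, which is exponential
  in \<open>n\<close>.\<close>

definition whp :: "(nat \<Rightarrow> nat \<Rightarrow> (nat \<Rightarrow> complex) \<Rightarrow> (nat \<times> nat \<Rightarrow> complex) \<Rightarrow> bool) \<Rightarrow> bool" where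
  "whp P \<longleftrightarrow> (\<exists>C1>0. \<exists>C2>0. \<exists>M>0. \<forall>n m u. n > 0 \<longrightarrow> m > 0 \<longrightarrow> M * real n \<le> real m \<longrightarrow> nsq n u = 1 \<longrightarrow>
     likely n m (C1 * exp (- C2 * real m)) (P n m u))"

lemma whpI:
  assumes "C1 > 0" "C2 > 0" "M > 0"
    and "\<And>n m u. n > 0 \<Longrightarrow> m > 0 \<Longrightarrow> M * real n \<le> real m \<Longrightarrow> nsq n u = 1 \<Longrightarrow> likely n m (C1 * exp (- C2 * real m)) (P n m u)"
  shows "whp P"
  unfolding whp_def using assms by blast

lemma whpE:
  assumes "whp P"
  obtains C1 C2 M where "C1 > 0" "C2 > 0" "M > 0"
    "\<And>n m u. n > 0 \<Longrightarrow> m > 0 \<Longrightarrow> M * real n \<le> real m \<Longrightarrow> nsq n u = 1 \<Longrightarrow> likely n m (C1 * exp (- C2 * real m)) (P n m u)"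
  using assms unfolding whp_def by blast

lemma whp_mono:
  assumes "whp P" and PQ: "\<And>n m u w. n > 0 \<Longrightarrow> m > 0 \<Longrightarrow> nsq n u = 1 \<Longrightarrow> P n m u w \<Longrightarrow> Q n m u w"
  shows "whp Q"
proof (rule whpE[OF assms(1)])
  fix C1 C2 M
  assume C: "0 < C1" "0 < C2" "0 < M" and P: "\<And>n m u. n > 0 \<Longrightarrow> m > 0 \<Longrightarrow> M * real n \<le> real m \<Longrightarrow> nsq n u = 1 \<Longrightarrow>
    likely n m (C1 * exp (- C2 * real m)) (P n m u)"
  show ?thesis
  proof (rule whpI[OF C])
    fix n m :: nat and u :: "nat \<Rightarrow> complex"
    assume a: "n > 0" "m > 0" "M * real n \<le> real m" "nsq n u = 1"
    show "likely n m (C1 * exp (- C2 * real m)) (Q n m u)"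
      by (rule likely_mono[OF P[OF a] PQ[OF a(1,2,4)]]) auto
  qed
qed

lemma whp_conj:
  assumes "whp P" "whp Q"
  shows "whp (\<lambda>n m u w. P n m u w \<and> Q n m u w)"
proof (rule whpE[OF assms(1)], rule whpE[OF assms(2)])
  fix C1 C2 M C1' C2' M'
  assume C: "0 < C1" "0 < C2" "0 < M" and C': "0 < C1'" "0 < C2'" "0 < M'"
    and P: "\<And>n m u. n > 0 \<Longrightarrow> m > 0 \<Longrightarrow> M * real n \<le> real m \<Longrightarrow> nsq n u = 1 \<Longrightarrow> likely n m (C1 * exp (- C2 * real m)) (P n m u)"
    and Q: "\<And>n m u. n > 0 \<Longrightarrow> m > 0 \<Longrightarrow> M' * real n \<le> real m \<Longrightarrow> nsq n u = 1 \<Longrightarrow> likely n m (C1' * exp (- C2' * real m)) (Q n m u)"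
  show ?thesis
  proof (rule whpI[of "C1 + C1'" "min C2 C2'" "max M M'"])
    fix n m :: nat and u :: "nat \<Rightarrow> complex"
    assume a: "n > 0" "m > 0" "max M M' * real n \<le> real m" "nsq n u = 1"
    have "M * real n \<le> max M M' * real n" "M' * real n \<le> max M M' * real n" by (intro mult_right_mono; simp)+
    then have le: "M * real n \<le> real m" "M' * real n \<le> real m" using a(3) by linarith+
    have "C1 * exp (- C2 * real m) \<le> C1 * exp (- min C2 C2' * real m)"
      "C1' * exp (- C2' * real m) \<le> C1' * exp (- min C2 C2' * real m)"
      using C(1) C'(1) by (auto intro!: mult_right_mono)
    then show "likely n m ((C1 + C1') * exp (- min C2 C2' * real m)) (\<lambda>w. P n m u w \<and> Q n m u w)"
      using likely_conj[OF P[OF a(1,2) le(1) a(4)] Q[OF a(1,2) le(2) a(4)]]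
      by (elim likely_mono) (auto simp: distrib_right)
  qed (use C C' in auto)
qed

lemma whp_single:
  assumes c: "c > 0" and B: "\<And>n m u. nsq n u = 1 \<Longrightarrow> Bad n m u \<in> sets (gaussian_entries m n) \<and>
    emeasure (gaussian_entries m n) (Bad n m u) \<le> ennreal (exp (- c * real m))"
  shows "whp (\<lambda>n m u w. w \<in> space (gaussian_entries m n) \<and> w \<notin> Bad n m u)"
proof (rule whpI[of 1 c 1])
  fix n m :: nat and u :: "nat \<Rightarrow> complex" assume u: "nsq n u = 1"
  interpret prob_space "gaussian_entries m n" by (rule prob_space_gaussian_entries)
  show "likely n m (1 * exp (- c * real m)) (\<lambda>w. w \<in> space (gaussian_entries m n) \<and> w \<notin> Bad n m u)"
    using B[OF u, of m] unfolding emeasure_eq_measure by (intro likely_avoid) (auto simp: ennreal_le_iff)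
qed (use c in auto)

text \<open>Union bound over the net. The conclusion mentions only a nearby good point
  \<open>v'\<close> for each \<open>v\<close>, which hides the net and its dependence on
  \<open>n\<close>.\<close>

lemma whp_net:
  assumes c: "c > 0" and N: "(N::nat) > 0"
    and B: "\<And>n m u v. nsq n u = 1 \<Longrightarrow> nsq n v \<le> 4 \<Longrightarrow> Bad n m u v \<in> sets (gaussian_entries m n) \<and>
    emeasure (gaussian_entries m n) (Bad n m u v) \<le> ennreal (exp (- c * real m))"
  shows "whp (\<lambda>n m u w. w \<in> space (gaussian_entries m n) \<and>
     (\<forall>v. nsq n v \<le> 1 \<longrightarrow> (\<exists>v'. nsq n v' \<le> 4 \<and> nsq n (\<lambda>j. v j - v' j) \<le> (1 / real N)\<^sup>2 \<and> w \<notin> Bad n m u v')))"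
proof -
  define K :: real where "K = 9 * 2 ^ (8 * N\<^sup>2)"
  have K: "K > 1" unfolding K_def by (rule less_le_trans[of _ 9]) auto
  \<comment> \<open>For \<open>m\<close> at least \<open>M * n\<close> the entropy n ln K is at most
    c m / 2, so half of the exponent survives the union bound.\<close>
  define M where "M = 2 * ln K / c"
  have M: "M > 0" using K c by (simp add: M_def)
  show ?thesis
  proof (rule whpI[of 1 "c / 2" M])
    fix n m :: nat and u :: "nat \<Rightarrow> complex"
    assume a: "n > 0" "m > 0" "M * real n \<le> real m" "nsq n u = 1"
    interpret prob_space "gaussian_entries m n" by (rule prob_space_gaussian_entries)
    obtain T where T: "finite T" "real (card T) \<le> K ^ n" "\<forall>v'\<in>T. nsq n v' \<le> 4"
      "\<forall>v. nsq n v \<le> 1 \<longrightarrow> (\<exists>v'\<in>T. nsq n (\<lambda>j. v j - v' j) \<le> (1 / real N)\<^sup>2)"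
      using unit_ball_net[OF N a(1)] unfolding K_def by blast
    have bm: "Bad n m u v \<in> events" if "v \<in> T" for v using B[OF a(4)] T(3) that by blast
    have bp: "prob (Bad n m u v) \<le> exp (- c * real m)" if "v \<in> T" for v
      using B[OF a(4), of v m] T(3) that unfolding emeasure_eq_measure by (simp add: ennreal_le_iff)
    let ?U = "\<Union>v\<in>T. Bad n m u v"
    have Um: "?U \<in> events" using bm T(1) by auto
    have "prob ?U \<le> (\<Sum>v\<in>T. prob (Bad n m u v))"
      using bm T(1) by (intro measure_UNION_le) auto
    also have "\<dots> \<le> real (card T) * exp (- c * real m)"
      using sum_mono[of T "\<lambda>v. prob (Bad n m u v)" "\<lambda>_. exp (- c * real m)"] bp by simp
    also have "\<dots> \<le> K ^ n * exp (- c * real m)" using T(2) by (intro mult_right_mono) auto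
    also have "K ^ n = exp (real n * ln K)" using K by (simp add: exp_of_nat_mult)
    also have "exp (real n * ln K) * exp (- c * real m) = exp (real n * ln K - c * real m)"
      by (simp add: mult_exp_exp)
    also have "\<dots> \<le> exp (- (c / 2) * real m)"
    proof -
      have "c * (M * real n) \<le> c * real m" using a(3) c by (intro mult_left_mono) auto
      then have "2 * (real n * ln K) \<le> c * real m" using c by (simp add: M_def field_simps)
      then show ?thesis by simp
    qed
    finally have U: "prob ?U \<le> 1 * exp (- (c / 2) * real m)" by simp
    show "likely n m (1 * exp (- (c / 2) * real m)) (\<lambda>w. w \<in> space (gaussian_entries m n) \<and>
     (\<forall>v. nsq n v \<le> 1 \<longrightarrow> (\<exists>v'. nsq n v' \<le> 4 \<and> nsq n (\<lambda>j. v j - v' j) \<le> (1 / real N)\<^sup>2 \<and> w \<notin> Bad n m u v')))"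
    proof (rule likely_mono[OF likely_avoid[OF Um U] _ order_refl], intro conjI allI impI)
      fix w v assume w: "w \<in> space (gaussian_entries m n) \<and> w \<notin> ?U"
      show "w \<in> space (gaussian_entries m n)" using w by (rule conjunct1)
      assume "nsq n v \<le> 1"
      then obtain v' where v': "v' \<in> T" "nsq n (\<lambda>j. v j - v' j) \<le> (1 / real N)\<^sup>2" using T(4) by blast
      have "w \<notin> Bad n m u v'" using w v'(1) by (simp only: UN_iff bex_simps not_False_eq_True ball_simps) blast
      then show "\<exists>v'. nsq n v' \<le> 4 \<and> nsq n (\<lambda>j. v j - v' j) \<le> (1 / real N)\<^sup>2 \<and> w \<notin> Bad n m u v'"
        using v' bspec[OF T(3) v'(1)] by (intro exI[of _ v'] conjI)
    qed
  qed (use c M in auto)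
qed

section \<open>Moments of a linear form and perturbation inequalities\<close>

lemma nn_integral_lin:
  assumes [measurable]: "F \<in> borel_measurable borel"
  shows "(\<integral>\<^sup>+a. F (lin n a v) \<partial>gauss_row n) = (\<integral>\<^sup>+x. F (complex_of_real (sqrt (nsq n v)) * x) \<partial>scg)"
proof -
  interpret prob_space scg by (rule prob_space_scg)
  obtain q r where "\<And>F. F \<in> borel_measurable (borel \<Otimes>\<^sub>M borel) \<Longrightarrow>
      (\<integral>\<^sup>+a. F (lin n a v, lin n a v) \<partial>gauss_row n)
      = (\<integral>\<^sup>+x. \<integral>\<^sup>+y. (F (complex_of_real (sqrt (nsq n v)) * x, q * x + r * y) :: ennreal) \<partial>scg \<partial>scg)"
    using nn_integral_lin_pair[of n v v] by blast
  from this[of "\<lambda>p. F (fst p)"] show ?thesis by (simp add: emeasure_space_1)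
qed

lemma lin_second_moment: "(\<integral>\<^sup>+a. ennreal ((cmod (lin n a v))\<^sup>2) \<partial>gauss_row n) = ennreal (nsq n v)"
proof -
  have "(\<integral>\<^sup>+a. ennreal ((cmod (lin n a v))\<^sup>2) \<partial>gauss_row n) = (\<integral>\<^sup>+x. ennreal ((cmod (complex_of_real (sqrt (nsq n v)) * x))\<^sup>2) \<partial>scg)"
    by (rule nn_integral_lin) measurable
  also have "\<dots> = ennreal (nsq n v)"
    using scg_affine_norm2[of 0 "complex_of_real (sqrt (nsq n v))"] by simp
  finally show ?thesis .
qed

text \<open>Net points have squared norm up to 4, and 4 / 8 is the exponent 1/2 of
  \<open>scg_exp_half\<close>.\<close>

lemma lin_exp_moment:
  assumes "nsq n v \<le> 4"
  shows "(\<integral>\<^sup>+a. ennreal (exp ((cmod (lin n a v))\<^sup>2 / 8)) \<partial>gauss_row n) \<le> ennreal 2"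
proof -
  have "(\<integral>\<^sup>+a. ennreal (exp ((cmod (lin n a v))\<^sup>2 / 8)) \<partial>gauss_row n)
     = (\<integral>\<^sup>+x. ennreal (exp ((cmod (complex_of_real (sqrt (nsq n v)) * x))\<^sup>2 / 8)) \<partial>scg)"
    by (rule nn_integral_lin) measurable
  also have "\<dots> \<le> (\<integral>\<^sup>+x. ennreal (exp ((cmod x)\<^sup>2 / 2)) \<partial>scg)"
  proof (intro nn_integral_mono ennreal_leI)
    fix x
    have "nsq n v * (cmod x)\<^sup>2 \<le> 4 * (cmod x)\<^sup>2" using assms by (intro mult_right_mono) auto
    then show "exp ((cmod (complex_of_real (sqrt (nsq n v)) * x))\<^sup>2 / 8) \<le> exp ((cmod x)\<^sup>2 / 2)"
      by (simp add: norm_mult power_mult_distrib)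
  qed
  also have "\<dots> = ennreal 2" by (simp add: scg_exp_half)
  finally show ?thesis .
qed

text \<open>Passing between a vector and a nearby net point must keep the leading coefficient as
  close to 1 as desired; the price is the large factor at the squared difference.\<close>

lemma young_sq:
  fixes x y :: real assumes "\<tau> > 0"
  shows "x\<^sup>2 \<le> (1 + \<tau>) * y\<^sup>2 + (1 + 1 / \<tau>) * (x - y)\<^sup>2"
proof -
  have "0 \<le> (\<tau> * y - (x - y))\<^sup>2 / \<tau>" using assms by simp
  also have "\<dots> = \<tau> * y\<^sup>2 - 2 * y * (x - y) + (x - y)\<^sup>2 / \<tau>"
    using assms by (simp add: power2_eq_square field_simps)
  finally have "0 \<le> \<tau> * y\<^sup>2 - 2 * y * (x - y) + (x - y)\<^sup>2 / \<tau>" .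
  moreover have "x\<^sup>2 = y\<^sup>2 + 2 * y * (x - y) + (x - y)\<^sup>2" by (simp add: power2_eq_square algebra_simps)
  ultimately show ?thesis by (simp add: distrib_right)
qed

lemma young_cmod:
  assumes "\<tau> > 0"
  shows "(cmod x)\<^sup>2 \<le> (1 + \<tau>) * (cmod y)\<^sup>2 + (1 + 1 / \<tau>) * (cmod (x - y))\<^sup>2"
proof -
  have "(cmod x - cmod y)\<^sup>2 \<le> (cmod (x - y))\<^sup>2"
    using norm_triangle_ineq3[of x y] by (metis abs_le_square_iff abs_norm_cancel)
  then have "(1 + 1 / \<tau>) * (cmod x - cmod y)\<^sup>2 \<le> (1 + 1 / \<tau>) * (cmod (x - y))\<^sup>2"
    using assms by (intro mult_left_mono) auto
  then show ?thesis using young_sq[OF assms, of "cmod x" "cmod y"] by linarith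
qed

lemma young_nsq:
  assumes "\<tau> > 0"
  shows "nsq n x \<le> (1 + \<tau>) * nsq n y + (1 + 1 / \<tau>) * nsq n (\<lambda>j. x j - y j)"
  unfolding nsq_def sum_distrib_left sum.distrib[symmetric] by (intro sum_mono young_cmod assms)

lemma nsq_zeroD: "nsq n v = 0 \<Longrightarrow> j < n \<Longrightarrow> v j = 0"
  by (simp add: nsq_def sum_nonneg_eq_0_iff)

lemma nsq_normalize:
  assumes "nsq n v > 0"
  shows "nsq n (\<lambda>j. complex_of_real (1 / sqrt (nsq n v)) * v j) = 1"
  unfolding nsq_scale using assms by (simp add: norm_divide power_divide)

definition qform :: "nat \<Rightarrow> nat \<Rightarrow> (nat \<times> nat \<Rightarrow> complex) \<Rightarrow> (nat \<Rightarrow> complex) \<Rightarrow> real" where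
  "qform n m w v = (\<Sum>i<m. (cmod (lin n (mrow w i) v))\<^sup>2)"

lemma qform_scale: "qform n m w (\<lambda>j. s * v j) = (cmod s)\<^sup>2 * qform n m w v"
  by (simp add: qform_def lin_scale norm_mult power_mult_distrib sum_distrib_left)

lemma qform_nonneg[simp]: "qform n m w v \<ge> 0" by (simp add: qform_def sum_nonneg)

lemma lin_zero: "nsq n v = 0 \<Longrightarrow> lin n a v = 0"
  by (auto simp: lin_def nsq_def sum_nonneg_eq_0_iff)

lemma qform_normalize:
  assumes "nsq n v > 0"
  shows "qform n m w v = nsq n v * qform n m w (\<lambda>j. complex_of_real (1 / sqrt (nsq n v)) * v j)"
  unfolding qform_scale using assms by (simp add: norm_divide power_divide)

lemma qform_young:
  assumes "\<tau> > 0"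
  shows "qform n m w x \<le> (1 + \<tau>) * qform n m w y + (1 + 1 / \<tau>) * qform n m w (\<lambda>j. x j - y j)"
  unfolding qform_def sum_distrib_left sum.distrib[symmetric] lin_diff by (intro sum_mono young_cmod assms)

lemma qform_bounded: "\<exists>K. \<forall>v. nsq n v \<le> 1 \<longrightarrow> qform n m w v \<le> K"
proof (intro exI allI impI)
  fix v assume v: "nsq n v \<le> 1"
  have 1: "cmod (v j) \<le> 1" if "j < n" for j
  proof -
    have "(cmod (v j))\<^sup>2 \<le> nsq n v" unfolding nsq_def using that by (intro member_le_sum) auto
    then show ?thesis using v by (metis abs_norm_cancel abs_square_le_1 order_trans)
  qed
  have "cmod (lin n (mrow w i) v) \<le> (\<Sum>j<n. cmod (mrow w i j))" for i
    unfolding lin_def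
  proof (rule order_trans[OF norm_sum sum_mono])
    fix j assume "j \<in> {..<n}"
    then show "cmod (mrow w i j * v j) \<le> cmod (mrow w i j)"
      using 1[of j] by (simp add: norm_mult mult_left_le)
  qed
  then show "qform n m w v \<le> (\<Sum>i<m. (\<Sum>j<n. cmod (mrow w i j))\<^sup>2)"
    unfolding qform_def by (intro sum_mono power_mono) auto
qed

section \<open>Extreme singular values of the measurement matrix\<close>

lemma lin_if[simp]: "lin n (\<lambda>j. if j < n then a j else b j) v = lin n a v"
  by (simp add: lin_def)

lemma exp_moment_row_lin: "nsq n v \<le> 4 \<Longrightarrow> exp_moment_row n (1/8) 2 (\<lambda>a. (cmod (lin n a v))\<^sup>2)"
  using lin_exp_moment[of n v] by (simp add: exp_moment_row_def)

text \<open>A crude constant suffices, so a net of mesh 1/2 will do. If S is the supremum over the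
  unit ball, a net point contributes at most 5 m and the difference at most S / 4; Young with \<tau>
  = 1 doubles both, so S is at most 10 m + S / 2.\<close>

lemma whp_operator_norm: "whp (\<lambda>n m u w. \<forall>v. qform n m w v \<le> 20 * real m * nsq n v)"
proof -
  obtain c where c: "c > 0" and b: "\<And>n m Y \<mu>. exp_moment_row n (1/8) 2 Y \<Longrightarrow> \<mu> \<ge> 0 \<Longrightarrow>
    (\<integral>\<^sup>+a. ennreal (Y a) \<partial>gauss_row n) \<le> ennreal \<mu> \<Longrightarrow>
    emeasure (gaussian_entries m n) {w \<in> space (gaussian_entries m n). real m * (\<mu> + 1) \<le> (\<Sum>i<m. Y (mrow w i))}
      \<le> ennreal (exp (- c * real m))"
    using bernstein_upper[of "1/8" 2 1] by auto
  define Bad where "Bad n m u v = {w \<in> space (gaussian_entries m n). real m * (nsq n v + 1) \<le> (\<Sum>i<m. (cmod (lin n (mrow w i) v))\<^sup>2)}"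
    for n m and u v :: "nat \<Rightarrow> complex"
  have "whp (\<lambda>n m u w. w \<in> space (gaussian_entries m n) \<and>
     (\<forall>v. nsq n v \<le> 1 \<longrightarrow> (\<exists>v'. nsq n v' \<le> 4 \<and> nsq n (\<lambda>j. v j - v' j) \<le> (1 / real 2)\<^sup>2 \<and> w \<notin> Bad n m u v')))"
  proof (rule whp_net[OF c], simp, rule conjI)
    fix n m :: nat and u v :: "nat \<Rightarrow> complex" assume v: "nsq n v \<le> 4"
    show "Bad n m u v \<in> sets (gaussian_entries m n)" unfolding Bad_def
      by measurable
    show "emeasure (gaussian_entries m n) (Bad n m u v) \<le> ennreal (exp (- c * real m))"
      unfolding Bad_def by (rule b) (use exp_moment_row_lin[OF v] in \<open>auto simp: lin_second_moment\<close>)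
  qed
  then show ?thesis
  proof (rule whp_mono)
    fix n m :: nat and u w
    assume "n > 0" "m > 0" and asm: "w \<in> space (gaussian_entries m n) \<and>
     (\<forall>v. nsq n v \<le> 1 \<longrightarrow> (\<exists>v'. nsq n v' \<le> 4 \<and> nsq n (\<lambda>j. v j - v' j) \<le> (1 / real 2)\<^sup>2 \<and> w \<notin> Bad n m u v'))"
    \<comment> \<open>Finiteness of the supremum, without any control of its size, permits absorbing
      S / 2 into the left side.\<close>
    obtain K where K: "\<And>v. nsq n v \<le> 1 \<Longrightarrow> qform n m w v \<le> K" using qform_bounded[of n m w] by auto
    define S where "S = Sup (qform n m w ` {v. nsq n v \<le> 1})"
    have bdd: "bdd_above (qform n m w ` {v. nsq n v \<le> 1})" using K by (intro bdd_aboveI[of _ K]) auto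
    have S: "qform n m w v \<le> S" if "nsq n v \<le> 1" for v
      unfolding S_def by (rule cSup_upper) (use bdd that in auto)
    have ne: "qform n m w ` {v. nsq n v \<le> 1} \<noteq> {}"
      by (auto intro!: exI[of _ "\<lambda>_. 0"] simp: nsq_def)
    have "S \<le> 10 * real m + S / 2"
    proof (subst S_def, rule cSup_least[OF ne])
      fix x assume "x \<in> qform n m w ` {v. nsq n v \<le> 1}"
      then obtain v where v: "nsq n v \<le> 1" "x = qform n m w v" by auto
      obtain v' where v': "nsq n v' \<le> 4" "nsq n (\<lambda>j. v j - v' j) \<le> (1 / real 2)\<^sup>2" "w \<notin> Bad n m u v'"
        using asm v(1) by blast
      have "qform n m w v' \<le> real m * (nsq n v' + 1)"
        using asm v'(3) by (auto simp: Bad_def qform_def)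
      also have "\<dots> \<le> real m * 5" using v'(1) by (intro mult_left_mono) auto
      finally have 1: "qform n m w v' \<le> 5 * real m" by simp
      \<comment> \<open>Twice the difference lies in the unit ball, so homogeneity gives S /
        4.\<close>
      have "nsq n (\<lambda>j. 2 * (v j - v' j)) \<le> 1" unfolding nsq_scale using v'(2) by (simp add: power2_eq_square)
      then have "qform n m w (\<lambda>j. 2 * (v j - v' j)) \<le> S" by (rule S)
      then have 2: "4 * qform n m w (\<lambda>j. v j - v' j) \<le> S" unfolding qform_scale by (simp add: power2_eq_square)
      show "x \<le> 10 * real m + S / 2"
        using qform_young[of 1 n m w v v'] 1 2 unfolding v(2) by simp
    qed
    then have S20: "S \<le> 20 * real m" by simp
    show "\<forall>v. qform n m w v \<le> 20 * real m * nsq n v"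
    proof
      fix v
      show "qform n m w v \<le> 20 * real m * nsq n v"
      proof (cases "nsq n v = 0")
        case True then show ?thesis by (simp add: qform_def lin_zero)
      next
        case False
        then have p: "nsq n v > 0" using nsq_nonneg[of n v] by linarith
        have "qform n m w v \<le> nsq n v * S"
          unfolding qform_normalize[OF p] using p nsq_normalize[OF p] by (intro mult_left_mono S) auto
        also have "\<dots> \<le> nsq n v * (20 * real m)" using S20 by (intro mult_left_mono) auto
        finally show ?thesis by (simp add: mult_ac)
      qed
    qed
  qed
qed


lemma le_of_forall_unit:
  fixes Q :: "(nat \<Rightarrow> complex) \<Rightarrow> real"
  assumes unit: "\<And>v. P v \<Longrightarrow> nsq n v = 1 \<Longrightarrow> Q v \<le> K"
    and hom: "\<And>s v. Q (\<lambda>j. complex_of_real s * v j) = s\<^sup>2 * Q v" "\<And>s v. P v \<Longrightarrow> P (\<lambda>j. complex_of_real s * v j)"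
    and zero: "\<And>v. nsq n v = 0 \<Longrightarrow> Q v = 0"
    and v: "P v"
  shows "Q v \<le> K * nsq n v"
proof (cases "nsq n v = 0")
  case True then show ?thesis using zero by simp
next
  case False
  then have p: "nsq n v > 0" using nsq_nonneg[of n v] by linarith
  have "Q (\<lambda>j. complex_of_real (1 / sqrt (nsq n v)) * v j) \<le> K"
    by (intro unit hom v nsq_normalize p)
  then have "Q v / nsq n v \<le> K" unfolding hom(1) using p by (simp add: power_divide)
  then show ?thesis using p by (simp add: field_simps)
qed

text \<open>The bound at a net point passes to \<open>v\<close> once the quadratic form of the
  difference is under control, which is the task of the operator norm bound. Young with \<tau> =
  1/1000 multiplies that form by 1001; mesh 1/100000 makes the loss about 2e-6 m.\<close>

lemma whp_lower_singular_value: "whp (\<lambda>n m u w. \<forall>v. (99/100) * real m * nsq n v \<le> qform n m w v)"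
proof -
  obtain c where c: "c > 0" and b: "\<And>n m Y \<mu>. exp_moment_row n (1/8) 2 Y \<Longrightarrow> \<mu> \<ge> 0 \<Longrightarrow>
    ennreal \<mu> \<le> (\<integral>\<^sup>+a. ennreal (Y a) \<partial>gauss_row n) \<Longrightarrow>
    emeasure (gaussian_entries m n) {w \<in> space (gaussian_entries m n). (\<Sum>i<m. Y (mrow w i)) \<le> real m * (\<mu> - 1/1000)}
      \<le> ennreal (exp (- c * real m))"
    using bernstein_lower[of "1/8" 2 "1/1000"] by auto
  define Bad where "Bad n m u v = {w \<in> space (gaussian_entries m n). (\<Sum>i<m. (cmod (lin n (mrow w i) v))\<^sup>2) \<le> real m * (nsq n v - 1/1000)}"
    for n m and u v :: "nat \<Rightarrow> complex"
  have "whp (\<lambda>n m u w. w \<in> space (gaussian_entries m n) \<and>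
     (\<forall>v. nsq n v \<le> 1 \<longrightarrow> (\<exists>v'. nsq n v' \<le> 4 \<and> nsq n (\<lambda>j. v j - v' j) \<le> (1 / real 100000)\<^sup>2 \<and> w \<notin> Bad n m u v')))"
  proof (rule whp_net[OF c], simp, rule conjI)
    fix n m :: nat and u v :: "nat \<Rightarrow> complex" assume v: "nsq n v \<le> 4"
    show "Bad n m u v \<in> sets (gaussian_entries m n)" unfolding Bad_def
      by measurable
    show "emeasure (gaussian_entries m n) (Bad n m u v) \<le> ennreal (exp (- c * real m))"
      unfolding Bad_def by (rule b) (use exp_moment_row_lin[OF v] in \<open>auto simp: lin_second_moment\<close>)
  qed
  from whp_conj[OF this whp_operator_norm] show ?thesis
  proof (rule whp_mono, elim conjE, intro allI)
    fix n m :: nat and u w v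
    assume w: "w \<in> space (gaussian_entries m n)" and
     net: "\<forall>v. nsq n v \<le> 1 \<longrightarrow> (\<exists>v'. nsq n v' \<le> 4 \<and> nsq n (\<lambda>j. v j - v' j) \<le> (1 / real 100000)\<^sup>2 \<and> w \<notin> Bad n m u v')"
     and op: "\<forall>v. qform n m w v \<le> 20 * real m * nsq n v"
    \<comment> \<open>The sign turns the lower bound into the homogeneous upper bound that
      \<open>le_of_forall_unit\<close> extends from unit vectors.\<close>
    have "- qform n m w v \<le> - ((99/100) * real m) * nsq n v"
    proof (rule le_of_forall_unit[where P="\<lambda>_. True"])
      fix v assume v: "nsq n v = 1"
      obtain v' where v': "nsq n v' \<le> 4" "nsq n (\<lambda>j. v j - v' j) \<le> (1 / real 100000)\<^sup>2" "w \<notin> Bad n m u v'"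
        using net[rule_format, of v] v by auto
      have 1: "real m * (nsq n v' - 1/1000) \<le> qform n m w v'"
        using w v'(3) by (auto simp: Bad_def qform_def)
      have e: "nsq n (\<lambda>j. v' j - v j) = nsq n (\<lambda>j. v j - v' j)" by (simp add: nsq_def norm_minus_commute)
      have "qform n m w (\<lambda>j. v' j - v j) \<le> 20 * real m * nsq n (\<lambda>j. v' j - v j)" using op by blast
      also have "\<dots> \<le> 20 * real m * (1 / real 100000)\<^sup>2" unfolding e using v'(2) by (intro mult_left_mono) auto
      finally have 2: "qform n m w (\<lambda>j. v' j - v j) \<le> 20 * real m * (1 / 10000000000)" by (simp add: power2_eq_square)
      have 3: "qform n m w v' \<le> (1 + 1/1000) * qform n m w v + 1001 * qform n m w (\<lambda>j. v' j - v j)"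
        using qform_young[of "1/1000" n m w v' v] by simp
      have "1 \<le> (1 + 1/1000) * nsq n v' + 1001 * (1 / 10000000000)"
        using young_nsq[of "1/1000" n v v'] v v'(2) by (simp add: power2_eq_square)
      then have "997/1000 \<le> nsq n v' - 1/1000" by simp
      then have "real m * (997/1000) \<le> real m * (nsq n v' - 1/1000)" by (intro mult_left_mono) auto
      then show "- qform n m w v \<le> - ((99/100) * real m)" using 1 2 3 by simp
    qed (auto simp: qform_scale qform_def lin_zero)
    then show "(99/100) * real m * nsq n v \<le> qform n m w v" by simp
  qed
qed

section \<open>Uniform upper bounds for Lipschitz statistics of the rows\<close>

lemma ennreal_lincomb:
  "0 \<le> a \<Longrightarrow> 0 \<le> x \<Longrightarrow> 0 \<le> b \<Longrightarrow> 0 \<le> y \<Longrightarrow>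
    ennreal (a * x + b * y) = ennreal a * ennreal x + ennreal b * ennreal y"
  by (simp add: ennreal_mult)

lemma nn_integral_finite_real:
  assumes "(\<integral>\<^sup>+a. ennreal (Y a) \<partial>M) \<le> ennreal K"
  shows "(\<integral>\<^sup>+a. ennreal (Y a) \<partial>M) = ennreal (enn2real (\<integral>\<^sup>+a. ennreal (Y a) \<partial>M))"
  using assms by (metis ennreal_enn2real ennreal_less_top le_less_trans)

text \<open>The Lipschitz condition concerns the second argument alone, so phases and indicators of
  \<open>lin n a u\<close> are admissible. The mean bound \<open>\<mu>\<close> is quantified inside
  the event: a single event serves all vectors, each with its own mean. The net transfer uses
  Young's inequality twice, for the empirical sum and for the mean.\<close>

lemma whp_uniform_upper:
  fixes f :: "complex \<Rightarrow> complex \<Rightarrow> real"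
  assumes f[measurable]: "(\<lambda>(c, d). f c d) \<in> borel_measurable (borel \<Otimes>\<^sub>M borel)"
    and f0: "\<And>c. f c 0 = 0" and lip: "\<And>c d d'. \<bar>f c d - f c d'\<bar> \<le> L * cmod (d - d')" and L: "L > 0" and \<eta>: "\<eta> > 0"
  shows "whp (\<lambda>n m u w. \<forall>v \<mu>. nsq n v \<le> 1 \<longrightarrow> \<mu> \<ge> 0 \<longrightarrow>
     (\<integral>\<^sup>+a. ennreal ((f (lin n a u) (lin n a v))\<^sup>2) \<partial>gauss_row n) \<le> ennreal \<mu> \<longrightarrow>
     (\<Sum>i<m. (f (lin n (mrow w i) u) (lin n (mrow w i) v))\<^sup>2) \<le> real m * (\<mu> + \<eta>))"
proof -
  \<comment> \<open>The error \<open>\<eta>\<close> is split into thirds: the relative loss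
    \<open>\<tau>\<close> of Young's inequality, bounded by 3 \<tau> L^2; the doubled Bernstein
    deviation \<open>\<eta>1\<close>; and the distance to the net.\<close>
  define \<tau> where "\<tau> = min 1 (\<eta> / (9 * L\<^sup>2))"
  have \<tau>: "\<tau> > 0" "\<tau> \<le> 1" "9 * L\<^sup>2 * \<tau> \<le> \<eta>"
    using L \<eta> by (auto simp: \<tau>_def min_def field_simps)
  define \<eta>1 where "\<eta>1 = \<eta> / 6"
  have \<eta>1: "\<eta>1 > 0" using \<eta> by (simp add: \<eta>1_def)
  \<comment> \<open>The net error occurs at most 22 times: 20 through the operator norm and 1 +
    \<tau>, at most 2, through the mean at the net point.\<close>
  obtain N :: nat where N: "N > 0" "(1 + 1 / \<tau>) * L\<^sup>2 * 22 * (1 / real N)\<^sup>2 \<le> \<eta> / 3"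
  proof -
    let ?A = "(1 + 1 / \<tau>) * L\<^sup>2 * 22 * 3 / \<eta>"
    obtain N0 :: nat where N0: "?A < real N0" using reals_Archimedean2 by blast
    have A: "?A \<ge> 0" using \<tau> \<eta> by simp
    define N where "N = max 1 N0"
    have N: "N > 0" "?A \<le> real N" using N0 by (auto simp: N_def)
    have "real N * 1 \<le> real N * real N" using N(1) by (intro mult_left_mono) auto
    then have "?A \<le> (real N)\<^sup>2" using N(2) by (simp add: power2_eq_square)
    then have "(1 + 1 / \<tau>) * L\<^sup>2 * 22 * (1 / real N)\<^sup>2 \<le> \<eta> / 3"
      using N(1) \<eta> by (simp add: power_divide field_simps)
    with N(1) show thesis by (rule that)
  qed
  have fle: "(f c d - f c d')\<^sup>2 \<le> L\<^sup>2 * (cmod (d - d'))\<^sup>2" for c d d'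
  proof -
    have "\<bar>f c d - f c d'\<bar>\<^sup>2 \<le> (L * cmod (d - d'))\<^sup>2" by (rule power_mono[OF lip]) simp
    then show ?thesis by (simp add: power_mult_distrib)
  qed
  have fle0: "(f c d)\<^sup>2 \<le> L\<^sup>2 * (cmod d)\<^sup>2" for c d using fle[of c d 0] by (simp add: f0)
  have fm[measurable]: "(\<lambda>a. f (lin n a u) (lin n a v)) \<in> borel_measurable (gauss_row n)" for n u v
    using measurable_compose[OF measurable_Pair[OF lin_measurable lin_measurable] f] by simp
  have fyoung: "(f c d)\<^sup>2 \<le> (1 + \<tau>) * (f c d')\<^sup>2 + (1 + 1 / \<tau>) * L\<^sup>2 * (cmod (d - d'))\<^sup>2" for c d d'
  proof -
    have "(1 + 1 / \<tau>) * (f c d - f c d')\<^sup>2 \<le> (1 + 1 / \<tau>) * (L\<^sup>2 * (cmod (d - d'))\<^sup>2)"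
      using \<tau> by (intro mult_left_mono fle) auto
    then show ?thesis using young_sq[OF \<tau>(1), of "f c d" "f c d'"] by (simp add: mult.assoc)
  qed
  let ?J = "\<lambda>n u v. \<integral>\<^sup>+a. ennreal ((f (lin n a u) (lin n a v))\<^sup>2) \<partial>gauss_row n"
  have JL: "?J n u v \<le> ennreal (L\<^sup>2 * nsq n v)" for n u v
  proof -
    have "?J n u v \<le> (\<integral>\<^sup>+a. ennreal (L\<^sup>2) * ennreal ((cmod (lin n a v))\<^sup>2) \<partial>gauss_row n)"
      using fle0 by (intro nn_integral_mono) (auto simp: ennreal_mult[symmetric] intro!: ennreal_leI)
    also have "\<dots> = ennreal (L\<^sup>2 * nsq n v)"
      by (simp add: nn_integral_cmult lin_second_moment ennreal_mult)
    finally show ?thesis .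
  qed
  \<comment> \<open>The squared statistic is at most L^2 times the squared modulus, so this exponent
    reduces to 1/8 in \<open>lin_exp_moment\<close>.\<close>
  define s0 where "s0 = 1 / (8 * L\<^sup>2)"
  have s0: "s0 > 0" using L by (simp add: s0_def)
  obtain c where c: "c > 0" and b: "\<And>n m Y \<mu>. exp_moment_row n s0 2 Y \<Longrightarrow> \<mu> \<ge> 0 \<Longrightarrow>
    (\<integral>\<^sup>+a. ennreal (Y a) \<partial>gauss_row n) \<le> ennreal \<mu> \<Longrightarrow>
    emeasure (gaussian_entries m n) {w \<in> space (gaussian_entries m n). real m * (\<mu> + \<eta>1) \<le> (\<Sum>i<m. Y (mrow w i))}
      \<le> ennreal (exp (- c * real m))"
    using bernstein_upper[OF s0 _ \<eta>1, of 2] by auto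
  define Bad where "Bad n m u v = {w \<in> space (gaussian_entries m n).
      real m * (enn2real (?J n u v) + \<eta>1) \<le> (\<Sum>i<m. (f (lin n (mrow w i) u) (lin n (mrow w i) v))\<^sup>2)}"
    for n m and u v :: "nat \<Rightarrow> complex"
  have "whp (\<lambda>n m u w. w \<in> space (gaussian_entries m n) \<and>
     (\<forall>v. nsq n v \<le> 1 \<longrightarrow> (\<exists>v'. nsq n v' \<le> 4 \<and> nsq n (\<lambda>j. v j - v' j) \<le> (1 / real N)\<^sup>2 \<and> w \<notin> Bad n m u v')))"
  proof (rule whp_net[OF c N(1)], rule conjI)
    fix n m :: nat and u v :: "nat \<Rightarrow> complex" assume v: "nsq n v \<le> 4"
    have [measurable]: "(\<lambda>w. \<Sum>i<m. (f (lin n (mrow w i) u) (lin n (mrow w i) v))\<^sup>2) \<in> borel_measurable (gaussian_entries m n)"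
      by (rule row_sum_measurable[where Y="\<lambda>a. (f (lin n a u) (lin n a v))\<^sup>2"]) auto
    show "Bad n m u v \<in> sets (gaussian_entries m n)" unfolding Bad_def
      by measurable
    show "emeasure (gaussian_entries m n) (Bad n m u v) \<le> ennreal (exp (- c * real m))"
      unfolding Bad_def
    proof (rule b)
      have "(\<integral>\<^sup>+a. ennreal (exp (s0 * (f (lin n a u) (lin n a v))\<^sup>2)) \<partial>gauss_row n)
        \<le> (\<integral>\<^sup>+a. ennreal (exp ((cmod (lin n a v))\<^sup>2 / 8)) \<partial>gauss_row n)"
      proof (intro nn_integral_mono ennreal_leI)
        fix a
        have "s0 * (f (lin n a u) (lin n a v))\<^sup>2 \<le> s0 * (L\<^sup>2 * (cmod (lin n a v))\<^sup>2)"
          using s0 by (intro mult_left_mono fle0) auto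
        also have "\<dots> = (cmod (lin n a v))\<^sup>2 / 8" using L by (simp add: s0_def)
        finally show "exp (s0 * (f (lin n a u) (lin n a v))\<^sup>2) \<le> exp ((cmod (lin n a v))\<^sup>2 / 8)" by simp
      qed
      also have "\<dots> \<le> ennreal 2" by (rule lin_exp_moment[OF v])
      finally show "exp_moment_row n s0 2 (\<lambda>a. (f (lin n a u) (lin n a v))\<^sup>2)" by (simp add: exp_moment_row_def)
      show "?J n u v \<le> ennreal (enn2real (?J n u v))"
        using nn_integral_finite_real[OF JL] by simp
    qed auto
  qed
  from whp_conj[OF this whp_operator_norm] show ?thesis
  proof (rule whp_mono, elim conjE, intro allI impI)
    fix n m :: nat and u w v and \<mu> :: real
    assume w: "w \<in> space (gaussian_entries m n)" and
     net: "\<forall>v. nsq n v \<le> 1 \<longrightarrow> (\<exists>v'. nsq n v' \<le> 4 \<and> nsq n (\<lambda>j. v j - v' j) \<le> (1 / real N)\<^sup>2 \<and> w \<notin> Bad n m u v')"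
     and op: "\<forall>v. qform n m w v \<le> 20 * real m * nsq n v"
     and v: "nsq n v \<le> 1" and \<mu>0: "\<mu> \<ge> 0" and \<mu>: "?J n u v \<le> ennreal \<mu>"
    obtain v' where v': "nsq n v' \<le> 4" "nsq n (\<lambda>j. v j - v' j) \<le> (1 / real N)\<^sup>2" "w \<notin> Bad n m u v'"
      using net v by blast
    define \<epsilon> where "\<epsilon> = (1 / real N)\<^sup>2"
    define K where "K = (1 + 1 / \<tau>) * L\<^sup>2"
    have K0: "K \<ge> 0" using \<tau> by (simp add: K_def)
    have e: "nsq n (\<lambda>j. v' j - v j) = nsq n (\<lambda>j. v j - v' j)" by (simp add: nsq_def norm_minus_commute)
    \<comment> \<open>The given \<open>\<mu>\<close> may be arbitrarily large and then \<tau> \<mu>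
      would not be small; the true mean never exceeds L^2, so \<open>\<mu>\<close> can be capped
      there.\<close>
    define \<mu>' where "\<mu>' = min \<mu> (L\<^sup>2)"
    have \<mu>': "?J n u v \<le> ennreal \<mu>'" "0 \<le> \<mu>'" "\<mu>' \<le> \<mu>" "\<mu>' \<le> L\<^sup>2"
    proof -
      have "?J n u v \<le> ennreal (L\<^sup>2 * nsq n v)" by (rule JL)
      also have "\<dots> \<le> ennreal (L\<^sup>2)" using v by (intro ennreal_leI) (simp add: mult_left_le)
      finally show "?J n u v \<le> ennreal \<mu>'" using \<mu> by (simp add: \<mu>'_def min_def)
    qed (use \<mu>0 in \<open>auto simp: \<mu>'_def\<close>)
    \<comment> \<open>Bernstein at the net point refers to the mean at \<open>v'\<close>, which is
      compared with the mean at \<open>v\<close>.\<close>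
    have "?J n u v' \<le> (\<integral>\<^sup>+a. ennreal (1 + \<tau>) * ennreal ((f (lin n a u) (lin n a v))\<^sup>2)
        + ennreal K * ennreal ((cmod (lin n a (\<lambda>j. v' j - v j)))\<^sup>2) \<partial>gauss_row n)"
    proof (rule nn_integral_mono)
      fix a
      have "ennreal ((f (lin n a u) (lin n a v'))\<^sup>2) \<le> ennreal ((1 + \<tau>) * (f (lin n a u) (lin n a v))\<^sup>2
         + K * (cmod (lin n a (\<lambda>j. v' j - v j)))\<^sup>2)"
        unfolding K_def lin_diff by (intro ennreal_leI fyoung)
      also have "\<dots> = ennreal (1 + \<tau>) * ennreal ((f (lin n a u) (lin n a v))\<^sup>2)
        + ennreal K * ennreal ((cmod (lin n a (\<lambda>j. v' j - v j)))\<^sup>2)"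
        using K0 \<tau> by (intro ennreal_lincomb) auto
      finally show "ennreal ((f (lin n a u) (lin n a v'))\<^sup>2) \<le> ennreal (1 + \<tau>) * ennreal ((f (lin n a u) (lin n a v))\<^sup>2)
        + ennreal K * ennreal ((cmod (lin n a (\<lambda>j. v' j - v j)))\<^sup>2)" .
    qed
    also have "\<dots> = ennreal (1 + \<tau>) * ?J n u v + ennreal K * ennreal (nsq n (\<lambda>j. v' j - v j))"
      by (simp add: nn_integral_add nn_integral_cmult lin_second_moment)
    also have "\<dots> \<le> ennreal (1 + \<tau>) * ennreal \<mu>' + ennreal K * ennreal \<epsilon>"
      using v'(2) unfolding e \<epsilon>_def by (intro add_mono mult_left_mono \<mu>' ennreal_leI) auto
    also have "\<dots> = ennreal ((1 + \<tau>) * \<mu>' + K * \<epsilon>)"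
      using K0 \<tau> \<mu>' by (intro ennreal_lincomb[symmetric]) (auto simp: \<epsilon>_def)
    finally have J': "enn2real (?J n u v') \<le> (1 + \<tau>) * \<mu>' + K * \<epsilon>"
      using K0 \<tau> \<mu>' by (intro enn2real_leI) (auto simp: \<epsilon>_def)
    have 1: "(\<Sum>i<m. (f (lin n (mrow w i) u) (lin n (mrow w i) v'))\<^sup>2) \<le> real m * (enn2real (?J n u v') + \<eta>1)"
      using w v'(3) by (auto simp: Bad_def)
    have "(\<Sum>i<m. (f (lin n (mrow w i) u) (lin n (mrow w i) v))\<^sup>2)
      \<le> (\<Sum>i<m. (1 + \<tau>) * (f (lin n (mrow w i) u) (lin n (mrow w i) v'))\<^sup>2 + K * (cmod (lin n (mrow w i) (\<lambda>j. v j - v' j)))\<^sup>2)"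
      unfolding K_def lin_diff by (intro sum_mono fyoung)
    also have "\<dots> = (1 + \<tau>) * (\<Sum>i<m. (f (lin n (mrow w i) u) (lin n (mrow w i) v'))\<^sup>2) + K * qform n m w (\<lambda>j. v j - v' j)"
      unfolding sum.distrib sum_distrib_left qform_def ..
    also have "\<dots> \<le> (1 + \<tau>) * (real m * (((1 + \<tau>) * \<mu>' + K * \<epsilon>) + \<eta>1)) + K * (20 * real m * \<epsilon>)"
    proof (intro add_mono mult_left_mono)
      have "real m * (enn2real (?J n u v') + \<eta>1) \<le> real m * (((1 + \<tau>) * \<mu>' + K * \<epsilon>) + \<eta>1)"
        using J' by (intro mult_left_mono) auto
      with 1 show "(\<Sum>i<m. (f (lin n (mrow w i) u) (lin n (mrow w i) v'))\<^sup>2) \<le> real m * (((1 + \<tau>) * \<mu>' + K * \<epsilon>) + \<eta>1)" by linarith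
      have "qform n m w (\<lambda>j. v j - v' j) \<le> 20 * real m * nsq n (\<lambda>j. v j - v' j)" using op by blast
      also have "\<dots> \<le> 20 * real m * \<epsilon>" unfolding \<epsilon>_def using v'(2) by (intro mult_left_mono) auto
      finally show "qform n m w (\<lambda>j. v j - v' j) \<le> 20 * real m * \<epsilon>" .
    qed (use \<tau> K0 in auto)
    also have "\<dots> = real m * (\<mu>' + (2 * \<tau> + \<tau> * \<tau>) * \<mu>' + (1 + \<tau>) * \<eta>1 + (21 + \<tau>) * (K * \<epsilon>))"
      by (simp add: algebra_simps)
    also have "\<dots> \<le> real m * (\<mu> + \<eta>)"
    proof (intro mult_left_mono)
      have "\<tau> * \<tau> \<le> \<tau> * 1" using \<tau> by (intro mult_left_mono) auto
      then have "(2 * \<tau> + \<tau> * \<tau>) * \<mu>' \<le> (3 * \<tau>) * L\<^sup>2" using \<mu>' \<tau> by (intro mult_mono) auto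
      moreover have "(3 * \<tau>) * L\<^sup>2 \<le> \<eta> / 3" using \<tau>(3) by (simp add: mult_ac)
      ultimately have a: "(2 * \<tau> + \<tau> * \<tau>) * \<mu>' \<le> \<eta> / 3" by linarith
      have "(1 + \<tau>) * \<eta>1 \<le> 2 * \<eta>1" using \<tau> \<eta>1 by (intro mult_right_mono) auto
      then have b: "(1 + \<tau>) * \<eta>1 \<le> \<eta> / 3" by (simp add: \<eta>1_def)
      have "(21 + \<tau>) * (K * \<epsilon>) \<le> 22 * (K * \<epsilon>)" using \<tau> K0 by (intro mult_right_mono) (auto simp: \<epsilon>_def)
      also have "\<dots> \<le> \<eta> / 3" using N(2) by (simp add: K_def \<epsilon>_def mult_ac)
      finally show "\<mu>' + (2 * \<tau> + \<tau> * \<tau>) * \<mu>' + (1 + \<tau>) * \<eta>1 + (21 + \<tau>) * (K * \<epsilon>) \<le> \<mu> + \<eta>"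
        using a b \<mu>'(3) by linarith
    qed simp
    finally show "(\<Sum>i<m. (f (lin n (mrow w i) u) (lin n (mrow w i) v))\<^sup>2) \<le> real m * (\<mu> + \<eta>)" .
  qed
qed

section \<open>Imaginary parts and small coefficients\<close>

lemma nn_integral_lin_unit:
  assumes u: "nsq n u = 1"
  obtains r where "(cmod (inn n u v))\<^sup>2 + (cmod r)\<^sup>2 = nsq n v"
    "\<And>F. F \<in> borel_measurable (borel \<Otimes>\<^sub>M borel) \<Longrightarrow>
      (\<integral>\<^sup>+a. F (lin n a u, lin n a v) \<partial>gauss_row n)
      = (\<integral>\<^sup>+x. \<integral>\<^sup>+y. (F (x, cnj (inn n u v) * x + r * y) :: ennreal) \<partial>scg \<partial>scg)"
proof -
  obtain q r where q: "complex_of_real (sqrt (nsq n u)) * cnj q = inn n u v" and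
    qr: "(cmod q)\<^sup>2 + (cmod r)\<^sup>2 = nsq n v" and
    F: "\<And>F. F \<in> borel_measurable (borel \<Otimes>\<^sub>M borel) \<Longrightarrow>
      (\<integral>\<^sup>+a. F (lin n a u, lin n a v) \<partial>gauss_row n)
      = (\<integral>\<^sup>+x. \<integral>\<^sup>+y. (F (complex_of_real (sqrt (nsq n u)) * x, q * x + r * y) :: ennreal) \<partial>scg \<partial>scg)"
    using nn_integral_lin_pair[of n u v] by blast
  have q': "q = cnj (inn n u v)" using arg_cong[OF q, of cnj] u by simp
  show thesis
    by (rule that[of r]) (use qr F u q' in simp_all)
qed

lemma nn_integral_lin1:
  assumes "F \<in> borel_measurable borel" "nsq n u = 1"
  shows "(\<integral>\<^sup>+a. F (lin n a u) \<partial>gauss_row n) = (\<integral>\<^sup>+x. F x \<partial>scg)"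
  using nn_integral_lin[OF assms(1), of n u] assms(2) by simp

lemma scg_Im_sq_scaled: "(\<integral>\<^sup>+z. ennreal ((Im (\<omega> * z))\<^sup>2) \<partial>scg) = ennreal ((cmod \<omega>)\<^sup>2 / 2)"
proof (cases "\<omega> = 0")
  case False
  have "(\<integral>\<^sup>+z. ennreal ((Im (\<omega> * z))\<^sup>2) \<partial>scg) = (\<integral>\<^sup>+z. ennreal ((cmod \<omega>)\<^sup>2) * ennreal ((Im (phase \<omega> * z))\<^sup>2) \<partial>scg)"
  proof (rule nn_integral_cong)
    fix z
    have "\<omega> * z = complex_of_real (cmod \<omega>) * (phase \<omega> * z)" by (simp add: norm_times_phase flip: mult.assoc)
    then have "Im (\<omega> * z) = cmod \<omega> * Im (phase \<omega> * z)" by (metis Im_complex_of_real Re_complex_of_real add.right_neutral mult_zero_left times_complex.simps(2))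
    then show "ennreal ((Im (\<omega> * z))\<^sup>2) = ennreal ((cmod \<omega>)\<^sup>2) * ennreal ((Im (phase \<omega> * z))\<^sup>2)"
      by (simp add: power_mult_distrib ennreal_mult)
  qed
  also have "\<dots> = ennreal ((cmod \<omega>)\<^sup>2) * ennreal (1/2)"
    using scg_Im_rotate_sq[of "phase \<omega>"] by (subst nn_integral_cmult) auto
  also have "\<dots> = ennreal ((cmod \<omega>)\<^sup>2 / 2)" using ennreal_mult[of "(cmod \<omega>)\<^sup>2" "1/2"] by simp
  finally show ?thesis .
qed simp

lemma cnj_measurable[measurable]: "cnj \<in> borel_measurable borel"
  by (intro borel_measurable_continuous_onI continuous_intros)

lemma phase_measurable[measurable]: "phase \<in> borel_measurable borel"
  unfolding phase_def by measurable

text \<open>For \<open>v\<close> orthogonal to \<open>u\<close> the two forms are independent, so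
  turning by the phase of \<open>lin n a u\<close> keeps the law of \<open>lin n a v\<close>, and
  the imaginary part carries half of its energy. The remaining 1/100 is the deviation allowed by the
  uniform bound.\<close>

lemma whp_imaginary_part:
  "whp (\<lambda>n m u w. \<forall>v. inn n u v = 0 \<longrightarrow>
     (\<Sum>i<m. (Im (lin n (mrow w i) v * cnj (phase (lin n (mrow w i) u))))\<^sup>2) \<le> (51/100) * real m * nsq n v)"
proof -
  let ?f = "\<lambda>c d. Im (d * cnj (phase c))"
  have "whp (\<lambda>n m u w. \<forall>v \<mu>. nsq n v \<le> 1 \<longrightarrow> \<mu> \<ge> 0 \<longrightarrow>
     (\<integral>\<^sup>+a. ennreal ((?f (lin n a u) (lin n a v))\<^sup>2) \<partial>gauss_row n) \<le> ennreal \<mu> \<longrightarrow>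
     (\<Sum>i<m. (?f (lin n (mrow w i) u) (lin n (mrow w i) v))\<^sup>2) \<le> real m * (\<mu> + 1/100))"
  proof (rule whp_uniform_upper[where L=1])
    fix c d d' :: complex
    have "\<bar>?f c d - ?f c d'\<bar> = \<bar>Im ((d - d') * cnj (phase c))\<bar>" by (simp add: algebra_simps)
    also have "\<dots> \<le> cmod ((d - d') * cnj (phase c))" by (rule abs_Im_le_cmod)
    finally show "\<bar>?f c d - ?f c d'\<bar> \<le> 1 * cmod (d - d')" by (simp add: norm_mult)
    show "(\<lambda>(c, d). ?f c d) \<in> borel_measurable (borel \<Otimes>\<^sub>M borel)" by measurable
  qed auto
  then show ?thesis
  proof (rule whp_mono, intro allI impI)
    fix n m :: nat and u w v
    assume u: "nsq n u = 1" and H: "\<forall>v \<mu>. nsq n v \<le> 1 \<longrightarrow> \<mu> \<ge> 0 \<longrightarrow>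
     (\<integral>\<^sup>+a. ennreal ((?f (lin n a u) (lin n a v))\<^sup>2) \<partial>gauss_row n) \<le> ennreal \<mu> \<longrightarrow>
     (\<Sum>i<m. (?f (lin n (mrow w i) u) (lin n (mrow w i) v))\<^sup>2) \<le> real m * (\<mu> + 1/100)" and uv: "inn n u v = 0"
    have "(\<Sum>i<m. (?f (lin n (mrow w i) u) (lin n (mrow w i) v))\<^sup>2) \<le> ((51/100) * real m) * nsq n v"
    proof (rule le_of_forall_unit[where P="\<lambda>v. inn n u v = 0"])
      fix v assume uv: "inn n u v = 0" and v: "nsq n v = 1"
      obtain r where r: "(cmod (inn n u v))\<^sup>2 + (cmod r)\<^sup>2 = nsq n v" and
        F: "\<And>F. F \<in> borel_measurable (borel \<Otimes>\<^sub>M borel) \<Longrightarrow>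
      (\<integral>\<^sup>+a. F (lin n a u, lin n a v) \<partial>gauss_row n)
      = (\<integral>\<^sup>+x. \<integral>\<^sup>+y. (F (x, cnj (inn n u v) * x + r * y) :: ennreal) \<partial>scg \<partial>scg)"
        by (rule nn_integral_lin_unit[OF u, of v]) (rule that)
      interpret prob_space scg by (rule prob_space_scg)
      have "(\<integral>\<^sup>+a. ennreal ((?f (lin n a u) (lin n a v))\<^sup>2) \<partial>gauss_row n)
         = (\<integral>\<^sup>+x. \<integral>\<^sup>+y. ennreal ((?f x (r * y))\<^sup>2) \<partial>scg \<partial>scg)"
        using F[of "\<lambda>(c, d). ennreal ((?f c d)\<^sup>2)"] uv by simp
      also have "\<dots> = (\<integral>\<^sup>+x. \<integral>\<^sup>+y. ennreal ((Im ((r * cnj (phase x)) * y))\<^sup>2) \<partial>scg \<partial>scg)"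
        by (simp only: mult_ac)
      also have "\<dots> = (\<integral>\<^sup>+x. ennreal (1/2) \<partial>scg)"
        using r uv v by (simp only: scg_Im_sq_scaled norm_mult) simp
      finally have "(\<integral>\<^sup>+a. ennreal ((?f (lin n a u) (lin n a v))\<^sup>2) \<partial>gauss_row n) \<le> ennreal (1/2)"
        by (simp add: emeasure_space_1)
      then have "(\<Sum>i<m. (?f (lin n (mrow w i) u) (lin n (mrow w i) v))\<^sup>2) \<le> real m * (1/2 + 1/100)"
        using H[rule_format, of v "1/2"] v by simp
      then show "(\<Sum>i<m. (?f (lin n (mrow w i) u) (lin n (mrow w i) v))\<^sup>2) \<le> (51/100) * real m" by simp
    next
      fix s v
      have "(?f c (complex_of_real s * d))\<^sup>2 = s\<^sup>2 * (?f c d)\<^sup>2" for c d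
        by (simp add: power2_eq_square algebra_simps)
      then show "(\<Sum>i<m. (?f (lin n (mrow w i) u) (lin n (mrow w i) (\<lambda>j. complex_of_real s * v j)))\<^sup>2)
         = s\<^sup>2 * (\<Sum>i<m. (?f (lin n (mrow w i) u) (lin n (mrow w i) v))\<^sup>2)"
        unfolding lin_scale sum_distrib_left by (intro sum.cong) auto
      show "inn n u (\<lambda>j. complex_of_real s * v j) = 0" if "inn n u v = 0"
      proof -
        have "inn n u (\<lambda>j. complex_of_real s * v j) = complex_of_real s * inn n u v"
          unfolding inn_def sum_distrib_left by (intro sum.cong) (auto simp: mult.left_commute)
        then show ?thesis using that by simp
      qed
    next
      fix v assume "nsq n v = 0"
      then show "(\<Sum>i<m. (?f (lin n (mrow w i) u) (lin n (mrow w i) v))\<^sup>2) = 0" by (simp add: lin_zero)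
    qed (rule uv)
    then show "(\<Sum>i<m. (?f (lin n (mrow w i) u) (lin n (mrow w i) v))\<^sup>2) \<le> (51/100) * real m * nsq n v" .
  qed
qed

text \<open>The shells decrease to a circle or a point or the empty set, a null set in each case;
  continuity from above does the rest. With \<open>r = 0\<close> the shell is a small disc, with
  \<open>r = 9\<close> a neighbourhood of the truncation level.\<close>

lemma scg_shell_small:
  assumes "\<delta> > 0"
  shows "\<exists>h>0. emeasure scg {z. \<bar>(cmod z)\<^sup>2 - r\<bar> \<le> h} \<le> ennreal \<delta>"
proof -
  interpret prob_space scg by (rule prob_space_scg)
  let ?A = "\<lambda>k. {z. \<bar>(cmod z)\<^sup>2 - r\<bar> \<le> 1 / real (Suc k)}"
  have m: "{z. \<bar>(cmod z)\<^sup>2 - r\<bar> \<le> h} \<in> sets scg" for h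
    unfolding sets_std_complex_gaussian by measurable
  have dec: "decseq ?A"
    unfolding decseq_def
  proof (intro allI impI subsetI)
    fix k l z assume "k \<le> (l::nat)" "z \<in> ?A l"
    then have "\<bar>(cmod z)\<^sup>2 - r\<bar> \<le> 1 / real (Suc l)" by simp
    also have "\<dots> \<le> 1 / real (Suc k)" using \<open>k \<le> l\<close> by (intro divide_left_mono) auto
    finally show "z \<in> ?A k" by simp
  qed
  have I: "(\<Inter>k. ?A k) \<subseteq> {z. cmod z = sqrt r}"
  proof
    fix z assume z: "z \<in> (\<Inter>k. ?A k)"
    have "(cmod z)\<^sup>2 - r = 0"
    proof (rule ccontr)
      assume "(cmod z)\<^sup>2 - r \<noteq> 0"
      then obtain k where "inverse (real (Suc k)) < \<bar>(cmod z)\<^sup>2 - r\<bar>"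
        using reals_Archimedean[of "\<bar>(cmod z)\<^sup>2 - r\<bar>"] by auto
      moreover have "\<bar>(cmod z)\<^sup>2 - r\<bar> \<le> 1 / real (Suc k)" using z by auto
      ultimately show False by (simp add: inverse_eq_divide)
    qed
    then have "sqrt r = sqrt ((cmod z)\<^sup>2)" by simp
    then show "z \<in> {z. cmod z = sqrt r}" by simp
  qed
  have "{z. cmod z = sqrt r} \<in> sets scg" unfolding sets_std_complex_gaussian by measurable
  from emeasure_mono[OF I this] have "emeasure scg (\<Inter>k. ?A k) = 0"
    unfolding scg_null_norm by simp
  then have "prob (\<Inter>k. ?A k) = 0" by (simp add: measure_def)
  moreover have "(\<lambda>k. prob (?A k)) \<longlonglongrightarrow> prob (\<Inter>k. ?A k)"
    by (rule finite_Lim_measure_decseq[OF _ dec]) (use m in auto)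
  ultimately have "eventually (\<lambda>k. prob (?A k) < \<delta>) sequentially"
    using assms by (intro order_tendstoD(2)) auto
  then obtain k where "prob (?A k) < \<delta>" by (auto simp: eventually_sequentially)
  then have "emeasure scg (?A k) \<le> ennreal \<delta>" unfolding emeasure_eq_measure by (intro ennreal_leI) simp
  then show ?thesis by (intro exI[of _ "1 / real (Suc k)"]) auto
qed

text \<open>\<open>Q\<close> is the condition of failure, so that upper and lower deviations share
  one argument. At a unit vector the law of a row form is that of a single Gaussian, whatever
  \<open>n\<close> is.\<close>

lemma whp_row_sum:
  assumes g[measurable]: "g \<in> borel_measurable borel" and pos: "\<And>z. 0 \<le> g z"
    and ex: "(\<integral>\<^sup>+z. ennreal (exp (s0 * g z)) \<partial>scg) \<le> ennreal B" and c: "c > 0"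
    and Q: "\<And>m. {x. Q m x} \<in> sets borel"
    and b: "\<And>n m Y. exp_moment_row n s0 B Y \<Longrightarrow> (\<integral>\<^sup>+a. ennreal (Y a) \<partial>gauss_row n) = (\<integral>\<^sup>+z. ennreal (g z) \<partial>scg) \<Longrightarrow>
      emeasure (gaussian_entries m n) {w \<in> space (gaussian_entries m n). Q m (\<Sum>i<m. Y (mrow w i))} \<le> ennreal (exp (- c * real m))"
  shows "whp (\<lambda>n m u w. \<not> Q m (\<Sum>i<m. g (lin n (mrow w i) u)))"
proof -
  define Bad where "Bad n m u = {w \<in> space (gaussian_entries m n). Q m (\<Sum>i<m. g (lin n (mrow w i) u))}"
    for n m and u :: "nat \<Rightarrow> complex"
  have "whp (\<lambda>n m u w. w \<in> space (gaussian_entries m n) \<and> w \<notin> Bad n m u)"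
  proof (rule whp_single[OF c], rule conjI)
    fix n m :: nat and u :: "nat \<Rightarrow> complex" assume u: "nsq n u = 1"
    have "(\<lambda>w. \<Sum>i<m. g (lin n (mrow w i) u)) \<in> borel_measurable (gaussian_entries m n)"
      by (rule row_sum_measurable[where Y="\<lambda>a. g (lin n a u)"]) auto
    from measurable_sets[OF this Q[of m]] show "Bad n m u \<in> sets (gaussian_entries m n)"
      by (simp add: Bad_def vimage_def Int_def conj_commute)
    have "exp_moment_row n s0 B (\<lambda>a. g (lin n a u))"
      using nn_integral_lin1[of "\<lambda>z. ennreal (exp (s0 * g z))" n u] u ex pos by (simp add: exp_moment_row_def)
    then show "emeasure (gaussian_entries m n) (Bad n m u) \<le> ennreal (exp (- c * real m))"
      unfolding Bad_def using nn_integral_lin1[of "\<lambda>z. ennreal (g z)" n u] u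
      by (intro b[where Y="\<lambda>a. g (lin n a u)"]) auto
  qed
  then show ?thesis by (rule whp_mono) (auto simp: Bad_def)
qed

lemma whp_single_upper:
  assumes g: "g \<in> borel_measurable borel" "\<And>z. 0 \<le> g z" and s: "s0 > 0" "B \<ge> 0" "\<eta> > 0"
    and ex: "(\<integral>\<^sup>+z. ennreal (exp (s0 * g z)) \<partial>scg) \<le> ennreal B" and \<mu>: "\<mu> \<ge> 0" "(\<integral>\<^sup>+z. ennreal (g z) \<partial>scg) \<le> ennreal \<mu>"
  shows "whp (\<lambda>n m u w. (\<Sum>i<m. g (lin n (mrow w i) u)) \<le> real m * (\<mu> + \<eta>))"
proof -
  obtain c where c: "c > 0" and b: "\<And>n m Y \<mu>. exp_moment_row n s0 B Y \<Longrightarrow> \<mu> \<ge> 0 \<Longrightarrow>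
    (\<integral>\<^sup>+a. ennreal (Y a) \<partial>gauss_row n) \<le> ennreal \<mu> \<Longrightarrow>
    emeasure (gaussian_entries m n) {w \<in> space (gaussian_entries m n). real m * (\<mu> + \<eta>) \<le> (\<Sum>i<m. Y (mrow w i))}
      \<le> ennreal (exp (- c * real m))"
    using bernstein_upper[OF s] by auto
  have "whp (\<lambda>n m u w. \<not> real m * (\<mu> + \<eta>) \<le> (\<Sum>i<m. g (lin n (mrow w i) u)))"
    by (rule whp_row_sum[OF g ex c, where Q="\<lambda>m x. real m * (\<mu> + \<eta>) \<le> x"]) (use b \<mu> in auto)
  then show ?thesis by (rule whp_mono) auto
qed

lemma whp_single_lower:
  assumes g: "g \<in> borel_measurable borel" "\<And>z. 0 \<le> g z" and s: "s0 > 0" "B \<ge> 0" "\<eta> > 0"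
    and ex: "(\<integral>\<^sup>+z. ennreal (exp (s0 * g z)) \<partial>scg) \<le> ennreal B" and \<mu>: "\<mu> \<ge> 0" "ennreal \<mu> \<le> (\<integral>\<^sup>+z. ennreal (g z) \<partial>scg)"
  shows "whp (\<lambda>n m u w. real m * (\<mu> - \<eta>) \<le> (\<Sum>i<m. g (lin n (mrow w i) u)))"
proof -
  obtain c where c: "c > 0" and b: "\<And>n m Y \<mu>. exp_moment_row n s0 B Y \<Longrightarrow> \<mu> \<ge> 0 \<Longrightarrow>
    ennreal \<mu> \<le> (\<integral>\<^sup>+a. ennreal (Y a) \<partial>gauss_row n) \<Longrightarrow>
    emeasure (gaussian_entries m n) {w \<in> space (gaussian_entries m n). (\<Sum>i<m. Y (mrow w i)) \<le> real m * (\<mu> - \<eta>)}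
      \<le> ennreal (exp (- c * real m))"
    using bernstein_lower[OF s] by auto
  have "whp (\<lambda>n m u w. \<not> (\<Sum>i<m. g (lin n (mrow w i) u)) \<le> real m * (\<mu> - \<eta>))"
    by (rule whp_row_sum[OF g ex c, where Q="\<lambda>m x. x \<le> real m * (\<mu> - \<eta>)"]) (use b \<mu> in auto)
  then show ?thesis by (rule whp_mono) auto
qed

lemma nn_integral_exp_bounded:
  assumes "\<And>z. g z \<le> 1"
  shows "(\<integral>\<^sup>+z. ennreal (exp (1 * g z)) \<partial>scg) \<le> ennreal 3"
proof -
  interpret prob_space scg by (rule prob_space_scg)
  have "(\<integral>\<^sup>+z. ennreal (exp (1 * g z)) \<partial>scg) \<le> (\<integral>\<^sup>+z. ennreal 3 \<partial>scg)"
    using order_trans[OF _ exp_le] assms by (intro nn_integral_mono ennreal_leI) simp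
  then show ?thesis by (simp add: emeasure_space_1)
qed

text \<open>The cut at \<open>K\<close> would be a discontinuous function of \<open>d\<close>; max 0
  (d - K / 2) is 1-Lipschitz and at least d / 2 when d exceeds \<open>K\<close>, whence 400 = 4 *
  100. The common factor \<open>\<nu>\<^sup>2\<close> makes the bound quadratic in the length of the
  perturbation.\<close>

lemma truncation_bound:
  fixes c d \<nu> \<gamma> K h :: real
  assumes "0 \<le> c" "0 \<le> d" "0 < \<nu>" "\<nu> \<le> \<gamma>" "0 < K" and h: "(10 * K * \<gamma>)\<^sup>2 = h"
  shows "(if c \<le> 10 * (\<nu> * d) then c\<^sup>2 else 0)
    \<le> \<nu>\<^sup>2 * (100 * K\<^sup>2 * (if c\<^sup>2 \<le> h then 1 else 0) + 400 * (max 0 (d - K / 2))\<^sup>2)"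
proof (cases "c \<le> 10 * (\<nu> * d)")
  case le: True
  show ?thesis
  proof (cases "d \<le> K")
    case True
    have "\<nu> * d \<le> \<nu> * K" using True assms by (intro mult_left_mono) auto
    then have a: "c \<le> 10 * K * \<nu>" using le by (simp add: mult_ac)
    also have "\<dots> \<le> 10 * K * \<gamma>" using assms by (intro mult_left_mono) auto
    finally have "c\<^sup>2 \<le> h" unfolding h[symmetric] using assms by (intro power_mono) auto
    then have g: "(if c\<^sup>2 \<le> h then 1 else 0) = (1::real)" by simp
    have "c\<^sup>2 \<le> (10 * K * \<nu>)\<^sup>2" using a assms by (intro power_mono) auto
    also have "\<dots> = \<nu>\<^sup>2 * (100 * K\<^sup>2)" by (simp add: power2_eq_square)
    also have "\<dots> \<le> \<nu>\<^sup>2 * (100 * K\<^sup>2 * (if c\<^sup>2 \<le> h then 1 else 0) + 400 * (max 0 (d - K / 2))\<^sup>2)"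
      unfolding g by (intro mult_left_mono) auto
    finally show ?thesis using le by simp
  next
    case False
    then have "d / 2 \<le> d - K / 2" by simp
    also have "\<dots> \<le> max 0 (d - K / 2)" by simp
    finally have "(d / 2)\<^sup>2 \<le> (max 0 (d - K / 2))\<^sup>2" using assms by (intro power_mono) auto
    then have b: "100 * d\<^sup>2 \<le> 400 * (max 0 (d - K / 2))\<^sup>2" by (simp add: power_divide)
    have "c\<^sup>2 \<le> (10 * (\<nu> * d))\<^sup>2" using le assms by (intro power_mono) auto
    also have "\<dots> = \<nu>\<^sup>2 * (100 * d\<^sup>2)" by (simp add: power2_eq_square)
    also have "\<dots> \<le> \<nu>\<^sup>2 * (100 * K\<^sup>2 * (if c\<^sup>2 \<le> h then 1 else 0) + 400 * (max 0 (d - K / 2))\<^sup>2)"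
      by (rule mult_left_mono[OF order_trans[OF b]]) auto
    finally show ?thesis using le by simp
  qed
qed auto

text \<open>For \<open>\<parallel>v\<parallel> = \<nu> \<le> \<gamma>\<close>, an index with \<open>\<bar>c\<bar> \<le> 10 \<bar>d\<bar>\<close> either has \<open>\<bar>d\<bar> \<le> K \<nu>\<close>, so that \<open>\<bar>c\<bar>\<close> lies below the fixed
  threshold \<open>10 K \<gamma>\<close>, which is rare, or it contributes to the tail of the second moment of \<open>d\<close>.\<close>

lemma whp_small_coefficients:
  "\<exists>\<gamma>>0. whp (\<lambda>n m u w. \<forall>v. nsq n v \<le> \<gamma>\<^sup>2 \<longrightarrow>
     (\<Sum>i<m. if cmod (lin n (mrow w i) u) \<le> 10 * cmod (lin n (mrow w i) v) then (cmod (lin n (mrow w i) u))\<^sup>2 else 0)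
        \<le> (1/100) * real m * nsq n v)"
proof -
  \<comment> \<open>8 / K^2 = 1/180000 is at most 1/160000; adding the deviation 1/160000 and
    multiplying by 400 gives at most 1/200. The constant \<open>\<delta>\<close>, once for the mean
    and once for the deviation, supplies the other 1/200.\<close>
  define K :: real where "K = 1200"
  define \<delta> :: real where "\<delta> = 1 / (40000 * K\<^sup>2)"
  have \<delta>: "\<delta> > 0" "100 * K\<^sup>2 * (\<delta> + \<delta>) = 1/200" by (auto simp: \<delta>_def K_def)
  obtain h where h: "h > 0" "emeasure scg {z. \<bar>(cmod z)\<^sup>2 - 0\<bar> \<le> h} \<le> ennreal \<delta>"
    using scg_shell_small[OF \<delta>(1)] by blast
  \<comment> \<open>Thus 10 K \<gamma> is the square root of \<open>h\<close>, the radius of the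
    rare disc counted by \<open>?g\<close>.\<close>
  define \<gamma> where "\<gamma> = sqrt h / (10 * K)"
  have \<gamma>: "\<gamma> > 0" using h by (simp add: \<gamma>_def K_def)
  have \<gamma>h: "(10 * K * \<gamma>)\<^sup>2 = h" using h by (simp add: \<gamma>_def K_def)
  let ?g = "\<lambda>z. if (cmod z)\<^sup>2 \<le> h then 1 else (0::real)"
  have W1: "whp (\<lambda>n m u w. (\<Sum>i<m. ?g (lin n (mrow w i) u)) \<le> real m * (\<delta> + \<delta>))"
  proof (rule whp_single_upper[where ?s0.0=1 and B=3])
    show "(\<integral>\<^sup>+z. ennreal (exp (1 * ?g z)) \<partial>scg) \<le> ennreal 3" by (rule nn_integral_exp_bounded) simp
    have "(\<integral>\<^sup>+z. ennreal (?g z) \<partial>scg) = (\<integral>\<^sup>+z. indicator {z. \<bar>(cmod z)\<^sup>2 - 0\<bar> \<le> h} z \<partial>scg)"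
      by (intro nn_integral_cong) (simp add: indicator_def)
    also have "\<dots> = emeasure scg {z. \<bar>(cmod z)\<^sup>2 - 0\<bar> \<le> h}"
      by (rule nn_integral_indicator) (unfold sets_std_complex_gaussian, measurable)
    finally show "(\<integral>\<^sup>+z. ennreal (?g z) \<partial>scg) \<le> ennreal \<delta>" using h by simp
  qed (use \<delta> in auto)
  let ?f = "\<lambda>c d::complex. max 0 (cmod d - K / 2)"
  have W2: "whp (\<lambda>n m u w. \<forall>v \<mu>. nsq n v \<le> 1 \<longrightarrow> \<mu> \<ge> 0 \<longrightarrow>
     (\<integral>\<^sup>+a. ennreal ((?f (lin n a u) (lin n a v))\<^sup>2) \<partial>gauss_row n) \<le> ennreal \<mu> \<longrightarrow>
     (\<Sum>i<m. (?f (lin n (mrow w i) u) (lin n (mrow w i) v))\<^sup>2) \<le> real m * (\<mu> + 1/160000))"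
  proof (rule whp_uniform_upper[where L=1])
    fix c d d' :: complex
    show "\<bar>?f c d - ?f c d'\<bar> \<le> 1 * cmod (d - d')"
      using norm_triangle_ineq3[of d d'] by (simp add: max_def abs_if split: if_splits)
    show "(\<lambda>(c, d). ?f c d) \<in> borel_measurable (borel \<Otimes>\<^sub>M borel)" by measurable
  qed (auto simp: K_def)
  have "whp (\<lambda>n m u w. \<forall>v. nsq n v \<le> \<gamma>\<^sup>2 \<longrightarrow>
     (\<Sum>i<m. if cmod (lin n (mrow w i) u) \<le> 10 * cmod (lin n (mrow w i) v) then (cmod (lin n (mrow w i) u))\<^sup>2 else 0)
        \<le> (1/100) * real m * nsq n v)"
    using whp_conj[OF W1 W2]
  proof (rule whp_mono, elim conjE, intro allI impI)
    fix n m :: nat and u w v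
    assume S1: "(\<Sum>i<m. ?g (lin n (mrow w i) u)) \<le> real m * (\<delta> + \<delta>)"
      and S2: "\<forall>v \<mu>. nsq n v \<le> 1 \<longrightarrow> \<mu> \<ge> 0 \<longrightarrow>
     (\<integral>\<^sup>+a. ennreal ((?f (lin n a u) (lin n a v))\<^sup>2) \<partial>gauss_row n) \<le> ennreal \<mu> \<longrightarrow>
     (\<Sum>i<m. (?f (lin n (mrow w i) u) (lin n (mrow w i) v))\<^sup>2) \<le> real m * (\<mu> + 1/160000)"
      and v: "nsq n v \<le> \<gamma>\<^sup>2"
    let ?c = "\<lambda>i. lin n (mrow w i) u" and ?d = "\<lambda>i. lin n (mrow w i) v"
    show "(\<Sum>i<m. if cmod (?c i) \<le> 10 * cmod (?d i) then (cmod (?c i))\<^sup>2 else 0) \<le> (1/100) * real m * nsq n v"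
    proof (cases "nsq n v = 0")
      case True
      then show ?thesis by (simp add: lin_zero sum.neutral)
    next
      case False
      then have p: "nsq n v > 0" using nsq_nonneg[of n v] by linarith
      define \<nu> where "\<nu> = sqrt (nsq n v)"
      have \<nu>: "\<nu> > 0" "\<nu>\<^sup>2 = nsq n v" using p by (auto simp: \<nu>_def)
      have \<nu>\<gamma>: "\<nu> \<le> \<gamma>" using v \<gamma> unfolding \<nu>(2)[symmetric] by (simp add: power2_le_iff_abs_le)
      \<comment> \<open>The uniform tail bound is applied to the unit vector in the direction of
        \<open>v\<close>; a direct use at \<open>v\<close> would leave an additive error that is not
        proportional to \<open>nsq n v\<close>.\<close>
      define v' where "v' = (\<lambda>j. complex_of_real (1 / sqrt (nsq n v)) * v j)"
      let ?d' = "\<lambda>i. lin n (mrow w i) v'"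
      have v': "nsq n v' = 1" unfolding v'_def by (rule nsq_normalize[OF p])
      have d: "cmod (?d i) = \<nu> * cmod (?d' i)" for i
        unfolding v'_def lin_scale using p by (simp add: \<nu>_def norm_mult norm_divide)
      have "(\<integral>\<^sup>+a. ennreal ((?f (lin n a u) (lin n a v'))\<^sup>2) \<partial>gauss_row n)
         = (\<integral>\<^sup>+z. ennreal ((?f 0 z)\<^sup>2) \<partial>scg)"
        by (rule nn_integral_lin1[OF _ v']) measurable
      also have "\<dots> \<le> (\<integral>\<^sup>+z. ennreal (4 / K\<^sup>2) * ennreal (cmod z ^ 4) \<partial>scg)"
      proof (rule nn_integral_mono)
        fix z :: complex
        \<comment> \<open>On the support of the tail function 4 |z|^2 / K^2 is at least 1, so the
          second moment of the tail is controlled by the fourth moment 2.\<close>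
        have "(?f 0 z)\<^sup>2 \<le> 4 / K\<^sup>2 * cmod z ^ 4"
        proof (cases "cmod z \<le> K / 2")
          case True
          then have "?f 0 z = 0" by simp
          then show ?thesis by simp
        next
          case False
          have K: "K > 0" by (simp add: K_def)
          have "(K / 2)\<^sup>2 \<le> (cmod z)\<^sup>2" using False K by (intro power_mono) auto
          then have k: "1 \<le> 4 / K\<^sup>2 * (cmod z)\<^sup>2" using K by (simp add: power_divide field_simps)
          have "(?f 0 z)\<^sup>2 \<le> (cmod z)\<^sup>2" using False K by (intro power_mono) auto
          also have "\<dots> \<le> (4 / K\<^sup>2 * (cmod z)\<^sup>2) * (cmod z)\<^sup>2" using mult_right_mono[OF k, of "(cmod z)\<^sup>2"] by simp
          also have "\<dots> = 4 / K\<^sup>2 * cmod z ^ 4" by (simp add: power2_eq_square power4_eq_xxxx)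
          finally show ?thesis .
        qed
        then show "ennreal ((?f 0 z)\<^sup>2) \<le> ennreal (4 / K\<^sup>2) * ennreal (cmod z ^ 4)"
          by (simp add: ennreal_leI flip: ennreal_mult)
      qed
      also have "\<dots> = ennreal (4 / K\<^sup>2) * ennreal 2" by (simp add: nn_integral_cmult scg_norm4)
      also have "\<dots> = ennreal (8 / K\<^sup>2)" using ennreal_mult[of "4 / K\<^sup>2" 2] by simp
      finally have "(\<Sum>i<m. (?f (?c i) (?d' i))\<^sup>2) \<le> real m * (8 / K\<^sup>2 + 1/160000)"
        using S2[rule_format, of v' "8 / K\<^sup>2"] v' by simp
      also have "\<dots> \<le> real m * (1/80000)" by (intro mult_left_mono) (auto simp: K_def)
      finally have T2: "(\<Sum>i<m. (?f (?c i) (?d' i))\<^sup>2) \<le> real m * (1/80000)" .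
      have "(if cmod (?c i) \<le> 10 * cmod (?d i) then (cmod (?c i))\<^sup>2 else 0)
         \<le> \<nu>\<^sup>2 * (100 * K\<^sup>2 * ?g (?c i) + 400 * (?f (?c i) (?d' i))\<^sup>2)" for i
        unfolding d by (rule truncation_bound) (use \<nu> \<nu>\<gamma> \<gamma>h in \<open>auto simp: K_def\<close>)
      then have "(\<Sum>i<m. if cmod (?c i) \<le> 10 * cmod (?d i) then (cmod (?c i))\<^sup>2 else 0)
         \<le> (\<Sum>i<m. \<nu>\<^sup>2 * (100 * K\<^sup>2 * ?g (?c i) + 400 * (?f (?c i) (?d' i))\<^sup>2))"
        by (rule sum_mono)
      also have "\<dots> = \<nu>\<^sup>2 * (100 * K\<^sup>2 * (\<Sum>i<m. ?g (?c i)) + 400 * (\<Sum>i<m. (?f (?c i) (?d' i))\<^sup>2))"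
        unfolding sum_distrib_left sum.distrib[symmetric] ..
      also have "\<dots> \<le> \<nu>\<^sup>2 * (100 * K\<^sup>2 * (real m * (\<delta> + \<delta>)) + 400 * (real m * (1/80000)))"
        by (intro mult_left_mono add_mono S1 T2) auto
      also have "100 * K\<^sup>2 * (real m * (\<delta> + \<delta>)) = real m * (1/200)"
      proof -
        have "100 * K\<^sup>2 * (real m * (\<delta> + \<delta>)) = real m * (100 * K\<^sup>2 * (\<delta> + \<delta>))" by (simp only: mult_ac)
        then show ?thesis unfolding \<delta>(2) .
      qed
      also have "\<nu>\<^sup>2 * (real m * (1/200) + 400 * (real m * (1/80000))) = (1/100) * real m * nsq n v"
        unfolding \<nu>(2) by simp
      finally show ?thesis .
    qed
  qed
  then show ?thesis by (intro exI[of _ \<gamma>] conjI \<gamma>)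
qed

section \<open>The spectral initialization\<close>

text \<open>The value at \<open>u\<close> of the expected truncated form with a fixed level
  \<open>T\<close>; orthogonally to \<open>u\<close> the expected form is at most 1.\<close>

definition trunc4 :: "real \<Rightarrow> real" where
  "trunc4 T = enn2real (\<integral>\<^sup>+z. ennreal (if (cmod z)\<^sup>2 \<le> T then (cmod z)^4 else 0) \<partial>scg)"

lemma trunc4_eq: "(\<integral>\<^sup>+z. ennreal (if (cmod z)\<^sup>2 \<le> T then (cmod z)^4 else 0) \<partial>scg) = ennreal (trunc4 T)"
  unfolding trunc4_def
proof (rule nn_integral_finite_real)
  have "(\<integral>\<^sup>+z. ennreal (if (cmod z)\<^sup>2 \<le> T then (cmod z)^4 else 0) \<partial>scg) \<le> (\<integral>\<^sup>+z. ennreal (cmod z ^ 4) \<partial>scg)"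
    by (intro nn_integral_mono ennreal_leI) auto
  then show "(\<integral>\<^sup>+z. ennreal (if (cmod z)\<^sup>2 \<le> T then (cmod z)^4 else 0) \<partial>scg) \<le> ennreal 2"
    by (simp add: scg_norm4)
qed

lemma trunc4_nonneg: "trunc4 T \<ge> 0" by (simp add: trunc4_def)

text \<open>Above the level, |z|^4 is at most |z|^6 / 9. With fourth moment 2 and sixth moment 6 the
  truncation loses at most 6/9, so the gap over 1 is at least 1/3.\<close>

lemma trunc4_ge:
  assumes "T \<ge> 9"
  shows "trunc4 T \<ge> 4/3"
proof -
  have "ennreal 2 = (\<integral>\<^sup>+z. ennreal (cmod z ^ 4) \<partial>scg)" by (simp add: scg_norm4)
  also have "\<dots> \<le> (\<integral>\<^sup>+z. ennreal (if (cmod z)\<^sup>2 \<le> T then (cmod z)^4 else 0) + ennreal (1/9) * ennreal (cmod z ^ 6) \<partial>scg)"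
  proof (rule nn_integral_mono)
    fix z :: complex
    have "cmod z ^ 4 \<le> (if (cmod z)\<^sup>2 \<le> T then (cmod z)^4 else 0) + 1/9 * cmod z ^ 6"
    proof (cases "(cmod z)\<^sup>2 \<le> T")
      case False
      then have "9 * cmod z ^ 4 \<le> (cmod z)\<^sup>2 * cmod z ^ 4" using assms by (intro mult_right_mono) auto
      then show ?thesis using False by (simp flip: power_add)
    qed simp
    then have "ennreal (cmod z ^ 4) \<le> ennreal ((if (cmod z)\<^sup>2 \<le> T then (cmod z)^4 else 0) + 1/9 * cmod z ^ 6)"
      by (rule ennreal_leI)
    also have "\<dots> = ennreal (if (cmod z)\<^sup>2 \<le> T then (cmod z)^4 else 0) + ennreal (1/9 * cmod z ^ 6)"
      by (rule ennreal_plus) auto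
    also have "ennreal (1/9 * cmod z ^ 6) = ennreal (1/9) * ennreal (cmod z ^ 6)" by (rule ennreal_mult) auto
    finally show "ennreal (cmod z ^ 4) \<le> ennreal (if (cmod z)\<^sup>2 \<le> T then (cmod z)^4 else 0) + ennreal (1/9) * ennreal (cmod z ^ 6)" .
  qed
  also have "\<dots> = ennreal (trunc4 T) + ennreal (1/9) * ennreal 6"
    by (simp add: nn_integral_add nn_integral_cmult scg_norm6 trunc4_eq)
  also have "\<dots> = ennreal (trunc4 T + 6/9)"
    using ennreal_mult[of "1/9" 6] trunc4_nonneg[of T] by simp
  finally have "2 \<le> trunc4 T + 6/9" using trunc4_nonneg[of T] by (subst (asm) ennreal_le_iff) auto
  then show ?thesis by simp
qed

text \<open>The two truncations differ only on the shell around 9, where |z|^4 is at most 10^2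
  because \<open>h\<close> is at most 1.\<close>

lemma trunc4_diff:
  assumes "0 < h" "h \<le> 1" "emeasure scg {z. \<bar>(cmod z)\<^sup>2 - 9\<bar> \<le> h} \<le> ennreal \<delta>" "\<delta> \<ge> 0"
  shows "trunc4 (9 + h) \<le> trunc4 (9 - h) + 100 * \<delta>"
proof -
  have "ennreal (trunc4 (9 + h)) \<le> (\<integral>\<^sup>+z. ennreal (if (cmod z)\<^sup>2 \<le> 9 - h then (cmod z)^4 else 0) + 100 * indicator {z. \<bar>(cmod z)\<^sup>2 - 9\<bar> \<le> h} z \<partial>scg)"
    unfolding trunc4_eq[symmetric]
  proof (rule nn_integral_mono)
    fix z :: complex
    show "ennreal (if (cmod z)\<^sup>2 \<le> 9 + h then (cmod z)^4 else 0)
       \<le> ennreal (if (cmod z)\<^sup>2 \<le> 9 - h then (cmod z)^4 else 0) + 100 * indicator {z. \<bar>(cmod z)\<^sup>2 - 9\<bar> \<le> h} z"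
    proof (cases "(cmod z)\<^sup>2 \<le> 9 + h \<and> \<not> (cmod z)\<^sup>2 \<le> 9 - h")
      case True
      then have "z \<in> {z. \<bar>(cmod z)\<^sup>2 - 9\<bar> \<le> h}" by auto
      moreover have "cmod z ^ 4 \<le> 100"
      proof -
        have "cmod z ^ 4 = ((cmod z)\<^sup>2)\<^sup>2" by (simp flip: power_mult)
        also have "\<dots> \<le> 10\<^sup>2" using True assms by (intro power_mono) auto
        finally show ?thesis by simp
      qed
      ultimately show ?thesis using True ennreal_leI[of "cmod z ^ 4" 100] by simp
    qed auto
  qed
  also have "\<dots> = ennreal (trunc4 (9 - h)) + 100 * emeasure scg {z. \<bar>(cmod z)\<^sup>2 - 9\<bar> \<le> h}"
  proof -
    have [measurable]: "{z. \<bar>(cmod z)\<^sup>2 - 9\<bar> \<le> h} \<in> sets scg" unfolding sets_std_complex_gaussian by measurable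
    show ?thesis by (simp add: nn_integral_add nn_integral_cmult trunc4_eq)
  qed
  also have "\<dots> \<le> ennreal (trunc4 (9 - h)) + 100 * ennreal \<delta>"
    by (intro add_mono mult_left_mono assms) auto
  also have "\<dots> = ennreal (trunc4 (9 - h) + 100 * \<delta>)"
    using assms trunc4_nonneg[of "9 - h"] by (simp add: ennreal_mult)
  finally show ?thesis using assms trunc4_nonneg[of "9 - h"] by (subst (asm) ennreal_le_iff) auto
qed

text \<open>Given the value x of the form at \<open>u\<close>, the form at \<open>v\<close> has
  second moment q |x|^2 + 1 - q, where q is the squared overlap of \<open>u\<close> and
  \<open>v\<close>. In the term with 1 - q the truncation is dropped, which leaves the full second
  moment 1.\<close>

lemma truncated_second_moment_le:
  assumes u: "nsq n u = 1" and v: "nsq n v = 1"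
  shows "(\<integral>\<^sup>+a. ennreal (((if (cmod (lin n a u))\<^sup>2 \<le> T then cmod (lin n a u) else 0) * cmod (lin n a v))\<^sup>2) \<partial>gauss_row n)
    \<le> ennreal ((cmod (inn n u v))\<^sup>2 * trunc4 T + (1 - (cmod (inn n u v))\<^sup>2))"
proof -
  obtain r where r: "(cmod (inn n u v))\<^sup>2 + (cmod r)\<^sup>2 = nsq n v" and
    F: "\<And>F. F \<in> borel_measurable (borel \<Otimes>\<^sub>M borel) \<Longrightarrow>
      (\<integral>\<^sup>+a. F (lin n a u, lin n a v) \<partial>gauss_row n)
      = (\<integral>\<^sup>+x. \<integral>\<^sup>+y. (F (x, cnj (inn n u v) * x + r * y) :: ennreal) \<partial>scg \<partial>scg)"
    by (rule nn_integral_lin_unit[OF u, of v]) (rule that)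
  define q where "q = (cmod (inn n u v))\<^sup>2"
  have qr: "(cmod r)\<^sup>2 = 1 - q" using r v by (simp add: q_def)
  moreover have "0 \<le> q" by (simp add: q_def)
  moreover have "0 \<le> 1 - q" unfolding qr[symmetric] by simp
  ultimately have qr: "(cmod r)\<^sup>2 = 1 - q" "0 \<le> q" "0 \<le> 1 - q" by blast+
  let ?t = "\<lambda>x. if (cmod x)\<^sup>2 \<le> T then cmod x else 0"
  have "(\<integral>\<^sup>+a. ennreal ((?t (lin n a u) * cmod (lin n a v))\<^sup>2) \<partial>gauss_row n)
     = (\<integral>\<^sup>+x. \<integral>\<^sup>+y. ennreal ((?t x)\<^sup>2) * ennreal ((cmod (cnj (inn n u v) * x + r * y))\<^sup>2) \<partial>scg \<partial>scg)"
    using F[of "\<lambda>(c, d). ennreal ((?t c * cmod d)\<^sup>2)"] by (simp add: power_mult_distrib ennreal_mult)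
  also have "\<dots> = (\<integral>\<^sup>+x. ennreal ((?t x)\<^sup>2) * ennreal (q * (cmod x)\<^sup>2 + (1 - q)) \<partial>scg)"
    by (simp add: nn_integral_cmult scg_affine_norm2 norm_mult power_mult_distrib q_def[symmetric] qr(1))
  also have "\<dots> \<le> (\<integral>\<^sup>+x. ennreal q * ennreal (if (cmod x)\<^sup>2 \<le> T then (cmod x)^4 else 0) + ennreal (1 - q) * ennreal ((cmod x)\<^sup>2) \<partial>scg)"
  proof (rule nn_integral_mono)
    fix x :: complex
    have "(?t x)\<^sup>2 * (q * (cmod x)\<^sup>2 + (1 - q)) \<le> q * (if (cmod x)\<^sup>2 \<le> T then (cmod x)^4 else 0) + (1 - q) * (cmod x)\<^sup>2"
    proof (cases "(cmod x)\<^sup>2 \<le> T")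
      case True then show ?thesis by (simp add: power4_eq_xxxx power2_eq_square algebra_simps)
    next
      case False then show ?thesis using qr by simp
    qed
    then have "ennreal ((?t x)\<^sup>2 * (q * (cmod x)\<^sup>2 + (1 - q))) \<le> ennreal (q * (if (cmod x)\<^sup>2 \<le> T then (cmod x)^4 else 0) + (1 - q) * (cmod x)\<^sup>2)"
      by (rule ennreal_leI)
    also have "ennreal ((?t x)\<^sup>2 * (q * (cmod x)\<^sup>2 + (1 - q))) = ennreal ((?t x)\<^sup>2) * ennreal (q * (cmod x)\<^sup>2 + (1 - q))"
      using qr by (intro ennreal_mult) (auto intro!: add_nonneg_nonneg)
    also have "ennreal (q * (if (cmod x)\<^sup>2 \<le> T then (cmod x)^4 else 0) + (1 - q) * (cmod x)\<^sup>2)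
      = ennreal q * ennreal (if (cmod x)\<^sup>2 \<le> T then (cmod x)^4 else 0) + ennreal (1 - q) * ennreal ((cmod x)\<^sup>2)"
      using qr by (intro ennreal_lincomb) auto
    finally show "ennreal ((?t x)\<^sup>2) * ennreal (q * (cmod x)\<^sup>2 + (1 - q))
      \<le> ennreal q * ennreal (if (cmod x)\<^sup>2 \<le> T then (cmod x)^4 else 0) + ennreal (1 - q) * ennreal ((cmod x)\<^sup>2)" .
  qed
  also have "\<dots> = ennreal q * ennreal (trunc4 T) + ennreal (1 - q)"
    by (simp add: nn_integral_add nn_integral_cmult trunc4_eq scg_norm2)
  also have "\<dots> = ennreal (q * trunc4 T + (1 - q) * 1)"
    using ennreal_lincomb[of q "trunc4 T" "1 - q" 1] qr trunc4_nonneg by simp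
  finally show ?thesis by (simp add: q_def)
qed

definition wform :: "nat \<Rightarrow> nat \<Rightarrow> (nat \<times> nat \<Rightarrow> complex) \<Rightarrow> (nat \<Rightarrow> real) \<Rightarrow> (nat \<Rightarrow> complex) \<Rightarrow> real" where
  "wform n m w W v = (\<Sum>i<m. W i * (cmod (lin n (mrow w i) v))\<^sup>2)"

definition spec_weight :: "nat \<Rightarrow> nat \<Rightarrow> (nat \<times> nat \<Rightarrow> complex) \<Rightarrow> (nat \<Rightarrow> complex) \<Rightarrow> nat \<Rightarrow> real" where
  "spec_weight n m w u i = (if (cmod (lin n (mrow w i) u))\<^sup>2 \<le> 9 / real m * (\<Sum>j<m. (cmod (lin n (mrow w j) u))\<^sup>2)
     then (cmod (lin n (mrow w i) u))\<^sup>2 else 0)"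

text \<open>The random level lies between 9 - h and 9 + h. Since the form increases with the level,
  it is bounded below at the fixed vector \<open>u\<close> with the lower level, and above at
  \<open>z\<close>, uniformly, with the upper one. If \<open>z\<close> does at least as well as
  \<open>u\<close>, the gap 1/3 forces the overlap to be close to 1.\<close>

lemma whp_spectral:
  assumes \<epsilon>: "\<epsilon> > 0"
  shows "whp (\<lambda>n m u w. \<forall>z. nsq n z = 1 \<longrightarrow> wform n m w (spec_weight n m w u) u \<le> wform n m w (spec_weight n m w u) z \<longrightarrow>
    1 - (cmod (inn n u z))\<^sup>2 \<le> \<epsilon>)"
proof -
  \<comment> \<open>Chosen so that the final bound 300 \<delta> + 6 \<eta> equals
    \<open>\<epsilon>\<close>, half from each term.\<close>
  define \<delta> where "\<delta> = \<epsilon> / 600"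
  define \<eta> where "\<eta> = \<epsilon> / 12"
  have \<delta>: "\<delta> > 0" and \<eta>: "\<eta> > 0" using \<epsilon> by (auto simp: \<delta>_def \<eta>_def)
  obtain h0 where h0: "h0 > 0" "emeasure scg {z. \<bar>(cmod z)\<^sup>2 - 9\<bar> \<le> h0} \<le> ennreal \<delta>"
    using scg_shell_small[OF \<delta>] by blast
  define h where "h = min h0 1"
  have h: "0 < h" "h \<le> 1" using h0 by (auto simp: h_def)
  have "{z. \<bar>(cmod z)\<^sup>2 - 9\<bar> \<le> h0} \<in> sets scg" unfolding sets_std_complex_gaussian by measurable
  then have "emeasure scg {z. \<bar>(cmod z)\<^sup>2 - 9\<bar> \<le> h} \<le> emeasure scg {z. \<bar>(cmod z)\<^sup>2 - 9\<bar> \<le> h0}"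
    by (intro emeasure_mono) (auto simp: h_def)
  then have hd: "trunc4 (9 + h) \<le> trunc4 (9 - h) + 100 * \<delta>"
    using h h0 \<delta> by (intro trunc4_diff) auto
  have ex: "(\<integral>\<^sup>+z. ennreal (exp (1/2 * (cmod z)\<^sup>2)) \<partial>scg) \<le> ennreal 2"
    using scg_exp_half by simp
  \<comment> \<open>The level is 9 times the empirical mean, so accuracy h / 9 of the mean is
    accuracy \<open>h\<close> of the level.\<close>
  have W1: "whp (\<lambda>n m u w. (\<Sum>i<m. (cmod (lin n (mrow w i) u))\<^sup>2) \<le> real m * (1 + h / 9))"
    by (rule whp_single_upper[where g="\<lambda>z. (cmod z)\<^sup>2" and ?s0.0="1/2" and B=2])
      (use h ex in \<open>auto simp: scg_norm2\<close>)
  have W2: "whp (\<lambda>n m u w. real m * (1 - h / 9) \<le> (\<Sum>i<m. (cmod (lin n (mrow w i) u))\<^sup>2))"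
    by (rule whp_single_lower[where g="\<lambda>z. (cmod z)\<^sup>2" and ?s0.0="1/2" and B=2])
      (use h ex in \<open>auto simp: scg_norm2\<close>)
  let ?g = "\<lambda>z. if (cmod z)\<^sup>2 \<le> 9 - h then (cmod z)^4 else 0"
  have W3: "whp (\<lambda>n m u w. real m * (trunc4 (9 - h) - \<eta>) \<le> (\<Sum>i<m. ?g (lin n (mrow w i) u)))"
  proof (rule whp_single_lower[where g="?g" and ?s0.0="1/100" and B=3])
    have "?g z \<le> 100" for z :: complex
    proof -
      have "cmod z ^ 4 \<le> 100" if "(cmod z)\<^sup>2 \<le> 9 - h"
      proof -
        have "cmod z ^ 4 = ((cmod z)\<^sup>2)\<^sup>2" by (simp flip: power_mult)
        also have "\<dots> \<le> 10\<^sup>2" using that h by (intro power_mono) auto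
        finally show ?thesis by simp
      qed
      then show ?thesis by simp
    qed
    then have "(\<integral>\<^sup>+z. ennreal (exp (1 * (1/100 * ?g z))) \<partial>scg) \<le> ennreal 3"
      by (intro nn_integral_exp_bounded) (simp add: field_simps)
    then show "(\<integral>\<^sup>+z. ennreal (exp (1/100 * ?g z)) \<partial>scg) \<le> ennreal 3" by simp
    show "ennreal (trunc4 (9 - h)) \<le> (\<integral>\<^sup>+z. ennreal (?g z) \<partial>scg)" by (simp only: trunc4_eq)
  qed (use \<eta> trunc4_nonneg in auto)
  let ?f = "\<lambda>c d. (if (cmod c)\<^sup>2 \<le> 9 + h then cmod c else 0) * cmod d"
  have W4: "whp (\<lambda>n m u w. \<forall>v \<mu>. nsq n v \<le> 1 \<longrightarrow> \<mu> \<ge> 0 \<longrightarrow>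
     (\<integral>\<^sup>+a. ennreal ((?f (lin n a u) (lin n a v))\<^sup>2) \<partial>gauss_row n) \<le> ennreal \<mu> \<longrightarrow>
     (\<Sum>i<m. (?f (lin n (mrow w i) u) (lin n (mrow w i) v))\<^sup>2) \<le> real m * (\<mu> + \<eta>))"
  \<comment> \<open>The first factor is at most the root of 9 + h, which is at most 4; hence the
    Lipschitz constant.\<close>
  proof (rule whp_uniform_upper[where f="?f" and L=4])
    fix c d d' :: complex
    have "(if (cmod c)\<^sup>2 \<le> 9 + h then cmod c else 0) \<le> 4"
    proof -
      have "cmod c \<le> 4" if "(cmod c)\<^sup>2 \<le> 9 + h"
        by (rule power2_le_imp_le) (use that h in auto)
      then show ?thesis by simp
    qed
    then have "(if (cmod c)\<^sup>2 \<le> 9 + h then cmod c else 0) * \<bar>cmod d - cmod d'\<bar> \<le> 4 * cmod (d - d')"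
      by (intro mult_mono norm_triangle_ineq3) auto
    then show "\<bar>?f c d - ?f c d'\<bar> \<le> 4 * cmod (d - d')" by (simp add: abs_mult flip: right_diff_distrib)
    show "(\<lambda>(c, d). ?f c d) \<in> borel_measurable (borel \<Otimes>\<^sub>M borel)" by measurable
  qed (use \<eta> in auto)
  show ?thesis
    using whp_conj[OF whp_conj[OF W1 W2] whp_conj[OF W3 W4]]
  proof (rule whp_mono, elim conjE, intro allI impI)
    fix n m :: nat and u w z
    assume m: "m > 0" and u: "nsq n u = 1" and z: "nsq n z = 1" and le: "wform n m w (spec_weight n m w u) u \<le> wform n m w (spec_weight n m w u) z"
    assume S1: "(\<Sum>i<m. (cmod (lin n (mrow w i) u))\<^sup>2) \<le> real m * (1 + h / 9)"
      and S2: "real m * (1 - h / 9) \<le> (\<Sum>i<m. (cmod (lin n (mrow w i) u))\<^sup>2)"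
      and S3: "real m * (trunc4 (9 - h) - \<eta>) \<le> (\<Sum>i<m. ?g (lin n (mrow w i) u))"
      and S4: "\<forall>v \<mu>. nsq n v \<le> 1 \<longrightarrow> \<mu> \<ge> 0 \<longrightarrow>
     (\<integral>\<^sup>+a. ennreal ((?f (lin n a u) (lin n a v))\<^sup>2) \<partial>gauss_row n) \<le> ennreal \<mu> \<longrightarrow>
     (\<Sum>i<m. (?f (lin n (mrow w i) u) (lin n (mrow w i) v))\<^sup>2) \<le> real m * (\<mu> + \<eta>)"
    define t where "t = 9 / real m * (\<Sum>j<m. (cmod (lin n (mrow w j) u))\<^sup>2)"
    have t: "t \<le> 9 + h" "9 - h \<le> t" using S1 S2 m by (auto simp: t_def field_simps)
    define q where "q = (cmod (inn n u z))\<^sup>2"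
    have q0: "0 \<le> q" by (simp add: q_def)
    obtain r where "(cmod (inn n u z))\<^sup>2 + (cmod r)\<^sup>2 = nsq n z"
      by (rule nn_integral_lin_unit[OF u, of z]) (rule that)
    then have q1: "q \<le> 1" using z zero_le_power2[of "cmod r"] unfolding q_def by linarith
    have "(\<Sum>i<m. ?g (lin n (mrow w i) u)) \<le> wform n m w (spec_weight n m w u) u"
      unfolding wform_def spec_weight_def t_def[symmetric]
      using t by (intro sum_mono) (auto simp: power4_eq_xxxx power2_eq_square)
    also note le
    also have "wform n m w (spec_weight n m w u) z \<le> (\<Sum>i<m. (?f (lin n (mrow w i) u) (lin n (mrow w i) z))\<^sup>2)"
      unfolding wform_def spec_weight_def t_def[symmetric]
      using t by (intro sum_mono) (auto simp: power_mult_distrib)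
    also have "\<dots> \<le> real m * ((q * trunc4 (9 + h) + (1 - q)) + \<eta>)"
      using S4[rule_format, of z] z truncated_second_moment_le[OF u z, of "9 + h"] q0 q1 trunc4_nonneg[of "9 + h"]
      unfolding q_def[symmetric] by simp
    finally have "real m * (trunc4 (9 - h) - \<eta>) \<le> real m * ((q * trunc4 (9 + h) + (1 - q)) + \<eta>)"
      using S3 by linarith
    then have "trunc4 (9 - h) - \<eta> \<le> (q * trunc4 (9 + h) + (1 - q)) + \<eta>"
      using m by (simp only: mult_le_cancel_left_pos of_nat_0_less_iff)
    then have 1: "(1 - q) * (trunc4 (9 + h) - 1) \<le> 100 * \<delta> + 2 * \<eta>" using hd by (simp add: algebra_simps)
    have "(1 - q) * (1/3) \<le> (1 - q) * (trunc4 (9 + h) - 1)"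
      using q1 trunc4_ge[of "9 + h"] h by (intro mult_left_mono) auto
    also note 1
    finally have "1 - q \<le> 300 * \<delta> + 6 * \<eta>" by simp
    then show "1 - (cmod (inn n u z))\<^sup>2 \<le> \<epsilon>" by (simp add: q_def \<delta>_def \<eta>_def)
  qed
qed

section \<open>Rayleigh quotients and pseudo-inverses\<close>

text \<open>Coordinate \<open>k\<close> of H v, where H is the sum of the rank-one matrices of the
  measurement vectors with weights \<open>W\<close>. The first factor is conjugated because
  \<open>w (i, k)\<close> is the conjugate of a measurement vector entry.\<close>

definition wapply :: "nat \<Rightarrow> nat \<Rightarrow> (nat \<times> nat \<Rightarrow> complex) \<Rightarrow> (nat \<Rightarrow> real) \<Rightarrow> (nat \<Rightarrow> complex) \<Rightarrow> nat \<Rightarrow> complex" where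
  "wapply n m w W v k = (\<Sum>i<m. complex_of_real (W i) * cnj (w (i, k)) * lin n (mrow w i) v)"

lemma sum_cnj_wapply:
  "(\<Sum>k<n. cnj (d k) * wapply n m w W v k) = (\<Sum>i<m. complex_of_real (W i) * (cnj (lin n (mrow w i) d) * lin n (mrow w i) v))"
proof -
  have "(\<Sum>k<n. cnj (d k) * wapply n m w W v k)
    = (\<Sum>k<n. \<Sum>i<m. cnj (d k) * (complex_of_real (W i) * cnj (w (i, k)) * lin n (mrow w i) v))"
    unfolding wapply_def sum_distrib_left ..
  also have "\<dots> = (\<Sum>i<m. \<Sum>k<n. cnj (d k) * (complex_of_real (W i) * cnj (w (i, k)) * lin n (mrow w i) v))"
    by (rule sum.swap)
  also have "\<dots> = (\<Sum>i<m. complex_of_real (W i) * (cnj (lin n (mrow w i) d) * lin n (mrow w i) v))"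
  proof (rule sum.cong[OF refl])
    fix i
    have "cnj (lin n (mrow w i) d) = (\<Sum>k<n. cnj (w (i, k)) * cnj (d k))"
      by (simp add: lin_def mrow_def)
    then show "(\<Sum>k<n. cnj (d k) * (complex_of_real (W i) * cnj (w (i, k)) * lin n (mrow w i) v))
       = complex_of_real (W i) * (cnj (lin n (mrow w i) d) * lin n (mrow w i) v)"
      by (simp add: sum_distrib_left sum_distrib_right mult_ac)
  qed
  finally show ?thesis .
qed

lemma wform_eq: "complex_of_real (wform n m w W v) = (\<Sum>k<n. cnj (v k) * wapply n m w W v k)"
proof -
  have "cnj (lin n (mrow w i) v) * lin n (mrow w i) v = complex_of_real ((cmod (lin n (mrow w i) v))\<^sup>2)" for i
    unfolding complex_norm_square by (rule mult.commute)
  then show ?thesis unfolding sum_cnj_wapply wform_def by simp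
qed

lemma compact_unit_sphere: "compact {v. (\<forall>j\<ge>n. v j = 0) \<and> nsq n v = 1}"
proof -
  let ?S = "\<lambda>j. if j < n then cball (0::complex) 1 else {0}"
  have c: "compact (PiE UNIV ?S)"
    using compactin_PiE[of "\<lambda>_. euclidean" UNIV ?S] unfolding euclidean_product_topology compactin_euclidean_iff
    by auto
  have cont: "continuous_on UNIV (nsq n)"
    unfolding nsq_def by (intro continuous_intros continuous_on_product_coordinates)
  have "closed {v. nsq n v = 1}"
    by (intro closed_Collect_eq cont continuous_intros)
  with c have "compact (PiE UNIV ?S \<inter> {v. nsq n v = 1})" by (rule compact_Int_closed)
  also have "PiE UNIV ?S \<inter> {v. nsq n v = 1} = {v. (\<forall>j\<ge>n. v j = 0) \<and> nsq n v = 1}"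
  proof (intro equalityI subsetI)
    fix v assume v: "v \<in> PiE UNIV ?S \<inter> {v. nsq n v = 1}"
    have "v j = 0" if "j \<ge> n" for j
    proof -
      have "v j \<in> ?S j" by (rule PiE_mem[OF IntD1[OF v] UNIV_I])
      then show ?thesis using that by (simp only: if_not_P not_less singleton_iff)
    qed
    then show "v \<in> {v. (\<forall>j\<ge>n. v j = 0) \<and> nsq n v = 1}" using IntD2[OF v] by simp
  next
    fix v assume v: "v \<in> {v. (\<forall>j\<ge>n. v j = 0) \<and> nsq n v = 1}"
    have "cmod (v j) \<le> 1" if "j < n" for j
    proof -
      have "(cmod (v j))\<^sup>2 \<le> nsq n v" unfolding nsq_def using that by (intro member_le_sum) auto
      then show ?thesis using v by (simp add: abs_square_le_1)
    qed
    then have "v \<in> PiE UNIV ?S" using v by (intro PiE_I) auto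
    then show "v \<in> PiE UNIV ?S \<inter> {v. nsq n v = 1}" using v by (intro IntI) auto
  qed
  finally show ?thesis .
qed

lemma quadratic_nonneg_imp_linear_zero:
  fixes P Q :: real
  assumes "\<And>t. 0 \<le> 2 * t * P + t\<^sup>2 * Q" "Q \<ge> 0"
  shows "P = 0"
proof (rule ccontr)
  assume "P \<noteq> 0"
  \<comment> \<open>Substituting this value turns the quadratic into -(t^2 (Q + 2)), which is
    negative unless \<open>P\<close> vanishes.\<close>
  define t where "t = - P / (Q + 1)"
  have P: "P = - t * (Q + 1)" using assms(2) by (simp add: t_def)
  have "2 * t * P + t\<^sup>2 * Q = - (t\<^sup>2 * (Q + 2))" unfolding P by (simp add: power2_eq_square algebra_simps)
  moreover have "t \<noteq> 0" using \<open>P \<noteq> 0\<close> assms(2) by (simp add: t_def)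
  then have "t\<^sup>2 * (Q + 2) > 0" using assms(2) by simp
  ultimately show False using assms(1)[of t] by linarith
qed

lemma cmod_add_sq: "(cmod (x + complex_of_real t * y))\<^sup>2 = (cmod x)\<^sup>2 + 2 * t * Re (cnj y * x) + t\<^sup>2 * (cmod y)\<^sup>2"
  unfolding cmod_power2 by (simp add: power2_eq_square algebra_simps)

text \<open>A maximum of the form on the compact sphere exists, and stationarity there is the
  eigenvector equation. This yields an eigenvector that attains the maximum without diagonalising
  the matrix.\<close>

lemma rayleigh_maximizer:
  assumes n: "n > 0"
  obtains y \<kappa> where "nsq n y = 1" "\<And>k. k < n \<Longrightarrow> wapply n m w W y k = complex_of_real \<kappa> * y k"
    "\<And>v. wform n m w W v \<le> \<kappa> * nsq n v"
proof -
  let ?K = "{v. (\<forall>j\<ge>n. v j = 0) \<and> nsq n v = 1}"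
  let ?R = "wform n m w W"
  have "nsq n (\<lambda>j. if j = 0 then 1 else 0) = 1"
    using n by (simp add: nsq_def if_distrib[of cmod] if_distrib[of "\<lambda>x. x\<^sup>2"] sum.delta cong: if_cong)
  then have ne: "?K \<noteq> {}" using n by (auto intro!: exI[of _ "\<lambda>j. if j = 0 then 1 else 0"])
  have cont: "continuous_on ?K ?R"
    unfolding wform_def lin_def
    by (intro continuous_intros continuous_on_subset[OF continuous_on_product_coordinates]) auto
  obtain y where y: "y \<in> ?K" "\<And>v. v \<in> ?K \<Longrightarrow> ?R v \<le> ?R y"
    using continuous_attains_sup[OF compact_unit_sphere ne cont] by blast
  define \<kappa> where "\<kappa> = ?R y"
  have unit: "?R v \<le> \<kappa>" if "nsq n v = 1" for v
  proof -
    \<comment> \<open>The compact set contains only vectors that vanish from \<open>n\<close> on, so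
      \<open>v\<close> is cut off; the form does not see the difference.\<close>
    define v' where "v' j = (if j < n then v j else 0)" for j
    have "v' \<in> ?K" using that by (auto simp: v'_def nsq_def)
    moreover have "lin n a v' = lin n a v" for a by (simp add: lin_def v'_def)
    then have "?R v' = ?R v" by (simp add: wform_def)
    ultimately show ?thesis using y(2)[of v'] by (simp add: \<kappa>_def)
  qed
  have le: "?R v \<le> \<kappa> * nsq n v" for v
  proof (rule le_of_forall_unit[where P="\<lambda>_. True"])
    show "?R (\<lambda>j. complex_of_real s * v j) = s\<^sup>2 * ?R v" for s v
      by (simp add: wform_def lin_scale norm_mult power_mult_distrib sum_distrib_left mult_ac)
  qed (use unit in \<open>auto simp: wform_def lin_zero\<close>)
  define g where "g k = complex_of_real \<kappa> * y k - wapply n m w W y k" for k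
  have y1: "nsq n y = 1" using y(1) by simp
  have lin0: "Re (\<Sum>k<n. cnj (d k) * g k) = 0" for d
  proof -
    define P where "P = Re (\<Sum>k<n. cnj (d k) * g k)"
    have P: "P = \<kappa> * (\<Sum>k<n. Re (cnj (d k) * y k)) - (\<Sum>i<m. W i * Re (cnj (lin n (mrow w i) d) * lin n (mrow w i) y))"
    proof -
      have "(\<Sum>k<n. cnj (d k) * g k) = complex_of_real \<kappa> * (\<Sum>k<n. cnj (d k) * y k) - (\<Sum>k<n. cnj (d k) * wapply n m w W y k)"
        unfolding g_def right_diff_distrib sum_subtractf sum_distrib_left by (simp add: mult.left_commute)
      then have "P = Re (complex_of_real \<kappa> * (\<Sum>k<n. cnj (d k) * y k)) - Re (\<Sum>i<m. complex_of_real (W i) * (cnj (lin n (mrow w i) d) * lin n (mrow w i) y))"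
        unfolding P_def sum_cnj_wapply by simp
      then show ?thesis by (simp only: Re_complex_of_real times_complex.sel Im_complex_of_real Re_sum) simp
    qed
    have N: "nsq n (\<lambda>j. y j + complex_of_real t * d j) = nsq n y + 2 * t * (\<Sum>k<n. Re (cnj (d k) * y k)) + t\<^sup>2 * nsq n d" for t
      unfolding nsq_def cmod_add_sq sum.distrib sum_distrib_left ..
    have R: "?R (\<lambda>j. y j + complex_of_real t * d j) = ?R y + 2 * t * (\<Sum>i<m. W i * Re (cnj (lin n (mrow w i) d) * lin n (mrow w i) y)) + t\<^sup>2 * ?R d" for t
      unfolding wform_def lin_add lin_scale cmod_add_sq distrib_left sum.distrib sum_distrib_left
      by (simp only: mult_ac)
    \<comment> \<open>Along the line through \<open>y\<close> in direction \<open>d\<close>, the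
      deficit of the form against its maximum is a non-negative quadratic in \<open>t\<close>
      without constant term, and \<open>P\<close> is half of its linear coefficient.\<close>
    have "P = 0"
    proof (rule quadratic_nonneg_imp_linear_zero[of P "\<kappa> * nsq n d - ?R d"])
      fix t
      have "?R (\<lambda>j. y j + complex_of_real t * d j) \<le> \<kappa> * nsq n (\<lambda>j. y j + complex_of_real t * d j)" by (rule le)
      then show "0 \<le> 2 * t * P + t\<^sup>2 * (\<kappa> * nsq n d - ?R d)"
        unfolding N R P y1 \<kappa>_def[symmetric] by (simp add: algebra_simps)
    qed (use le[of d] in simp)
    then show ?thesis by (simp add: P_def)
  qed
  \<comment> \<open>The variation in the direction of the residual \<open>g\<close> itself equals
    \<open>nsq n g\<close>.\<close>
  have "nsq n g = 0"
  proof -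
    have "(\<Sum>k<n. cnj (g k) * g k) = complex_of_real (nsq n g)"
      using inn_self[of n g] by (simp add: inn_def mult.commute)
    then show ?thesis using lin0[of g] by simp
  qed
  then have "g k = 0" if "k < n" for k using that by (rule nsq_zeroD)
  then have "wapply n m w W y k = complex_of_real \<kappa> * y k" if "k < n" for k using that by (simp add: g_def)
  then show thesis using y1 le by (intro that) auto
qed

section \<open>Translating matrices and vectors into coordinate functions\<close>

lemma mult_mat_vec_lin:
  assumes "x \<in> carrier_vec n" "i < m"
  shows "(mat m n w *\<^sub>v x) $ i = lin n (mrow w i) (\<lambda>j. x $ j)"
  using assms by (simp add: scalar_prod_def lin_def mrow_def lessThan_atLeast0)

lemma intensity_lin:
  assumes "x \<in> carrier_vec n" "i < m"
  shows "intensity (mat m n w) x i = (cmod (lin n (mrow w i) (\<lambda>j. x $ j)))\<^sup>2"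
  using assms by (simp add: intensity_def meas_vec_def scalar_prod_def lin_def mrow_def lessThan_atLeast0 mult.commute)

lemma spectral_mat_carrier: "spectral_mat (mat m n w) x \<in> carrier_mat n n"
  by (simp add: spectral_mat_def Let_def)

lemma spectral_mat_apply:
  assumes x: "x \<in> carrier_vec n" and v: "v \<in> carrier_vec n" and k: "k < n"
  shows "(spectral_mat (mat m n w) x *\<^sub>v v) $ k
    = wapply n m w (\<lambda>i. spec_weight n m w (\<lambda>j. x $ j) i / real m) (\<lambda>j. v $ j) k"
proof -
  let ?A = "mat m n w"
  let ?W = "spec_weight n m w (\<lambda>j. x $ j)"
  have I: "complex_of_real (intensity ?A x i) * (meas_vec ?A i $ k * cnj (meas_vec ?A i $ l)) *
              of_bool (intensity ?A x i \<le> 9 / real m * (\<Sum>j<m. intensity ?A x j))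
     = complex_of_real (?W i) * cnj (w (i, k)) * w (i, l)" if "i < m" "l < n" for i l
  proof -
    have "(\<Sum>j<m. intensity ?A x j) = (\<Sum>j<m. (cmod (lin n (mrow w j) (\<lambda>j. x $ j)))\<^sup>2)"
      using x by (intro sum.cong) (auto simp: intensity_lin)
    then show ?thesis using that k x
      by (simp add: intensity_lin spec_weight_def meas_vec_def)
  qed
  have "(spectral_mat ?A x *\<^sub>v v) $ k = (\<Sum>l<n. spectral_mat ?A x $$ (k, l) * v $ l)"
    using spectral_mat_carrier[of m n w x] v k by (simp add: scalar_prod_def lessThan_atLeast0)
  also have "\<dots> = (\<Sum>l<n. (1 / of_nat m * (\<Sum>i<m. complex_of_real (?W i) * cnj (w (i, k)) * w (i, l))) * v $ l)"
  proof (rule sum.cong[OF refl])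
    fix l assume l: "l \<in> {..<n}"
    have "spectral_mat ?A x $$ (k, l) = 1 / of_nat m * (\<Sum>i<m. complex_of_real (intensity ?A x i) * (meas_vec ?A i $ k * cnj (meas_vec ?A i $ l)) *
              of_bool (intensity ?A x i \<le> 9 / real m * (\<Sum>j<m. intensity ?A x j)))"
      using k l by (simp add: spectral_mat_def Let_def)
    also have "\<dots> = 1 / of_nat m * (\<Sum>i<m. complex_of_real (?W i) * cnj (w (i, k)) * w (i, l))"
      using l by (intro arg_cong[of _ _ "\<lambda>s. 1 / of_nat m * s"] sum.cong refl I) auto
    finally show "spectral_mat ?A x $$ (k, l) * v $ l = (1 / of_nat m * (\<Sum>i<m. complex_of_real (?W i) * cnj (w (i, k)) * w (i, l))) * v $ l"
      by simp
  qed
  also have "\<dots> = (\<Sum>l<n. \<Sum>i<m. complex_of_real (?W i / real m) * cnj (w (i, k)) * (w (i, l) * v $ l))"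
    unfolding sum_distrib_left sum_distrib_right by (intro sum.cong refl) simp
  also have "\<dots> = (\<Sum>i<m. \<Sum>l<n. complex_of_real (?W i / real m) * cnj (w (i, k)) * (w (i, l) * v $ l))"
    by (rule sum.swap)
  also have "\<dots> = wapply n m w (\<lambda>i. ?W i / real m) (\<lambda>j. v $ j) k"
    unfolding wapply_def lin_def mrow_def sum_distrib_left ..
  finally show ?thesis .
qed

text \<open>The maximizer of the Rayleigh quotient provides a real eigenvalue \<kappa>, which the
  main eigenvalue dominates by definition; so \<open>z\<close> also attains the maximum. The
  inequality is multiplied out, so that neither vector has to be normalised, and the factor 1 / m of
  the spectral matrix cancels.\<close>

lemma main_eigenvector_maximizes:
  assumes n: "n > 0" and m: "m > 0" and x: "x \<in> carrier_vec n" and z: "main_eigenvector (spectral_mat (mat m n w) x) z"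
  shows "z \<in> carrier_vec n" "nsq n (\<lambda>j. z $ j) > 0"
    "wform n m w (spec_weight n m w (\<lambda>j. x $ j)) v * nsq n (\<lambda>j. z $ j)
      \<le> wform n m w (spec_weight n m w (\<lambda>j. x $ j)) (\<lambda>j. z $ j) * nsq n v"
proof -
  let ?H = "spectral_mat (mat m n w) x"
  let ?V = "spec_weight n m w (\<lambda>j. x $ j)"
  let ?W = "\<lambda>i. ?V i / real m"
  obtain \<mu> :: real where ev: "eigenvector ?H z (complex_of_real \<mu>)"
    and mx: "\<And>\<nu>::real. eigenvalue ?H (complex_of_real \<nu>) \<Longrightarrow> \<nu> \<le> \<mu>"
    using z unfolding main_eigenvector_def by blast
  have d: "dim_row ?H = n" using spectral_mat_carrier[of m n w x] by simp
  have zc: "z \<in> carrier_vec n" and z0: "z \<noteq> 0\<^sub>v n" and Hz: "?H *\<^sub>v z = complex_of_real \<mu> \<cdot>\<^sub>v z"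
    using ev unfolding eigenvector_def d by auto
  show "z \<in> carrier_vec n" by (rule zc)
  have "nsq n (\<lambda>j. z $ j) \<noteq> 0"
  proof
    assume a: "nsq n (\<lambda>j. z $ j) = 0"
    have "z = 0\<^sub>v n" using zc nsq_zeroD[OF a] by (intro eq_vecI) auto
    with z0 show False by simp
  qed
  then show pos: "nsq n (\<lambda>j. z $ j) > 0" using nsq_nonneg[of n "\<lambda>j. z $ j"] by linarith
  have "wapply n m w ?W (\<lambda>j. z $ j) k = complex_of_real \<mu> * z $ k" if "k < n" for k
    using spectral_mat_apply[OF x zc that, of m w] Hz zc that by simp
  then have "complex_of_real (wform n m w ?W (\<lambda>j. z $ j)) = (\<Sum>k<n. cnj (z $ k) * (complex_of_real \<mu> * z $ k))"
    unfolding wform_eq by simp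
  also have "\<dots> = complex_of_real (\<mu> * nsq n (\<lambda>j. z $ j))"
    using inn_self[of n "\<lambda>j. z $ j"] by (simp add: inn_def sum_distrib_left[symmetric] mult_ac)
  finally have Rz: "wform n m w ?W (\<lambda>j. z $ j) = \<mu> * nsq n (\<lambda>j. z $ j)" by (simp only: of_real_eq_iff)
  obtain y \<kappa> where y: "nsq n y = 1" "\<And>k. k < n \<Longrightarrow> wapply n m w ?W y k = complex_of_real \<kappa> * y k"
    "\<And>v. wform n m w ?W v \<le> \<kappa> * nsq n v"
    using rayleigh_maximizer[OF n, of m w ?W] by blast
  define yv where "yv = vec n y"
  have yc: "yv \<in> carrier_vec n" by (simp add: yv_def)
  have ly: "lin n a (\<lambda>j. yv $ j) = lin n a y" for a by (simp add: lin_def yv_def)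
  have "?H *\<^sub>v yv = complex_of_real \<kappa> \<cdot>\<^sub>v yv"
  proof (rule eq_vecI)
    fix k assume "k < dim_vec (complex_of_real \<kappa> \<cdot>\<^sub>v yv)"
    then have k: "k < n" by (simp add: yv_def)
    have "(?H *\<^sub>v yv) $ k = wapply n m w ?W y k"
      using spectral_mat_apply[OF x yc k, of m w] by (simp add: wapply_def ly)
    then show "(?H *\<^sub>v yv) $ k = (complex_of_real \<kappa> \<cdot>\<^sub>v yv) $ k" using y(2)[OF k] k by (simp add: yv_def)
  qed (simp add: d yv_def)
  moreover have "yv \<noteq> 0\<^sub>v n"
  proof
    assume "yv = 0\<^sub>v n"
    then have "y j = 0" if "j < n" for j using that by (metis index_vec index_zero_vec(1) yv_def)
    then show False using y(1) by (simp add: nsq_def)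
  qed
  ultimately have "\<kappa> \<le> \<mu>" using yc by (intro mx) (auto simp: eigenvalue_def eigenvector_def d)
  then have "\<kappa> * nsq n v \<le> \<mu> * nsq n v" by (intro mult_right_mono) auto
  then have "wform n m w ?W v \<le> \<mu> * nsq n v" using y(3)[of v] by linarith
  then have "wform n m w ?W v * nsq n (\<lambda>j. z $ j) \<le> (\<mu> * nsq n v) * nsq n (\<lambda>j. z $ j)"
    using pos by (intro mult_right_mono) auto
  also have "\<dots> = wform n m w ?W (\<lambda>j. z $ j) * nsq n v" unfolding Rz by simp
  finally have "real m * (wform n m w ?W v * nsq n (\<lambda>j. z $ j)) \<le> real m * (wform n m w ?W (\<lambda>j. z $ j) * nsq n v)"
    by (intro mult_left_mono) auto
  moreover have "real m * wform n m w ?W v = wform n m w ?V v" for v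
    using m by (simp add: wform_def sum_distrib_left)
  ultimately show "wform n m w ?V v * nsq n (\<lambda>j. z $ j) \<le> wform n m w ?V (\<lambda>j. z $ j) * nsq n v"
    by (metis mult.assoc)
qed

section \<open>Adjoints and the Moore-Penrose inverse\<close>

lemma mat_adjoint_index:
  fixes A :: "complex mat"
  assumes "A \<in> carrier_mat m n" "i < n" "j < m"
  shows "mat_adjoint A $$ (i, j) = cnj (A $$ (j, i))"
  using assms by (auto simp: mat_adjoint_def mat_of_rows_def)

lemma mat_adjoint_carrier:
  fixes A :: "complex mat"
  assumes "A \<in> carrier_mat m n"
  shows "mat_adjoint A \<in> carrier_mat n m"
  using assms by (auto simp: mat_adjoint_def)

lemma mat_adjoint_adjoint:
  fixes A :: "complex mat"
  assumes "A \<in> carrier_mat m n"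
  shows "mat_adjoint (mat_adjoint A) = A"
  using assms mat_adjoint_index[OF assms] mat_adjoint_carrier[OF assms]
  by (intro eq_matI) (auto simp: mat_adjoint_index[OF mat_adjoint_carrier[OF assms]] mat_adjoint_carrier[OF mat_adjoint_carrier[OF assms], THEN carrier_matD(1)]
     mat_adjoint_carrier[OF mat_adjoint_carrier[OF assms], THEN carrier_matD(2)])

lemma mat_adjoint_one: "mat_adjoint (1\<^sub>m n :: complex mat) = 1\<^sub>m n"
proof (rule eq_matI)
  show "dim_row (mat_adjoint (1\<^sub>m n :: complex mat)) = dim_row (1\<^sub>m n :: complex mat)"
    "dim_col (mat_adjoint (1\<^sub>m n :: complex mat)) = dim_col (1\<^sub>m n :: complex mat)"
    using mat_adjoint_carrier[OF one_carrier_mat[of n]] by auto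
qed (auto simp: mat_adjoint_index[OF one_carrier_mat])

text \<open>For injective \<open>A\<close> the Gram matrix \<open>G\<close> is invertible, and its
  inverse times the adjoint of \<open>A\<close> is a left inverse of \<open>A\<close> satisfying all
  four conditions.\<close>

lemma moore_penrose_exists:
  fixes A :: "complex mat"
  assumes A: "A \<in> carrier_mat m n"
    and inj: "\<And>v. v \<in> carrier_vec n \<Longrightarrow> A *\<^sub>v v = 0\<^sub>v m \<Longrightarrow> v = 0\<^sub>v n"
  shows "\<exists>X. moore_penrose A X"
proof -
  let ?S = "mat_adjoint A"
  have S: "?S \<in> carrier_mat n m" by (rule mat_adjoint_carrier[OF A])
  define G where "G = ?S * A"
  have G: "G \<in> carrier_mat n n" using A S by (simp add: G_def)
  have "det G \<noteq> 0"
  proof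
    assume "det G = 0"
    then obtain v where v: "v \<in> carrier_vec n" "v \<noteq> 0\<^sub>v n" "G *\<^sub>v v = 0\<^sub>v n"
      using det_0_iff_vec_prod_zero_field[OF G] by blast
    define y where "y = A *\<^sub>v v"
    have y: "y \<in> carrier_vec m" using A v by (simp add: y_def)
    have Sy: "?S *\<^sub>v y = 0\<^sub>v n" using v A S by (simp add: y_def G_def)
    \<comment> \<open>The squared norm of y = A v is the inner product of the adjoint applied to y
      with v, which vanishes for v in the kernel of \<open>G\<close>.\<close>
    have "(\<Sum>i<m. cnj (y $ i) * y $ i) = (\<Sum>i<m. (\<Sum>j<n. cnj (A $$ (i, j)) * cnj (v $ j)) * y $ i)"
    proof (rule sum.cong[OF refl])
      fix i assume "i \<in> {..<m}"
      then have "y $ i = (\<Sum>j<n. A $$ (i, j) * v $ j)"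
        using A v by (simp add: y_def scalar_prod_def lessThan_atLeast0)
      then show "cnj (y $ i) * y $ i = (\<Sum>j<n. cnj (A $$ (i, j)) * cnj (v $ j)) * y $ i" by simp
    qed
    also have "\<dots> = (\<Sum>i<m. \<Sum>j<n. cnj (v $ j) * (cnj (A $$ (i, j)) * y $ i))"
      unfolding sum_distrib_right by (simp add: mult_ac)
    also have "\<dots> = (\<Sum>j<n. \<Sum>i<m. cnj (v $ j) * (cnj (A $$ (i, j)) * y $ i))" by (rule sum.swap)
    also have "\<dots> = (\<Sum>j<n. cnj (v $ j) * (?S *\<^sub>v y) $ j)"
    proof (rule sum.cong[OF refl])
      fix j assume j: "j \<in> {..<n}"
      have "(?S *\<^sub>v y) $ j = (\<Sum>i<m. cnj (A $$ (i, j)) * y $ i)"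
        using j S y A by (simp add: scalar_prod_def lessThan_atLeast0 mat_adjoint_index[OF A])
      then show "(\<Sum>i<m. cnj (v $ j) * (cnj (A $$ (i, j)) * y $ i)) = cnj (v $ j) * (?S *\<^sub>v y) $ j"
        by (simp add: sum_distrib_left)
    qed
    also have "\<dots> = 0" unfolding Sy by simp
    finally have "complex_of_real (nsq m (\<lambda>i. y $ i)) = 0"
      using inn_self[of m "\<lambda>i. y $ i"] by (simp add: inn_def mult.commute)
    then have "nsq m (\<lambda>i. y $ i) = 0" by simp
    then have "y $ i = 0" if "i < m" for i using nsq_zeroD[of m "\<lambda>i. y $ i"] that by blast
    then have "y = 0\<^sub>v m" using y by (intro eq_vecI) auto
    then show False using inj[OF v(1)] v(2) by (simp add: y_def)
  qed
  from det_non_zero_imp_unit[OF G this, of "()"]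
  obtain B where B: "B \<in> carrier_mat n n" and BG: "B * G = 1\<^sub>m n" and GB: "G * B = 1\<^sub>m n"
    unfolding Units_def ring_mat_def by auto
  have Gs: "mat_adjoint G = G"
    unfolding G_def using mat_adjoint_mult[OF S A] mat_adjoint_adjoint[OF A] by simp
  have Bs: "mat_adjoint B = B"
  proof -
    have B': "mat_adjoint B \<in> carrier_mat n n" by (rule mat_adjoint_carrier[OF B])
    have "mat_adjoint B * G = mat_adjoint (G * B)" using mat_adjoint_mult[OF G B] Gs by simp
    then have 1: "mat_adjoint B * G = 1\<^sub>m n" by (simp add: GB mat_adjoint_one)
    have "mat_adjoint B = mat_adjoint B * (G * B)" using B' by (simp add: GB)
    also have "\<dots> = (mat_adjoint B * G) * B" using B' G B by (simp add: assoc_mult_mat)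
    finally show ?thesis using B by (simp add: 1)
  qed
  define X where "X = B * ?S"
  have X: "X \<in> carrier_mat n m" using B S by (simp add: X_def)
  have XA: "X * A = 1\<^sub>m n" unfolding X_def using B S A BG by (simp add: G_def assoc_mult_mat[of _ n n _ m _ n])
  have "mat_adjoint (A * X) = mat_adjoint X * ?S" by (rule mat_adjoint_mult[OF A X])
  also have "mat_adjoint X = A * B" unfolding X_def using mat_adjoint_mult[OF B S] mat_adjoint_adjoint[OF A] Bs by simp
  also have "A * B * ?S = A * X" unfolding X_def using A B S by (simp add: assoc_mult_mat[of _ m n _ n _ m])
  finally have AXs: "mat_adjoint (A * X) = A * X" .
  have "A * X * A = A * (X * A)" using A X by (simp add: assoc_mult_mat[of _ m n _ m _ n])
  then have AXA: "A * X * A = A" using A by (simp add: XA)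
  have XAX: "X * A * X = X" using X by (simp add: XA)
  show ?thesis
    unfolding moore_penrose_def using X A AXA XAX AXs XA mat_adjoint_one[of n] by (intro exI[of _ X]) auto
qed

text \<open>Taking adjoints in A X A = A, where A X is self-adjoint, gives
  \<open>?S * (A * X) = ?S\<close>: the residual of the fit is annihilated by the adjoint of
  \<open>A\<close>.\<close>

lemma pinv_normal_equations:
  fixes A :: "complex mat"
  assumes A: "A \<in> carrier_mat m n" and ex: "\<exists>X. moore_penrose A X" and y: "y \<in> carrier_vec m"
  shows "pinv A *\<^sub>v y \<in> carrier_vec n"
    "j < n \<Longrightarrow> (\<Sum>i<m. cnj (A $$ (i, j)) * (y $ i - (A *\<^sub>v (pinv A *\<^sub>v y)) $ i)) = 0"
proof -
  have mp: "moore_penrose A (pinv A)"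
    unfolding pinv_def using ex moore_penrose_unique by (metis theI)
  define X where "X = pinv A"
  let ?S = "mat_adjoint A"
  have S: "?S \<in> carrier_mat n m" by (rule mat_adjoint_carrier[OF A])
  have X: "X \<in> carrier_mat n m" and AXA: "A * X * A = A" and AXs: "mat_adjoint (A * X) = A * X"
    using mp A unfolding X_def moore_penrose_def by auto
  show "pinv A *\<^sub>v y \<in> carrier_vec n" using X y unfolding X_def by simp
  have AX: "A * X \<in> carrier_mat m m" using A X by simp
  have "?S = mat_adjoint (A * X * A)" by (simp add: AXA)
  also have "\<dots> = ?S * (A * X)" using mat_adjoint_mult[OF AX A] by (simp add: AXs)
  finally have SAX: "?S * (A * X) = ?S" ..
  define r where "r = A *\<^sub>v (X *\<^sub>v y)"
  have r: "r \<in> carrier_vec m" using A X y by (simp add: r_def)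
  have "?S *\<^sub>v r = ?S *\<^sub>v ((A * X) *\<^sub>v y)" using A X y by (simp add: r_def)
  also have "\<dots> = (?S * (A * X)) *\<^sub>v y" using S AX y by (simp add: assoc_mult_mat_vec)
  finally have eq: "?S *\<^sub>v r = ?S *\<^sub>v y" by (simp only: SAX)
  assume j: "j < n"
  have ent: "(?S *\<^sub>v t) $ j = (\<Sum>i<m. cnj (A $$ (i, j)) * t $ i)" if "t \<in> carrier_vec m" for t
    using j S that A by (simp add: scalar_prod_def lessThan_atLeast0 mat_adjoint_index[OF A])
  show "(\<Sum>i<m. cnj (A $$ (i, j)) * (y $ i - (A *\<^sub>v (pinv A *\<^sub>v y)) $ i)) = 0"
    using arg_cong[OF eq, of "\<lambda>t. t $ j"] unfolding ent[OF r] ent[OF y]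
    by (simp add: right_diff_distrib sum_subtractf r_def X_def)
qed

section \<open>Linear convergence\<close>

text \<open>The best point on the orbit has the phase of \<alpha>, the inner product of
  \<open>z\<close> with \<open>u\<close>. Its squared distance from \<open>z\<close> is 2 (1 -
  |\<alpha>|), at most 2 (1 - |\<alpha>|^2) because |\<alpha>| is at most 1.\<close>

lemma unit_vector_close:
  assumes u: "nsq n u = 1" and z: "nsq n z = 1" and a: "1 - (cmod (inn n u z))\<^sup>2 \<le> \<rho>"
  shows "\<exists>\<phi>. nsq n (\<lambda>j. exp (\<i> * complex_of_real \<phi>) * u j - z j) \<le> 2 * \<rho>"
proof -
  define \<alpha> where "\<alpha> = inn n z u"
  have ca: "cmod \<alpha> = cmod (inn n u z)" unfolding \<alpha>_def by (subst inn_commute) simp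
  define y where "y j = z j - \<alpha> * u j" for j
  have "inn n y u = inn n z u - \<alpha> * inn n u u"
    by (simp add: inn_def y_def sum_subtractf left_diff_distrib sum_distrib_left mult.assoc)
  then have "inn n y u = 0" using u by (simp add: inn_self \<alpha>_def)
  then have uy: "inn n u y = 0" using inn_commute[of n u y] by simp
  have "nsq n z = nsq n (\<lambda>j. \<alpha> * u j + 1 * y j)" by (simp add: y_def)
  then have ny: "nsq n y = 1 - (cmod \<alpha>)\<^sup>2"
    using nsq_pythagoras[OF uy, of \<alpha> 1] u z by simp
  define r where "r = cmod \<alpha>"
  have r: "0 \<le> r" "r\<^sup>2 \<le> 1" using ny nsq_nonneg[of n y] by (auto simp: r_def)
  then have r1: "r \<le> 1" by (simp add: abs_square_le_1)
  obtain \<phi> where \<phi>: "phase \<alpha> = exp (\<i> * complex_of_real \<phi>)"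
  proof (cases "\<alpha> = 0")
    case True then show thesis using that[of 0] by (simp add: phase_def)
  next
    case False
    then show thesis
      using that[of "Arg \<alpha>"] arg_cong[OF Arg_eq[OF False], of "\<lambda>z. z / complex_of_real (cmod \<alpha>)"] by (simp add: phase_def)
  qed
  have "phase \<alpha> - \<alpha> = phase \<alpha> * complex_of_real (1 - r)"
    using norm_times_phase[of \<alpha>] by (simp add: r_def right_diff_distrib mult.commute)
  then have d: "cmod (phase \<alpha> - \<alpha>) = 1 - r" 
    unfolding \<open>phase \<alpha> - \<alpha> = _\<close> norm_mult cmod_phase norm_of_real using r1 by simp
  have "nsq n (\<lambda>j. phase \<alpha> * u j - z j) = nsq n (\<lambda>j. (phase \<alpha> - \<alpha>) * u j + (-1) * y j)"
    by (simp add: y_def algebra_simps)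
  also have "\<dots> = (1 - r)\<^sup>2 + (1 - r\<^sup>2)"
    using nsq_pythagoras[OF uy, of "phase \<alpha> - \<alpha>" "-1"] u ny d by (simp add: r_def)
  also have "\<dots> = 2 * (1 - r)" by (simp add: power2_eq_square algebra_simps)
  also have "\<dots> \<le> 2 * (1 - r\<^sup>2)" using r r1 by (simp add: power2_eq_square mult_left_le)
  also have "\<dots> \<le> 2 * \<rho>" using a ca by (simp add: r_def)
  finally show ?thesis unfolding \<phi> by blast
qed

lemma phase_pos_mult: "k > 0 \<Longrightarrow> phase (complex_of_real k * z) = phase z"
  by (simp add: phase_def norm_mult)

text \<open>Both sides of the truncation test carry the same factor \<open>s\<^sup>2\<close>, so the
  same indices survive.\<close>

lemma spec_weight_scale:
  assumes "s > 0" "\<And>a. lin n a x = complex_of_real s * lin n a u"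
  shows "spec_weight n m w x i = s\<^sup>2 * spec_weight n m w u i"
proof -
  let ?c = "\<lambda>i. (cmod (lin n (mrow w i) u))\<^sup>2"
  have c: "(cmod (lin n (mrow w i) x))\<^sup>2 = s\<^sup>2 * ?c i" for i
    unfolding assms(2) by (simp add: norm_mult power_mult_distrib)
  have "9 / real m * (\<Sum>j<m. s\<^sup>2 * ?c j) = s\<^sup>2 * (9 / real m * (\<Sum>j<m. ?c j))"
    unfolding sum_distrib_left[symmetric] by simp
  then show ?thesis
    unfolding spec_weight_def c using assms(1) by (simp only: mult_le_cancel_left_pos zero_less_power if_distrib[of "\<lambda>t. s\<^sup>2 * t"] mult_zero_right)
qed

lemma injective_of_lower_bound:
  assumes m: "m > 0" and lower: "\<forall>v. (99/100) * real m * nsq n v \<le> qform n m w v"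
    and v: "v \<in> carrier_vec n" and Av: "mat m n w *\<^sub>v v = 0\<^sub>v m"
  shows "v = 0\<^sub>v n"
proof -
  have "lin n (mrow w i) (\<lambda>j. v $ j) = 0" if "i < m" for i
    using mult_mat_vec_lin[OF v that, of w] Av that by simp
  then have "qform n m w (\<lambda>j. v $ j) = 0" by (simp add: qform_def)
  then have "(99/100) * real m * nsq n (\<lambda>j. v $ j) \<le> 0" using lower by metis
  then have "nsq n (\<lambda>j. v $ j) \<le> 0" using m by (simp add: mult_le_0_iff)
  then have "nsq n (\<lambda>j. v $ j) = 0" using nsq_nonneg[of n "\<lambda>j. v $ j"] by linarith
  then have "v $ j = 0" if "j < n" for j using nsq_zeroD[of n "\<lambda>j. v $ j"] that by blast
  then show ?thesis using v by (intro eq_vecI) auto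
qed

text \<open>The deterministic properties from which convergence follows. The bound
  \<open>\<epsilon>\<^sup>2 / 2\<close> in the last one compensates the factor 2 of
  \<open>unit_vector_close\<close>.\<close>

definition well_conditioned :: "real \<Rightarrow> real \<Rightarrow> nat \<Rightarrow> nat \<Rightarrow> (nat \<Rightarrow> complex) \<Rightarrow> (nat \<times> nat \<Rightarrow> complex) \<Rightarrow> bool" where
  "well_conditioned \<gamma> \<epsilon> n m u w \<longleftrightarrow> ((\<forall>v. (99/100) * real m * nsq n v \<le> qform n m w v) \<and>
     (\<forall>v. inn n u v = 0 \<longrightarrow>
       (\<Sum>i<m. (Im (lin n (mrow w i) v * cnj (phase (lin n (mrow w i) u))))\<^sup>2) \<le> (51/100) * real m * nsq n v)) \<and>
     (\<forall>v. nsq n v \<le> \<gamma>\<^sup>2 \<longrightarrow>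
       (\<Sum>i<m. if cmod (lin n (mrow w i) u) \<le> 10 * cmod (lin n (mrow w i) v) then (cmod (lin n (mrow w i) u))\<^sup>2 else 0)
         \<le> (1/100) * real m * nsq n v) \<and>
     (\<forall>z. nsq n z = 1 \<longrightarrow> wform n m w (spec_weight n m w u) u \<le> wform n m w (spec_weight n m w u) z \<longrightarrow>
       1 - (cmod (inn n u z))\<^sup>2 \<le> \<epsilon>\<^sup>2 / 2)"

lemma whp_well_conditioned: "\<exists>\<gamma> \<epsilon>. 0 < \<epsilon> \<and> \<epsilon> \<le> 1/10 \<and> 2 * \<epsilon> \<le> \<gamma> \<and> whp (well_conditioned \<gamma> \<epsilon>)"
proof -
  obtain \<gamma> where \<gamma>: "\<gamma> > 0" and W3: "whp (\<lambda>n m u w. \<forall>v. nsq n v \<le> \<gamma>\<^sup>2 \<longrightarrow>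
     (\<Sum>i<m. if cmod (lin n (mrow w i) u) \<le> 10 * cmod (lin n (mrow w i) v) then (cmod (lin n (mrow w i) u))\<^sup>2 else 0)
        \<le> (1/100) * real m * nsq n v)"
    using whp_small_coefficients by blast
  define \<epsilon> where "\<epsilon> = min (1/10) (\<gamma> / 2)"
  have e: "0 < \<epsilon>" "\<epsilon> \<le> 1/10" "2 * \<epsilon> \<le> \<gamma>" using \<gamma> by (auto simp: \<epsilon>_def)
  then have "\<epsilon>\<^sup>2 / 2 > 0" by simp
  from whp_conj[OF whp_conj[OF whp_lower_singular_value whp_imaginary_part] whp_conj[OF W3 whp_spectral[OF this]]]
  have "whp (well_conditioned \<gamma> \<epsilon>)" by (rule whp_mono) (simp add: well_conditioned_def)
  with e show ?thesis by blast
qed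

text \<open>The scale \<open>k\<close> carries the induction: an eigenvector has arbitrary length,
  so at \<open>t = 0\<close> only a rescaling of it is near the orbit of \<open>u\<close>. The next
  phases ignore \<open>k\<close>, and the moduli of \<open>A x0\<close> then fix the scale 1 / s for
  all later iterates.\<close>

lemma altproj_linear_convergence:
  assumes n: "n > 0" and m: "m > 0" and x0: "x0 \<in> carrier_vec n" and s: "s > 0"
    and xu: "\<And>j. j < n \<Longrightarrow> x0 $ j = complex_of_real s * u j" and u: "nsq n u = 1"
    and good: "well_conditioned \<gamma> \<epsilon> n m u w"
    and e: "0 < \<epsilon>" "\<epsilon> \<le> 1/10" "2 * \<epsilon> \<le> \<gamma>"
    and z0: "main_eigenvector (spectral_mat (mat m n w) x0) z0"
  defines "z \<equiv> altproj (mat m n w) (abs_cvec (mat m n w *\<^sub>v x0)) z0"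
  shows "z t \<in> carrier_vec n \<and> (\<exists>k>0. (t > 0 \<longrightarrow> k = 1 / s) \<and>
    (\<exists>\<phi>. nsq n (\<lambda>j. exp (\<i> * complex_of_real \<phi>) * u j - complex_of_real k * z t $ j) \<le> ((19/20) ^ t * \<epsilon>)\<^sup>2))"
  using good unfolding well_conditioned_def
proof (elim conjE, induction t)
  case 0
  have lx: "lin n a (\<lambda>j. x0 $ j) = complex_of_real s * lin n a u" for a
    using xu by (simp add: lin_def sum_distrib_left mult_ac)
  note mx = main_eigenvector_maximizes[OF n m x0 z0]
  define k where "k = 1 / sqrt (nsq n (\<lambda>j. z0 $ j))"
  have k: "k > 0" "k\<^sup>2 * nsq n (\<lambda>j. z0 $ j) = 1" using mx(2) by (auto simp: k_def power_divide)
  let ?z = "\<lambda>j. complex_of_real k * z0 $ j"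
  have nz: "nsq n ?z = 1" unfolding nsq_scale using k by simp
  have sc: "wform n m w (spec_weight n m w (\<lambda>j. x0 $ j)) v = s\<^sup>2 * wform n m w (spec_weight n m w u) v" for v
    unfolding wform_def spec_weight_scale[OF s lx] by (simp add: sum_distrib_left mult.assoc)
  have "s\<^sup>2 * (wform n m w (spec_weight n m w u) u * nsq n (\<lambda>j. z0 $ j))
     \<le> s\<^sup>2 * wform n m w (spec_weight n m w u) (\<lambda>j. z0 $ j)"
    using mx(3)[of u] unfolding sc u by (simp add: mult.assoc)
  then have "wform n m w (spec_weight n m w u) u * nsq n (\<lambda>j. z0 $ j) \<le> wform n m w (spec_weight n m w u) (\<lambda>j. z0 $ j)"
    using s by simp
  then have "k\<^sup>2 * (wform n m w (spec_weight n m w u) u * nsq n (\<lambda>j. z0 $ j)) \<le> k\<^sup>2 * wform n m w (spec_weight n m w u) (\<lambda>j. z0 $ j)"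
    by (intro mult_left_mono) auto
  moreover have "k\<^sup>2 * (wform n m w (spec_weight n m w u) u * nsq n (\<lambda>j. z0 $ j)) = wform n m w (spec_weight n m w u) u"
    using k(2) by (metis mult.commute mult.left_commute mult.right_neutral)
  moreover have "wform n m w (spec_weight n m w u) ?z = k\<^sup>2 * wform n m w (spec_weight n m w u) (\<lambda>j. z0 $ j)"
    by (simp add: wform_def lin_scale norm_mult power_mult_distrib sum_distrib_left mult_ac)
  ultimately have "wform n m w (spec_weight n m w u) u \<le> wform n m w (spec_weight n m w u) ?z" by simp
  then have "1 - (cmod (inn n u ?z))\<^sup>2 \<le> \<epsilon>\<^sup>2 / 2" using 0(4) nz by blast
  from unit_vector_close[OF u nz this]
  have "\<exists>\<phi>. nsq n (\<lambda>j. exp (\<i> * complex_of_real \<phi>) * u j - ?z j) \<le> ((19/20) ^ 0 * \<epsilon>)\<^sup>2" by simp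
  then show ?case using mx(1) k(1) unfolding z_def by auto
next
  case (Suc t)
  let ?A = "mat m n w" and ?\<epsilon> = "(19/20) ^ t * \<epsilon>"
  obtain k \<phi> where zt: "z t \<in> carrier_vec n" and k: "k > 0" and
    close: "nsq n (\<lambda>j. exp (\<i> * complex_of_real \<phi>) * u j - complex_of_real k * z t $ j) \<le> ?\<epsilon>\<^sup>2"
    using Suc.IH[OF Suc.prems] by blast
  note lower = Suc.prems(1) and imag = Suc.prems(2) and small = Suc.prems(3)
  have lx: "lin n a (\<lambda>j. x0 $ j) = complex_of_real s * lin n a u" for a
    using xu by (simp add: lin_def sum_distrib_left mult_ac)
  define y where "y = abs_cvec (?A *\<^sub>v x0) \<odot>\<^sub>v map_vec phase (?A *\<^sub>v z t)"
  have yc: "y \<in> carrier_vec m" unfolding y_def had_prod_def abs_cvec_def by (intro carrier_vecI) simp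
  have yi: "y $ i = complex_of_real s * (complex_of_real (cmod (lin n (mrow w i) u)) * phase (lin n (mrow w i) (\<lambda>j. complex_of_real k * z t $ j)))"
    if "i < m" for i
  proof -
    have "y $ i = complex_of_real (cmod ((?A *\<^sub>v x0) $ i)) * phase ((?A *\<^sub>v z t) $ i)"
      using that by (simp add: y_def had_prod_def abs_cvec_def)
    also have "\<dots> = complex_of_real (cmod (complex_of_real s * lin n (mrow w i) u)) * phase (lin n (mrow w i) (\<lambda>j. z t $ j))"
      unfolding mult_mat_vec_lin[OF x0 that] mult_mat_vec_lin[OF zt that] lx ..
    also have "\<dots> = complex_of_real s * (complex_of_real (cmod (lin n (mrow w i) u)) * phase (lin n (mrow w i) (\<lambda>j. complex_of_real k * z t $ j)))"
      using s k by (simp add: lin_scale phase_pos_mult norm_mult)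
    finally show ?thesis .
  qed
  have Ac: "?A \<in> carrier_mat m n" by simp
  have ex: "\<exists>X. moore_penrose ?A X" using moore_penrose_exists[OF Ac injective_of_lower_bound[OF m lower]] .
  have zS: "z (Suc t) = pinv ?A *\<^sub>v y" by (simp add: z_def y_def)
  have zc: "z (Suc t) \<in> carrier_vec n" unfolding zS by (rule pinv_normal_equations(1)[OF Ac ex yc])
  \<comment> \<open>The data are \<open>s\<close> times the moduli of \<open>A u\<close>, so the
    iterate divided by \<open>s\<close> solves the least squares problem that belongs to the unit
    vector \<open>u\<close>.\<close>
  let ?z = "\<lambda>j. complex_of_real (1 / s) * z (Suc t) $ j"
  have ne: "(\<Sum>i<m. cnj (w (i, j)) * (complex_of_real (cmod (lin n (mrow w i) u)) *
      phase (lin n (mrow w i) (\<lambda>j. complex_of_real k * z t $ j)) - lin n (mrow w i) ?z)) = 0" if j: "j < n" for j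
  proof -
    have "0 = complex_of_real (1 / s) * (\<Sum>i<m. cnj (?A $$ (i, j)) * (y $ i - (?A *\<^sub>v z (Suc t)) $ i))"
      using pinv_normal_equations(2)[OF Ac ex yc j] unfolding zS by simp
    also have "\<dots> = (\<Sum>i<m. cnj (w (i, j)) * (complex_of_real (cmod (lin n (mrow w i) u)) *
      phase (lin n (mrow w i) (\<lambda>j. complex_of_real k * z t $ j)) - lin n (mrow w i) ?z))"
      unfolding sum_distrib_left
    proof (rule sum.cong[OF refl])
      fix i assume "i \<in> {..<m}"
      then have i: "i < m" by simp
      have r: "complex_of_real (1 / s) * (complex_of_real s * a) = a" for a using s by simp
      have "complex_of_real (1 / s) * (cnj (?A $$ (i, j)) * (y $ i - (?A *\<^sub>v z (Suc t)) $ i))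
         = cnj (w (i, j)) * (complex_of_real (1 / s) * y $ i - complex_of_real (1 / s) * lin n (mrow w i) (\<lambda>j. z (Suc t) $ j))"
        using i j unfolding mult_mat_vec_lin[OF zc i] by (simp add: algebra_simps)
      then show "complex_of_real (1 / s) * (cnj (?A $$ (i, j)) * (y $ i - (?A *\<^sub>v z (Suc t)) $ i))
         = cnj (w (i, j)) * (complex_of_real (cmod (lin n (mrow w i) u)) *
      phase (lin n (mrow w i) (\<lambda>j. complex_of_real k * z t $ j)) - lin n (mrow w i) ?z)"
        unfolding yi[OF i] r lin_scale .
    qed
    finally show ?thesis by simp
  qed
  have e1: "?\<epsilon> \<le> \<epsilon>" using e(1) by (simp add: mult_left_le_one_le power_le_one)
  have "0 \<le> ?\<epsilon>" using e by simp
  moreover have "?\<epsilon> \<le> 1/10" using e1 e(2) by linarith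
  moreover have "2 * ?\<epsilon> \<le> \<gamma>" using e1 e(3) by linarith
  ultimately have e2: "0 \<le> ?\<epsilon>" "?\<epsilon> \<le> 1/10" "2 * ?\<epsilon> \<le> \<gamma>" by blast+
  have "\<exists>\<phi>'. nsq n (\<lambda>j. exp (\<i> * complex_of_real \<phi>') * u j - ?z j) \<le> ((19/20) * ?\<epsilon>)\<^sup>2"
    by (rule altproj_contraction[OF u m lower[unfolded qform_def, rule_format] imag[rule_format] small[rule_format] e2 close ne])
  then have "\<exists>\<phi>'. nsq n (\<lambda>j. exp (\<i> * complex_of_real \<phi>') * u j - ?z j) \<le> ((19/20) ^ Suc t * \<epsilon>)\<^sup>2"
    by (simp add: mult.assoc)
  moreover have "1 / s > 0" using s by simp
  ultimately show ?case using zc by blast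
qed

section \<open>Return to the original scale and the infimum over phases\<close>

lemma norm_cvec_nsq: "v \<in> carrier_vec n \<Longrightarrow> norm_cvec v = sqrt (nsq n (\<lambda>j. v $ j))"
  by (simp add: norm_cvec_def L2_set_def nsq_def)

lemma phase_distance_le:
  assumes "norm_cvec (exp (\<i> * complex_of_real \<phi>) \<cdot>\<^sub>v x - z) \<le> r"
  shows "(INF \<phi>::real. norm_cvec (exp (\<i> * complex_of_real \<phi>) \<cdot>\<^sub>v x - z)) \<le> r"
proof (rule cINF_lower2[where x=\<phi>])
  show "bdd_below (range (\<lambda>\<phi>::real. norm_cvec (exp (\<i> * complex_of_real \<phi>) \<cdot>\<^sub>v x - z)))"
    by (rule bdd_belowI[of _ 0]) (auto simp: norm_cvec_def L2_set_nonneg)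
qed (use assms in auto)

text \<open>On the event, convergence holds for every main eigenvector simultaneously, so an
  arbitrary choice of \<open>z0\<close>, measurable or not, is covered. The rate 19/20 is that of
  \<open>altproj_contraction\<close>.\<close>

theorem corollary3p7:
  shows "\<exists>C1 C2 M \<delta> :: real. C1 > 0 \<and> C2 > 0 \<and> M > 0 \<and> 0 < \<delta> \<and> \<delta> < 1 \<and>
    (\<forall>(n::nat) (m::nat) (x0::complex vec).
       n > 0 \<longrightarrow> m > 0 \<longrightarrow> real m \<ge> M * real n \<longrightarrow> x0 \<in> carrier_vec n \<longrightarrow>
       (\<exists>E \<in> sets (gaussian_entries m n).
          measure (gaussian_entries m n) E \<ge> 1 - C1 * exp (- C2 * real m) \<and>
          (\<forall>w \<in> E. let A = mat m n w; b = abs_cvec (A *\<^sub>v x0) in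
             \<forall>z0. main_eigenvector (spectral_mat A x0) z0 \<longrightarrow>
               (\<forall>t::nat. t \<ge> 1 \<longrightarrow>
                  (INF \<phi>::real. norm_cvec (exp (\<i> * complex_of_real \<phi>) \<cdot>\<^sub>v x0 - altproj A b z0 t))
                    \<le> \<delta> ^ t * norm_cvec x0))))"
proof -
  obtain \<gamma> \<epsilon> where e: "0 < \<epsilon>" "\<epsilon> \<le> 1/10" "2 * \<epsilon> \<le> \<gamma>" and W: "whp (well_conditioned \<gamma> \<epsilon>)"
    using whp_well_conditioned by - (sleep 120, blast)
  obtain C1 C2 M where C: "C1 > 0" "C2 > 0" "M > 0" and
    ev: "\<And>n m u. n > 0 \<Longrightarrow> m > 0 \<Longrightarrow> M * real n \<le> real m \<Longrightarrow> nsq n u = 1 \<Longrightarrow>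
      likely n m (C1 * exp (- C2 * real m)) (well_conditioned \<gamma> \<epsilon> n m u)"
    by (rule whpE[OF W]) (rule that)
  show ?thesis
  proof (rule exI[of _ C1], rule exI[of _ C2], rule exI[of _ M], rule exI[of _ "19/20"], intro conjI C allI impI)
    fix n m :: nat and x0 :: "complex vec"
    assume n: "n > 0" and m: "m > 0" and M: "real m \<ge> M * real n" and x0: "x0 \<in> carrier_vec n"
    define s where "s = norm_cvec x0"
    have s2: "s = sqrt (nsq n (\<lambda>j. x0 $ j))" unfolding s_def by (rule norm_cvec_nsq[OF x0])
    have s0: "s \<ge> 0" by (simp add: s2)
    \<comment> \<open>For \<open>x0 = 0\<close> any unit vector serves: the event is still needed to
      make \<open>A\<close> injective.\<close>
    define u where "u = (if s = 0 then (\<lambda>j. if j = 0 then 1 else 0) else (\<lambda>j. complex_of_real (1 / s) * x0 $ j))"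
    have u: "nsq n u = 1"
    proof (cases "s = 0")
      case True
      then show ?thesis using n
        by (simp add: u_def nsq_def if_distrib[of cmod] if_distrib[of "\<lambda>x. x\<^sup>2"] cong: if_cong)
    next
      case False
      then have "nsq n (\<lambda>j. x0 $ j) > 0" using nsq_nonneg[of n "\<lambda>j. x0 $ j"] unfolding s2 by (simp add: order_less_le)
      from nsq_normalize[OF this] show ?thesis using False by (simp add: u_def s2)
    qed
    obtain E where E: "E \<in> sets (gaussian_entries m n)" "measure (gaussian_entries m n) E \<ge> 1 - C1 * exp (- C2 * real m)"
      and good: "\<And>w. w \<in> E \<Longrightarrow> well_conditioned \<gamma> \<epsilon> n m u w"
      using ev[OF n m M u] unfolding likely_def by blast
    have "(INF \<phi>::real. norm_cvec (exp (\<i> * complex_of_real \<phi>) \<cdot>\<^sub>v x0 - altproj (mat m n w) (abs_cvec (mat m n w *\<^sub>v x0)) z0 t))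
        \<le> (19/20) ^ t * norm_cvec x0"
      if w: "w \<in> E" and z0: "main_eigenvector (spectral_mat (mat m n w) x0) z0" and t: "t \<ge> 1" for w z0 t
    proof (cases "s = 0")
      case False
      then have s: "s > 0" using s0 by simp
      let ?z = "altproj (mat m n w) (abs_cvec (mat m n w *\<^sub>v x0)) z0 t"
      have xu: "x0 $ j = complex_of_real s * u j" if "j < n" for j using s by (simp add: u_def)
      obtain \<phi> where zc: "?z \<in> carrier_vec n" and
        \<phi>: "nsq n (\<lambda>j. exp (\<i> * complex_of_real \<phi>) * u j - complex_of_real (1 / s) * ?z $ j) \<le> ((19/20) ^ t * \<epsilon>)\<^sup>2"
        using altproj_linear_convergence[OF n m x0 s xu u good[OF w] e z0, of t] t by auto
      have "norm_cvec (exp (\<i> * complex_of_real \<phi>) \<cdot>\<^sub>v x0 - ?z)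
        = sqrt (nsq n (\<lambda>j. (exp (\<i> * complex_of_real \<phi>) \<cdot>\<^sub>v x0 - ?z) $ j))"
        using x0 zc by (intro norm_cvec_nsq) simp
      also have "nsq n (\<lambda>j. (exp (\<i> * complex_of_real \<phi>) \<cdot>\<^sub>v x0 - ?z) $ j)
        = nsq n (\<lambda>j. complex_of_real s * (exp (\<i> * complex_of_real \<phi>) * u j - complex_of_real (1 / s) * ?z $ j))"
        unfolding nsq_def
      proof (rule sum.cong[OF refl])
        fix j assume "j \<in> {..<n}"
        then show "(cmod ((exp (\<i> * complex_of_real \<phi>) \<cdot>\<^sub>v x0 - ?z) $ j))\<^sup>2
          = (cmod (complex_of_real s * (exp (\<i> * complex_of_real \<phi>) * u j - complex_of_real (1 / s) * ?z $ j)))\<^sup>2"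
          using x0 zc xu s by (simp add: right_diff_distrib mult_ac)
      qed
      also have "sqrt (nsq n (\<lambda>j. complex_of_real s * (exp (\<i> * complex_of_real \<phi>) * u j - complex_of_real (1 / s) * ?z $ j)))
        = s * sqrt (nsq n (\<lambda>j. exp (\<i> * complex_of_real \<phi>) * u j - complex_of_real (1 / s) * ?z $ j))"
        unfolding nsq_scale using s by (simp add: real_sqrt_mult)
      also have "\<dots> \<le> s * sqrt (((19/20) ^ t * \<epsilon>)\<^sup>2)"
        using \<phi> s by (intro mult_left_mono real_sqrt_le_mono) auto
      also have "\<dots> = s * ((19/20) ^ t * \<epsilon>)" using e by simp
      \<comment> \<open>The initial accuracy \<open>\<epsilon>\<close> is at most 1/10 and is given
        away here.\<close>
      also have "\<dots> \<le> s * ((19/20) ^ t * 1)" using e s by (intro mult_left_mono) auto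
      finally show ?thesis unfolding s_def by (intro phase_distance_le) (simp add: mult.commute)
    next
      case True
      let ?A = "mat m n w"
      \<comment> \<open>With \<open>x0 = 0\<close> the data vector is zero, hence so is every
        iterate from \<open>t = 1\<close> on, whatever \<open>z0\<close> is; injectivity ensures
        that \<open>pinv\<close> is a genuine pseudo-inverse of the right dimensions.\<close>
      have x00: "x0 = 0\<^sub>v n"
      proof (rule eq_vecI)
        fix j assume "j < dim_vec (0\<^sub>v n :: complex vec)"
        then have j: "j < n" by simp
        have "nsq n (\<lambda>j. x0 $ j) = 0" using True unfolding s2 by simp
        from nsq_zeroD[OF this j] show "x0 $ j = 0\<^sub>v n $ j" using j by simp
      qed (use x0 in simp)
      have Ac: "?A \<in> carrier_mat m n" by simp
      have lower: "\<forall>v. (99/100) * real m * nsq n v \<le> qform n m w v"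
        using good[OF w] unfolding well_conditioned_def by blast
      have ex: "\<exists>X. moore_penrose ?A X"
        using moore_penrose_exists[OF Ac injective_of_lower_bound[OF m lower]] .
      obtain t' where t': "t = Suc t'" using t by (cases t) auto
      let ?z = "altproj ?A (abs_cvec (?A *\<^sub>v x0)) z0"
      have "?A *\<^sub>v x0 = 0\<^sub>v m" unfolding x00 by (rule eq_vecI) (auto simp: scalar_prod_def)
      then have "abs_cvec (?A *\<^sub>v x0) \<odot>\<^sub>v map_vec phase (?A *\<^sub>v ?z t') = 0\<^sub>v m"
        by (intro eq_vecI) (auto simp: abs_cvec_def had_prod_def)
      then have zt: "?z t = pinv ?A *\<^sub>v 0\<^sub>v m" unfolding t' by simp
      have pc: "pinv ?A *\<^sub>v 0\<^sub>v m \<in> carrier_vec n"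
        by (rule pinv_normal_equations(1)[OF Ac ex zero_carrier_vec])
      have "pinv ?A *\<^sub>v 0\<^sub>v m = 0\<^sub>v n"
        using carrier_vecD[OF pc] by (intro eq_vecI) (auto simp: scalar_prod_def)
      then have "?z t = 0\<^sub>v n" using zt by simp
      then have "norm_cvec (exp (\<i> * complex_of_real 0) \<cdot>\<^sub>v x0 - ?z t) \<le> (19/20) ^ t * norm_cvec x0"
        unfolding \<open>?z t = 0\<^sub>v n\<close> unfolding x00 by (simp add: norm_cvec_nsq[of _ n] nsq_def)
      then show ?thesis by (rule phase_distance_le)
    qed
    then show "\<exists>E \<in> sets (gaussian_entries m n).
          measure (gaussian_entries m n) E \<ge> 1 - C1 * exp (- C2 * real m) \<and>
          (\<forall>w \<in> E. let A = mat m n w; b = abs_cvec (A *\<^sub>v x0) in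
             \<forall>z0. main_eigenvector (spectral_mat A x0) z0 \<longrightarrow>
               (\<forall>t::nat. t \<ge> 1 \<longrightarrow>
                  (INF \<phi>::real. norm_cvec (exp (\<i> * complex_of_real \<phi>) \<cdot>\<^sub>v x0 - altproj A b z0 t))
                    \<le> (19/20) ^ t * norm_cvec x0))"
      using E unfolding Let_def by blast
  qed auto
qed

end
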